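(* In the algorithm setup, assume Property (P2). Then for every $1\le\ell\le L$, every pseudo-Lipschitz $\psi:\mathbb R^\ell\to\mathbb R$, every variable $i$ and factor $a\in\partial i$, $$\mathbb E\big[\psi(u^1_{i\to a},\dots,u^\ell_{i\to a})\big]=\mathbb E[\psi(U_1,\dots,U_\ell)]+o_d(1),\qquad \mathbb E\big[\psi(u^1_{i},\dots,u^\ell_{i})\big]=\mathbb E[\psi(U_1,\dots,U_\ell)]+o_d(1),$$ where $U_1,\dots,U_\ell$ are independent with $U_s\sim\mathcal N(0,\nu_s)$.
   Context: Algorithm setup. Fix $r\ge2$ and a predicate $f:\{\pm1\}^r\to\{0,1\}$, identified with its multilinear extension $f(x)=\sum_{S\subseteq[r]}\hat f(S)\prod_{\iota\in S}x_\iota$ on $\mathbb R^r$, and assume $\hat f(S)=0$ whenever $|S|=1$. Let $\xi(s)=\sum_{j=1}^r\big(\sum_{|S|=j}\hat f(S)^2\big)s^j$. Fix $\delta>0$, let $L=\lfloor1/\delta\rfloor$, and for $\ell\ge1$ let $\nu_\ell=\big(\xi'(\ell\delta)-\xi'((\ell-1)\delta)\big)/r$. Let $G=(V,E)$ be a hypergraph whose hyperedges (factors) $a$ are ordered $r$-tuples $\partial a=(v_{a,1},\dots,v_{a,r})$ of distinct vertices (variables), which is $d$-index-regular: every variable lies in exactly $d$ factors, and for each $\iota\in[r]$ it is the $\iota$-th entry of exactly $d/r$ factors. Write $\partial i$ for the set of factors containing $i$. Assume the bipartite variable–factor incidence graph (factor graph) of $G$ has no cycle of length less than $4L+4$. For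 a factor $a$ and $j\in\partial a$, $\mathsf D_{j;a}f$ is the partial derivative of (multilinear) $f$ in the coordinate $\iota$ with $v_{a,\iota}=j$ (it does not depend on that coordinate). Fix $K>0$ and functions $F_{\to,\ell},F_\ell:\mathbb R^\ell\to[-K,K]$ for $0\le\ell\le L-1$ (constants when $\ell=0$). Randomness: $z_i^0$, $i\in V$, i.i.d. $\mathcal N(0,\delta)$; set $z^0_{i\to a}=z_i^0$, $w_i^0=w^0_{i\to a}=0$. For $\ell=0,\dots,L-1$: $A^\ell_{i\to a}=F_{\to,\ell}(u^1_{i\to a},\dots,u^\ell_{i\to a})$, $A^\ell_i=F_\ell(u^1_i,\dots,u^\ell_i)$; with $\mathbf z^\ell_{\partial b\to b}=(z^\ell_{v_{b,1}\to b},\dots,z^\ell_{v_{b,r}\to b})$, $w^{\ell+1}_{i\to a}=(d-1)^{-1/2}\sum_{b\in\partial i\setminus a}\mathsf D_{i;b}f(\mathbf z^\ell_{\partial b\to b})$, $u^{\ell+1}_{i\to a}=w^{\ell+1}_{i\to a}-w^\ell_{i\to a}$, $z^{\ell+1}_{i\to a}=z_i^0+\sum_{s=1}^{\ell+1}A^{s-1}_{i\to a}u^s_{i\to a}$; $w^{\ell+1}_i=d^{-1/2}\sum_{b\in\partial i}\mathsf D_{i;b}f(\mathbf z^\ell_{\partial b\to b})$, $u^{\ell+1}_i=w^{\ell+1}_i-w^\ell_i$, $z^{\ell+1}_i=z_i^0+\sum_{s=1}^{\ell+1}A^{s-1}_iu^s_i$. Also $\mathbf z^\ell_{\partial a}=(z^\ell_{v_{a,1}},\dots,z^\ell_{v_{a,r}})$.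 Asymptotics: $r,f,\delta,L,K$ are fixed and $d\to\infty$ along such hypergraphs (nonlinearities may depend on $d$); $O_d(g(d))$ denotes a quantity bounded in absolute value by $C g(d)$ with $C$ independent of $d$, of the hypergraph and of the chosen variables/factors; $o_d(1)$ denotes a quantity tending to $0$ as $d\to\infty$ in the same uniform sense; $\mathrm{plim}$ is limit in probability. Property (P1): for all $0\le\ell\le L-1$, variables $i$, factors $a\in\partial i$, $m\in\mathbb N$: $\mathbb E|A^\ell_i-A^\ell_{i\to a}|^m=O_d(d^{-m/2})$. Property (P2): for all such $\ell,i,a$: $\mathbb E[(A^\ell_i)^2]=\mathbb E[(A^\ell_{i\to a})^2]=\delta/\nu_{\ell+1}$. A function $\psi:\mathbb R^s\to\mathbb R$ is pseudo-Lipschitz if there is $C>0$ with $|\psi(x)-\psi(y)|\le C(1+\|x\|+\|y\|)\|x-y\|$ for all $x,y\in\mathbb R^s$. *)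

theory Defs
  imports "HOL-Probability.Probability"
begin

text \<open>Points of R^r are functions nat => real; only coordinates 0..r-1 are used.
  The cube {+-1}^r is the set of extensional functions on {..<r} with values +-1.\<close>

definition cube :: "nat \<Rightarrow> (nat \<Rightarrow> real) set" where
  "cube r = PiE {..<r} (\<lambda>_. {-1, 1})"

definition fhat :: "nat \<Rightarrow> ((nat \<Rightarrow> real) \<Rightarrow> real) \<Rightarrow> nat set \<Rightarrow> real" where
  "fhat r f S = (\<Sum>x\<in>cube r. f x * (\<Prod>\<iota>\<in>S. x \<iota>)) / 2 ^ r"

definition mlext :: "nat \<Rightarrow> ((nat \<Rightarrow> real) \<Rightarrow> real) \<Rightarrow> (nat \<Rightarrow> real) \<Rightarrow> real" where
  "mlext r f y = (\<Sum>S\<in>Pow {..<r}. fhat r f S * (\<Prod>\<iota>\<in>S. y \<iota>))"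

definition xi :: "nat \<Rightarrow> ((nat \<Rightarrow> real) \<Rightarrow> real) \<Rightarrow> real \<Rightarrow> real" where
  "xi r f s = (\<Sum>j=1..r. (\<Sum>S\<in>{S\<in>Pow {..<r}. card S = j}. (fhat r f S)\<^sup>2) * s ^ j)"

definition nu :: "nat \<Rightarrow> ((nat \<Rightarrow> real) \<Rightarrow> real) \<Rightarrow> real \<Rightarrow> nat \<Rightarrow> real" where
  "nu r f \<delta> l = (deriv (xi r f) (real l * \<delta>) - deriv (xi r f) ((real l - 1) * \<delta>)) / real r"

definition pdiff :: "nat \<Rightarrow> ((nat \<Rightarrow> real) \<Rightarrow> real) \<Rightarrow> nat \<Rightarrow> (nat \<Rightarrow> real) \<Rightarrow> real" where
  "pdiff r f \<iota> y = deriv (\<lambda>t. mlext r f (y(\<iota> := t))) (y \<iota>)"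

text \<open>Variables V, factors Fc (both sets of labels), and vtx a iota = v_{a,iota} for iota < r.\<close>

definition nbhd :: "nat \<Rightarrow> nat set \<Rightarrow> (nat \<Rightarrow> nat \<Rightarrow> nat) \<Rightarrow> nat \<Rightarrow> nat set" where
  "nbhd r Fc vtx i = {a \<in> Fc. \<exists>\<iota><r. vtx a \<iota> = i}"

definition pos :: "nat \<Rightarrow> (nat \<Rightarrow> nat \<Rightarrow> nat) \<Rightarrow> nat \<Rightarrow> nat \<Rightarrow> nat" where
  "pos r vtx a j = (THE \<iota>. \<iota> < r \<and> vtx a \<iota> = j)"

definition index_regular_hypergraph ::
  "nat \<Rightarrow> nat \<Rightarrow> nat set \<Rightarrow> nat set \<Rightarrow> (nat \<Rightarrow> nat \<Rightarrow> nat) \<Rightarrow> bool" where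
  "index_regular_hypergraph r d V Fc vtx \<longleftrightarrow>
     finite V \<and> finite Fc \<and>
     (\<forall>a\<in>Fc. (\<forall>\<iota><r. vtx a \<iota> \<in> V) \<and> inj_on (vtx a) {..<r}) \<and>
     (\<forall>i\<in>V. card (nbhd r Fc vtx i) = d \<and>
             (\<forall>\<iota><r. r * card {a\<in>Fc. vtx a \<iota> = i} = d))"

definition fg_adj :: "nat \<Rightarrow> nat set \<Rightarrow> nat set \<Rightarrow> (nat \<Rightarrow> nat \<Rightarrow> nat) \<Rightarrow>
    nat + nat \<Rightarrow> nat + nat \<Rightarrow> bool" where
  "fg_adj r V Fc vtx x y \<longleftrightarrow>
     (\<exists>i a. i \<in> V \<and> a \<in> Fc \<and> (\<exists>\<iota><r. vtx a \<iota> = i) \<and>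
        ((x = Inl i \<and> y = Inr a) \<or> (x = Inr a \<and> y = Inl i)))"

definition fg_has_cycle_of_length ::
  "nat \<Rightarrow> nat set \<Rightarrow> nat set \<Rightarrow> (nat \<Rightarrow> nat \<Rightarrow> nat) \<Rightarrow> nat \<Rightarrow> bool" where
  "fg_has_cycle_of_length r V Fc vtx k \<longleftrightarrow> 3 \<le> k \<and>
     (\<exists>xs. length xs = k \<and> distinct xs \<and>
        (\<forall>j<k. fg_adj r V Fc vtx (xs ! j) (xs ! (Suc j mod k))))"

text \<open>A nonlinearity F_k : R^k -> R is a function on extensional functions on {..<k}.\<close>

definition msg_A :: "(nat \<Rightarrow> (nat \<Rightarrow> real) \<Rightarrow> real) \<Rightarrow> (nat \<Rightarrow> nat \<Rightarrow> real) list \<Rightarrow>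
    nat \<Rightarrow> nat \<Rightarrow> nat \<Rightarrow> real" where
  "msg_A Fm ws k i a = Fm k (\<lambda>t\<in>{..<k}. (ws ! Suc t) i a - (ws ! t) i a)"

definition msg_z :: "(nat \<Rightarrow> real) \<Rightarrow> (nat \<Rightarrow> (nat \<Rightarrow> real) \<Rightarrow> real) \<Rightarrow>
    (nat \<Rightarrow> nat \<Rightarrow> real) list \<Rightarrow> nat \<Rightarrow> nat \<Rightarrow> nat \<Rightarrow> real" where
  "msg_z z0 Fm ws l i a =
     z0 i + (\<Sum>s=1..l. msg_A Fm ws (s - 1) i a * ((ws ! s) i a - (ws ! (s - 1)) i a))"

text \<open>History [w^0, ..., w^l] of the message iterates w^s_{i->a}.\<close>
primrec amp_w_msg :: "nat \<Rightarrow> ((nat \<Rightarrow> real) \<Rightarrow> real) \<Rightarrow> nat \<Rightarrow> nat set \<Rightarrow> (nat \<Rightarrow> nat \<Rightarrow> nat) \<Rightarrow>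
    (nat \<Rightarrow> (nat \<Rightarrow> real) \<Rightarrow> real) \<Rightarrow> (nat \<Rightarrow> real) \<Rightarrow> nat \<Rightarrow> (nat \<Rightarrow> nat \<Rightarrow> real) list" where
  "amp_w_msg r f d Fc vtx Fm z0 0 = [\<lambda>i a. 0]"
| "amp_w_msg r f d Fc vtx Fm z0 (Suc l) =
     (let ws = amp_w_msg r f d Fc vtx Fm z0 l in
      ws @ [\<lambda>i a. (\<Sum>b\<in>nbhd r Fc vtx i - {a}.
                 pdiff r f (pos r vtx b i) (\<lambda>\<iota>. msg_z z0 Fm ws l (vtx b \<iota>) b))
               / sqrt (real d - 1)])"

text \<open>u^s_{i->a} for s >= 1.\<close>
definition u_msg :: "nat \<Rightarrow> ((nat \<Rightarrow> real) \<Rightarrow> real) \<Rightarrow> nat \<Rightarrow> nat set \<Rightarrow> (nat \<Rightarrow> nat \<Rightarrow> nat) \<Rightarrow>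
    (nat \<Rightarrow> (nat \<Rightarrow> real) \<Rightarrow> real) \<Rightarrow> (nat \<Rightarrow> real) \<Rightarrow> nat \<Rightarrow> nat \<Rightarrow> nat \<Rightarrow> real" where
  "u_msg r f d Fc vtx Fm z0 s i a =
     (let ws = amp_w_msg r f d Fc vtx Fm z0 s in (ws ! s) i a - (ws ! (s - 1)) i a)"

definition A_msg :: "nat \<Rightarrow> ((nat \<Rightarrow> real) \<Rightarrow> real) \<Rightarrow> nat \<Rightarrow> nat set \<Rightarrow> (nat \<Rightarrow> nat \<Rightarrow> nat) \<Rightarrow>
    (nat \<Rightarrow> (nat \<Rightarrow> real) \<Rightarrow> real) \<Rightarrow> (nat \<Rightarrow> real) \<Rightarrow> nat \<Rightarrow> nat \<Rightarrow> nat \<Rightarrow> real" where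
  "A_msg r f d Fc vtx Fm z0 k i a = Fm k (\<lambda>t\<in>{..<k}. u_msg r f d Fc vtx Fm z0 (Suc t) i a)"

definition w_node :: "nat \<Rightarrow> ((nat \<Rightarrow> real) \<Rightarrow> real) \<Rightarrow> nat \<Rightarrow> nat set \<Rightarrow> (nat \<Rightarrow> nat \<Rightarrow> nat) \<Rightarrow>
    (nat \<Rightarrow> (nat \<Rightarrow> real) \<Rightarrow> real) \<Rightarrow> (nat \<Rightarrow> real) \<Rightarrow> nat \<Rightarrow> nat \<Rightarrow> real" where
  "w_node r f d Fc vtx Fm z0 s i =
     (if s = 0 then 0 else
      (let ws = amp_w_msg r f d Fc vtx Fm z0 (s - 1) in
       (\<Sum>b\<in>nbhd r Fc vtx i.
           pdiff r f (pos r vtx b i) (\<lambda>\<iota>. msg_z z0 Fm ws (s - 1) (vtx b \<iota>) b))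
       / sqrt (real d)))"

definition u_node :: "nat \<Rightarrow> ((nat \<Rightarrow> real) \<Rightarrow> real) \<Rightarrow> nat \<Rightarrow> nat set \<Rightarrow> (nat \<Rightarrow> nat \<Rightarrow> nat) \<Rightarrow>
    (nat \<Rightarrow> (nat \<Rightarrow> real) \<Rightarrow> real) \<Rightarrow> (nat \<Rightarrow> real) \<Rightarrow> nat \<Rightarrow> nat \<Rightarrow> real" where
  "u_node r f d Fc vtx Fm z0 s i =
     w_node r f d Fc vtx Fm z0 s i - w_node r f d Fc vtx Fm z0 (s - 1) i"

definition A_node :: "nat \<Rightarrow> ((nat \<Rightarrow> real) \<Rightarrow> real) \<Rightarrow> nat \<Rightarrow> nat set \<Rightarrow> (nat \<Rightarrow> nat \<Rightarrow> nat) \<Rightarrow>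
    (nat \<Rightarrow> (nat \<Rightarrow> real) \<Rightarrow> real) \<Rightarrow> (nat \<Rightarrow> (nat \<Rightarrow> real) \<Rightarrow> real) \<Rightarrow> (nat \<Rightarrow> real) \<Rightarrow>
    nat \<Rightarrow> nat \<Rightarrow> real" where
  "A_node r f d Fc vtx Fm Fn z0 k i = Fn k (\<lambda>t\<in>{..<k}. u_node r f d Fc vtx Fm z0 (Suc t) i)"

definition gauss :: "real \<Rightarrow> real measure" where
  "gauss v = (if v \<le> 0 then return borel 0 else density lborel (normal_density 0 (sqrt v)))"

definition init_measure :: "nat set \<Rightarrow> real \<Rightarrow> (nat \<Rightarrow> real) measure" where
  "init_measure V \<delta> = PiM V (\<lambda>_. gauss \<delta>)"

definition limit_measure :: "nat \<Rightarrow> ((nat \<Rightarrow> real) \<Rightarrow> real) \<Rightarrow> real \<Rightarrow> nat \<Rightarrow> (nat \<Rightarrow> real) measure" where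
  "limit_measure r f \<delta> l = PiM {..<l} (\<lambda>t. gauss (nu r f \<delta> (Suc t)))"

definition property_P2 ::
  "nat \<Rightarrow> ((nat \<Rightarrow> real) \<Rightarrow> real) \<Rightarrow> real \<Rightarrow> nat \<Rightarrow> nat \<Rightarrow> nat set \<Rightarrow> nat set \<Rightarrow>
   (nat \<Rightarrow> nat \<Rightarrow> nat) \<Rightarrow> (nat \<Rightarrow> (nat \<Rightarrow> real) \<Rightarrow> real) \<Rightarrow> (nat \<Rightarrow> (nat \<Rightarrow> real) \<Rightarrow> real) \<Rightarrow> bool" where
  "property_P2 r f \<delta> L d V Fc vtx Fm Fn \<longleftrightarrow>
     (\<forall>k<L. \<forall>i\<in>V. \<forall>a\<in>nbhd r Fc vtx i.
        (\<integral>z0. (A_node r f d Fc vtx Fm Fn z0 k i)\<^sup>2 \<partial>init_measure V \<delta>) = \<delta> / nu r f \<delta> (Suc k) \<and>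
        (\<integral>z0. (A_msg r f d Fc vtx Fm z0 k i a)\<^sup>2 \<partial>init_measure V \<delta>) = \<delta> / nu r f \<delta> (Suc k))"

definition enorm :: "nat \<Rightarrow> (nat \<Rightarrow> real) \<Rightarrow> real" where
  "enorm l x = sqrt (\<Sum>t<l. (x t)\<^sup>2)"

definition pseudo_lipschitz :: "nat \<Rightarrow> ((nat \<Rightarrow> real) \<Rightarrow> real) \<Rightarrow> bool" where
  "pseudo_lipschitz l \<psi> \<longleftrightarrow> (\<exists>C>0. \<forall>x\<in>PiE {..<l} (\<lambda>_. UNIV). \<forall>y\<in>PiE {..<l} (\<lambda>_. UNIV).
      \<bar>\<psi> x - \<psi> y\<bar> \<le> C * (1 + enorm l x + enorm l y) * enorm l (\<lambda>t. x t - y t))"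

definition admissible_nonlin :: "real \<Rightarrow> nat \<Rightarrow> (nat \<Rightarrow> (nat \<Rightarrow> real) \<Rightarrow> real) \<Rightarrow> bool" where
  "admissible_nonlin K L F \<longleftrightarrow> (\<forall>k<L. F k \<in> borel_measurable (PiM {..<k} (\<lambda>_. borel)) \<and>
      (\<forall>x\<in>PiE {..<k} (\<lambda>_. UNIV). \<bar>F k x\<bar> \<le> K))"

end

(* The neighbourhood of a message is a tree, so z_{i->a} is a martingale in the iteration index:
   every increment is orthogonal to all functions of variables outside the newly reached shell.
   Hence u^1, ..., u^l are normalised sums, over the factors at i, of independent vectors
   with uncorrelated coordinates. The average variance of coordinate s is close to nu_s because E[z^2] grows
   by delta in each step: A^2 is bounded, sum_b Y_b^2 / n concentrates around its mean by
   independence (no continuity of the nonlinearities is needed), and E[A^2] = delta / nu_s by (P2).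
   A third-order expansion of characteristic functions then gives the Gaussian limit with
   rate 1 / sqrt d, and pseudo-Lipschitz test functions are reached by Stone-Weierstrass on a box,
   fourth moments controlling the tails. *)

theory Submission
  imports Defs
begin

section \<open>Functions of disjoint coordinate sets\<close>

text \<open>The nonlinearities may change with \<open>d\<close>, so their laws need not converge and
  no induction can pass to a limit in \<open>A\<close>. The distribution of \<open>A\<close> enters
  only through |A| \<le> K and E[A^2]. All other estimates are quantitative, with constants computed
  from \<open>r\<close>, \<open>f\<close>, \<open>\<delta>\<close>, \<open>K\<close> and
  \<open>L\<close>; this makes the final threshold on \<open>d\<close> uniform over hypergraphs,
  variables, factors and nonlinearities. A second obstacle is that \<open>A\<close> and the next
  \<open>u\<close> share variables, since both reach into the same branches. The martingale property
  is therefore stated against test functions \<open>h\<close> that may depend on everything except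
  the newly reached shell, both inside and outside the ball. In this form \<open>A\<close> and the
  remaining factors of a monomial are absorbed into \<open>h\<close>, so the property reproduces
  itself from one level to the next. Girth is used in one way: if two branches of depth at most L
  met, there would be two non-backtracking walks of length at most 2L to the same root, hence a
  cycle of length at most 4L.\<close>

definition dep :: "'i set \<Rightarrow> (('i \<Rightarrow> 'b) \<Rightarrow> 'c) \<Rightarrow> bool" where
  "dep W X \<longleftrightarrow> (\<forall>z z'. (\<forall>v\<in>W. z v = z' v) \<longrightarrow> X z = X z')"

lemma dep_mono: "dep W X \<Longrightarrow> W \<subseteq> W' \<Longrightarrow> dep W' X"
  unfolding dep_def by blast

lemma dep_const: "dep W (\<lambda>_. c)"
  unfolding dep_def by simp

lemma dep_comp: "dep W X \<Longrightarrow> dep W (\<lambda>z. g (X z))"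
  unfolding dep_def by metis

lemma dep_comp2: "dep W X \<Longrightarrow> dep W Y \<Longrightarrow> dep W (\<lambda>z. g (X z) (Y z))"
  unfolding dep_def by metis

lemma dep_family:
  assumes "\<And>k. k \<in> I \<Longrightarrow> dep W (X k)"
    and "\<And>p q. (\<And>k. k \<in> I \<Longrightarrow> p k = q k) \<Longrightarrow> g p = g q"
  shows "dep W (\<lambda>z. g (\<lambda>k. X k z))"
  unfolding dep_def
proof (intro allI impI)
  fix z z' :: "'b \<Rightarrow> 'c" assume "\<forall>v\<in>W. z v = z' v"
  then show "g (\<lambda>k. X k z) = g (\<lambda>k. X k z')"
    using assms(1) unfolding dep_def by (intro assms(2)) blast
qed

lemma dep_sum: "(\<And>k. k \<in> I \<Longrightarrow> dep W (X k)) \<Longrightarrow> dep W (\<lambda>z. \<Sum>k\<in>I. X k z)"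
  by (rule dep_family[where g = "\<lambda>p. sum p I" and I = I]) (auto intro!: sum.cong)

lemma dep_prod: "(\<And>k. k \<in> I \<Longrightarrow> dep W (X k)) \<Longrightarrow> dep W (\<lambda>z. \<Prod>k\<in>I. X k z)"
  by (rule dep_family[where g = "\<lambda>p. prod p I" and I = I]) (auto intro!: prod.cong)

lemma dep_Union_sum:
  "(\<And>k. k \<in> I \<Longrightarrow> dep (W k) (X k)) \<Longrightarrow> dep (\<Union>k\<in>I. W k) (\<lambda>z. \<Sum>k\<in>I. X k z)"
  by (rule dep_sum) (blast intro: dep_mono)

lemma dep_Union_prod:
  "(\<And>k. k \<in> I \<Longrightarrow> dep (W k) (X k)) \<Longrightarrow> dep (\<Union>k\<in>I. W k) (\<lambda>z. \<Prod>k\<in>I. X k z)"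
  by (rule dep_prod) (blast intro: dep_mono)

text \<open>Fubini for the split of \<open>V\<close> into \<open>V \<inter> A\<close> and
  \<open>V - A\<close>: the second block does not move \<open>X\<close>, and the first does not move
  \<open>Y\<close> because \<open>A\<close> and \<open>B\<close> are disjoint. Since
  \<open>dep\<close> is pointwise and involves no sigma-algebra, \<open>A\<close> and
  \<open>B\<close> may reach beyond \<open>V\<close>, for instance as complements; off
  \<open>V\<close> a merged point is constantly \<open>undefined\<close>.\<close>

lemma integral_mult_dep:
  fixes X Y :: "('i \<Rightarrow> 'b) \<Rightarrow> 'c::{real_normed_field, banach, second_countable_topology}"
  assumes "finite V" and G: "\<And>i. prob_space (G i)"
    and X: "dep A X" and Y: "dep B Y" and AB: "A \<inter> B = {}"
    and int: "integrable (PiM V G) X" "integrable (PiM V G) Y"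
      "integrable (PiM V G) (\<lambda>z. X z * Y z)"
  shows "(\<integral>z. X z * Y z \<partial>PiM V G) = (\<integral>z. X z \<partial>PiM V G) * (\<integral>z. Y z \<partial>PiM V G)"
proof -
  interpret product_prob_space G by (rule product_prob_spaceI) (rule G)
  define I where "I = V \<inter> A"
  define J where "J = V - A"
  have V: "V = I \<union> J" "I \<inter> J = {}" "finite I" "finite J"
    using \<open>finite V\<close> by (auto simp: I_def J_def)
  interpret PI: prob_space "PiM I G" by (rule prob_space_PiM) (rule G)
  interpret PJ: prob_space "PiM J G" by (rule prob_space_PiM) (rule G)
  \<comment> \<open>Arbitrary points at which the irrelevant block of each function is
    frozen.\<close>
  define o1 where "o1 = (SOME x. x \<in> space (PiM I G))"
  define o2 where "o2 = (SOME x. x \<in> space (PiM J G))"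
  have fold: "(\<integral>z. H z \<partial>PiM V G) = (\<integral>x. (\<integral>y. H (merge I J (x, y)) \<partial>PiM J G) \<partial>PiM I G)"
    if "integrable (PiM V G) H" for H :: "('i \<Rightarrow> 'b) \<Rightarrow> 'c"
    using product_integral_fold[OF V(2-4)] that V(1) by metis
  have split: "X (merge I J (x, y)) = X (merge I J (x, o2))"
    "Y (merge I J (x, y)) = Y (merge I J (o1, y))" for x y
    by (rule X[unfolded dep_def, rule_format] Y[unfolded dep_def, rule_format];
        use AB in \<open>auto simp: merge_def J_def I_def\<close>)+
  define X' where "X' x = X (merge I J (x, o2))" for x
  define Y' where "Y' y = Y (merge I J (o1, y))" for y
  have X': "X (merge I J (x, y)) = X' x" and Y': "Y (merge I J (x, y)) = Y' y" for x y
    unfolding X'_def Y'_def by (fact split)+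
  show ?thesis
    unfolding int[THEN fold] X' Y' by (simp add: PI.prob_space PJ.prob_space)
qed

section \<open>Random variables with finite moments of every order\<close>

definition allmom :: "'a measure \<Rightarrow> ('a \<Rightarrow> real) \<Rightarrow> bool" where
  "allmom M X \<longleftrightarrow> X \<in> borel_measurable M \<and> (\<forall>m. integrable M (\<lambda>z. X z ^ m))"

lemma allmomD: "allmom M X \<Longrightarrow> integrable M (\<lambda>z. X z ^ m)"
  and allmom_measurable: "allmom M X \<Longrightarrow> X \<in> borel_measurable M"
  unfolding allmom_def by blast+

lemma allmom_integrable: "allmom M X \<Longrightarrow> integrable M X"
  using allmomD[of M X 1] by simp

lemma allmomD_abs: "allmom M X \<Longrightarrow> integrable M (\<lambda>z. \<bar>X z\<bar> ^ m)"
  using integrable_abs[OF allmomD[of M X m]] by (simp add: power_abs)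

text \<open>Asking for all moments at once makes the class closed under products, so polynomials in
  the iterates need no bookkeeping of exponents. The reason is |x y|^m \<le> x^(2m) +
  y^(2m).\<close>

lemma allmom_mult:
  assumes "allmom M X" "allmom M Y"
  shows "allmom M (\<lambda>z. X z * Y z)"
  unfolding allmom_def
proof (intro conjI allI)
  show mes: "(\<lambda>z. X z * Y z) \<in> borel_measurable M"
    using assms[THEN allmom_measurable] by measurable
  fix m
  have "integrable M (\<lambda>z. (X z) ^ (2*m) + (Y z) ^ (2*m))"
    using assms by (intro Bochner_Integration.integrable_add allmomD)
  then show "integrable M (\<lambda>z. (X z * Y z) ^ m)"
  proof (rule Bochner_Integration.integrable_bound)
    show "(\<lambda>z. (X z * Y z) ^ m) \<in> borel_measurable M" using mes by measurable
    have "\<bar>x * y\<bar> \<le> x\<^sup>2 + y\<^sup>2" for x y :: real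
      using sum_squares_bound[of "\<bar>x\<bar>" "\<bar>y\<bar>"] mult_nonneg_nonneg[of "\<bar>x\<bar>" "\<bar>y\<bar>"]
      unfolding abs_mult power2_abs by linarith
    then have "\<bar>X z ^ m * Y z ^ m\<bar> \<le> \<bar>(X z ^ m)\<^sup>2 + (Y z ^ m)\<^sup>2\<bar>" for z
      by (meson abs_ge_self order_trans)
    then have "\<bar>(X z * Y z) ^ m\<bar> \<le> \<bar>(X z) ^ (2*m) + (Y z) ^ (2*m)\<bar>" for z
      by (simp add: power_mult_distrib mult.commute[of 2] power_mult)
    then show "AE z in M. norm ((X z * Y z) ^ m) \<le> norm ((X z) ^ (2*m) + (Y z) ^ (2*m))"
      by simp
  qed
qed

lemma allmom_add:
  assumes "allmom M X" "allmom M Y"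
  shows "allmom M (\<lambda>z. X z + Y z)"
  unfolding allmom_def
proof (intro conjI allI)
  show mes: "(\<lambda>z. X z + Y z) \<in> borel_measurable M"
    using assms[THEN allmom_measurable] by measurable
  fix m
  have "integrable M (\<lambda>z. 2 ^ m * (\<bar>X z\<bar> ^ m + \<bar>Y z\<bar> ^ m))"
    using assms by (intro integrable_mult_right Bochner_Integration.integrable_add allmomD_abs)
  then show "integrable M (\<lambda>z. (X z + Y z) ^ m)"
  proof (rule Bochner_Integration.integrable_bound)
    show "(\<lambda>z. (X z + Y z) ^ m) \<in> borel_measurable M" using mes by measurable
    have "\<bar>x + y\<bar> ^ m \<le> 2 ^ m * (\<bar>x\<bar> ^ m + \<bar>y\<bar> ^ m)" for x y :: real
    proof -
      have "\<bar>x + y\<bar> ^ m \<le> (2 * max \<bar>x\<bar> \<bar>y\<bar>) ^ m" by (intro power_mono) auto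
      also have "\<dots> \<le> 2 ^ m * (\<bar>x\<bar> ^ m + \<bar>y\<bar> ^ m)"
        by (auto simp: power_mult_distrib max_def)
      finally show ?thesis .
    qed
    then show "AE z in M. norm ((X z + Y z) ^ m) \<le> norm (2 ^ m * (\<bar>X z\<bar> ^ m + \<bar>Y z\<bar> ^ m))"
      by (auto simp: power_abs)
  qed
qed

lemma (in finite_measure) allmom_bounded:
  assumes "X \<in> borel_measurable M" "\<And>z. z \<in> space M \<Longrightarrow> \<bar>X z\<bar> \<le> c"
  shows "allmom M X"
  unfolding allmom_def
proof (intro conjI allI)
  fix m
  have "\<bar>X z\<bar> ^ m \<le> c ^ m" if "z \<in> space M" for z
    using assms(2)[OF that] by (intro power_mono) auto
  then show "integrable M (\<lambda>z. X z ^ m)"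
    by (intro integrable_const_bound[of _ "c ^ m"]) (use assms(1) in \<open>auto simp: power_abs\<close>)
qed (fact assms(1))

lemma (in finite_measure) allmom_const: "allmom M (\<lambda>_. c)"
  by (rule allmom_bounded[of _ "\<bar>c\<bar>"]) auto

lemma (in finite_measure) allmom_cmult: "allmom M X \<Longrightarrow> allmom M (\<lambda>z. c * X z)"
  by (intro allmom_mult allmom_const)

lemma (in finite_measure) allmom_divide: "allmom M X \<Longrightarrow> allmom M (\<lambda>z. X z / c)"
  using allmom_cmult[of X "inverse c"] by (simp add: field_simps)

lemma (in finite_measure) allmom_diff:
  "allmom M X \<Longrightarrow> allmom M Y \<Longrightarrow> allmom M (\<lambda>z. X z - Y z)"
  using allmom_add[OF _ allmom_cmult[of Y "-1"]] by simp

lemma (in finite_measure) allmom_sum: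
  "(\<And>k. k \<in> I \<Longrightarrow> allmom M (X k)) \<Longrightarrow> allmom M (\<lambda>z. \<Sum>k\<in>I. X k z)"
  by (induction I rule: infinite_finite_induct) (auto intro: allmom_const allmom_add)

lemma (in finite_measure) allmom_prod:
  "(\<And>k. k \<in> I \<Longrightarrow> allmom M (X k)) \<Longrightarrow> allmom M (\<lambda>z. \<Prod>k\<in>I. X k z)"
  by (induction I rule: infinite_finite_induct) (auto intro: allmom_const allmom_mult)

lemma (in finite_measure) allmom_power: "allmom M X \<Longrightarrow> allmom M (\<lambda>z. X z ^ n)"
  by (induction n) (auto intro: allmom_const allmom_mult)

section \<open>Sums of independent variables on a product space\<close>

text \<open>Cauchy-Schwarz applied twice, to the terms and then to their squares.\<close>

lemma sum_power4_le:
  fixes y :: "'i \<Rightarrow> real"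
  shows "(\<Sum>k\<in>A. y k) ^ 4 \<le> real (card A) ^ 3 * (\<Sum>k\<in>A. y k ^ 4)"
proof -
  have "(\<Sum>k\<in>A. y k) ^ 4 = ((\<Sum>k\<in>A. y k)\<^sup>2)\<^sup>2" by (simp flip: power_mult)
  also have "\<dots> \<le> (real (card A) * (\<Sum>k\<in>A. (y k)\<^sup>2))\<^sup>2"
    using sum_squared_le_sum_of_squares[of y A] by (intro power_mono) (auto simp: mult.commute)
  also have "\<dots> = (real (card A))\<^sup>2 * (\<Sum>k\<in>A. (y k)\<^sup>2)\<^sup>2" by (simp add: power_mult_distrib)
  also have "\<dots> \<le> (real (card A))\<^sup>2 * (real (card A) * (\<Sum>k\<in>A. ((y k)\<^sup>2)\<^sup>2))"
    using sum_squared_le_sum_of_squares[of "\<lambda>k. (y k)\<^sup>2" A]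
    by (intro mult_left_mono) (auto simp: mult.commute)
  also have "\<dots> = real (card A) ^ 3 * (\<Sum>k\<in>A. y k ^ 4)"
    by (simp add: power3_eq_cube power2_eq_square power4_eq_xxxx mult.assoc)
  finally show ?thesis .
qed

text \<open>The upper half comes from exp x \<ge> 1 + x + x^2/2 together with (1 - x + x^2/2) (1 + x
  + x^2/2) = 1 + x^4/4 \<ge> 1.\<close>

lemma exp_minus_approx:
  fixes x :: real assumes "0 \<le> x"
  shows "\<bar>(1 - x) - exp (- x)\<bar> \<le> x\<^sup>2 / 2"
proof -
  have p: "0 < 1 + x + x\<^sup>2 / 2" using assms by (smt (verit) zero_le_power2 field_sum_of_halves)
  have "1 \<le> 1 + (x\<^sup>2)\<^sup>2 / 4" by simp
  also have "\<dots> = (1 - x + x\<^sup>2 / 2) * (1 + x + x\<^sup>2 / 2)"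
    by (simp add: field_simps power2_eq_square)
  finally have "inverse (1 + x + x\<^sup>2 / 2) \<le> 1 - x + x\<^sup>2 / 2"
    using p by (simp add: field_simps)
  moreover have "exp (- x) \<le> inverse (1 + x + x\<^sup>2 / 2)"
    using exp_lower_Taylor_quadratic[OF assms] p by (simp add: exp_minus)
  moreover have "1 - x \<le> exp (- x)" using exp_ge_add_one_self[of "- x"] by simp
  ultimately show ?thesis by linarith
qed

locale iid_space =
  fixes V :: "'i set" and G :: "'b measure"
  assumes finite_V: "finite V" and prob_G: "prob_space G"
begin

definition PM :: "('i \<Rightarrow> 'b) measure" where "PM = PiM V (\<lambda>_. G)"

sublocale prob_space PM
  unfolding PM_def by (rule prob_space_PiM) (rule prob_G)

abbreviation "E \<equiv> expectation"
abbreviation "E2 X \<equiv> E (\<lambda>z. (X z)\<^sup>2)"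
abbreviation "E4 X \<equiv> E (\<lambda>z. X z ^ 4)"

lemma E_mult_dep:
  fixes X Y :: "('i \<Rightarrow> 'b) \<Rightarrow> 'c::{real_normed_field, banach, second_countable_topology}"
  assumes "dep A X" "dep B Y" "A \<inter> B = {}"
    and "integrable PM X" "integrable PM Y" "integrable PM (\<lambda>z. X z * Y z)"
  shows "E (\<lambda>z. X z * Y z) = E X * E Y"
  using integral_mult_dep[of V "\<lambda>_. G", OF finite_V prob_G assms(1-3)] assms(4-) by (simp add: PM_def)

lemma E_mult_allmom:
  assumes "dep A X" "dep B Y" "A \<inter> B = {}" "allmom PM X" "allmom PM Y"
  shows "E (\<lambda>z. X z * Y z) = E X * E Y"
  using assms by (intro E_mult_dep) (auto intro: allmom_integrable allmom_mult)

lemma E_prod_allmom: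
  assumes "finite I" "\<And>k. k \<in> I \<Longrightarrow> dep (W k) (X k)" "disjoint_family_on W I"
    "\<And>k. k \<in> I \<Longrightarrow> allmom PM (X k)"
  shows "E (\<lambda>z. \<Prod>k\<in>I. X k z) = (\<Prod>k\<in>I. E (X k))"
  using assms
proof (induction I rule: finite_induct)
  case (insert k I)
  have "E (\<lambda>z. X k z * (\<Prod>k\<in>I. X k z)) = E (X k) * E (\<lambda>z. \<Prod>k\<in>I. X k z)"
  proof (rule E_mult_allmom)
    show "dep (\<Union>k\<in>I. W k) (\<lambda>z. \<Prod>k\<in>I. X k z)" by (rule dep_Union_prod) (use insert in auto)
    show "W k \<inter> (\<Union>k\<in>I. W k) = {}"
      using insert.prems(2) insert.hyps by (fastforce simp: disjoint_family_on_def)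
  qed (use insert in \<open>auto intro: allmom_prod\<close>)
  with insert show ?case by (simp add: disjoint_family_on_mono[OF subset_insertI])
qed (simp add: prob_space)

text \<open>Serves characteristic functions, which are complex; the bound 1 supplies the
  integrability that moments give in the real case.\<close>

lemma E_prod_bounded:
  fixes X :: "'k \<Rightarrow> ('i \<Rightarrow> 'b) \<Rightarrow> complex"
  assumes "finite I" "\<And>k. k \<in> I \<Longrightarrow> dep (W k) (X k)" "disjoint_family_on W I"
    "\<And>k. k \<in> I \<Longrightarrow> X k \<in> borel_measurable PM" "\<And>k z. k \<in> I \<Longrightarrow> norm (X k z) \<le> 1"
  shows "E (\<lambda>z. \<Prod>k\<in>I. X k z) = (\<Prod>k\<in>I. E (X k))"
  using assms
proof (induction I rule: finite_induct)
  case (insert k I)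
  have b: "norm (\<Prod>k\<in>I. X k z) \<le> 1" for z
    using insert.prems(4) by (auto simp flip: prod_norm intro!: prod_le_1)
  have m: "(\<lambda>z. \<Prod>k\<in>I. X k z) \<in> borel_measurable PM" "X k \<in> borel_measurable PM"
    using insert.prems by (auto intro: borel_measurable_prod)
  have "E (\<lambda>z. X k z * (\<Prod>k\<in>I. X k z)) = E (X k) * E (\<lambda>z. \<Prod>k\<in>I. X k z)"
  proof (rule E_mult_dep)
    show "dep (\<Union>k\<in>I. W k) (\<lambda>z. \<Prod>k\<in>I. X k z)" by (rule dep_Union_prod) (use insert in auto)
    show "W k \<inter> (\<Union>k\<in>I. W k) = {}"
      using insert.prems(2) insert.hyps by (fastforce simp: disjoint_family_on_def)
    show "integrable PM (\<lambda>z. X k z * (\<Prod>k\<in>I. X k z))"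
      by (rule integrable_const_bound[of _ 1])
        (use b m insert.prems(4) in \<open>auto simp: norm_mult intro!: mult_le_one\<close>)
    show "integrable PM (\<lambda>z. \<Prod>k\<in>I. X k z)" "integrable PM (X k)"
      by (rule integrable_const_bound[of _ 1]; use b m insert.prems(4) in auto)+
  qed (use insert in auto)
  with insert show ?case by (simp add: disjoint_family_on_mono[OF subset_insertI])
qed (simp add: prob_space)

text \<open>The factors \<open>x k\<close> are exchanged for \<open>y k\<close> one at a time. Each
  resulting term contains one increment \<open>x k - y k\<close>, multiplied by \<open>h\<close> and
  by factors living on other, disjoint sets \<open>R j\<close>; all of these avoid the shell
  \<open>R k - R' k\<close>, so the term vanishes. This carries orthogonality from single messages
  to monomials.\<close>

lemma E_telescope:
  assumes "finite T"
    and "\<And>k. k \<in> T \<Longrightarrow> allmom PM (x k)" "\<And>k. k \<in> T \<Longrightarrow> allmom PM (y k)"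
    and "\<And>k. k \<in> T \<Longrightarrow> dep (R k) (x k)" "\<And>k. k \<in> T \<Longrightarrow> dep (R' k) (y k)"
    and "\<And>k. k \<in> T \<Longrightarrow> R' k \<subseteq> R k" "disjoint_family_on R T"
    and "\<And>k h. k \<in> T \<Longrightarrow> allmom PM h \<Longrightarrow> dep (- (R k - R' k)) h \<Longrightarrow>
           E (\<lambda>z. h z * (x k z - y k z)) = 0"
    and "allmom PM h" "dep (- (\<Union>k\<in>T. R k - R' k)) h"
  shows "E (\<lambda>z. h z * ((\<Prod>k\<in>T. x k z) - (\<Prod>k\<in>T. y k z))) = 0"
  using assms
proof (induction T arbitrary: h rule: finite_induct)
  case (insert k T)
  have disj: "R j \<inter> R k = {}" if "j \<in> T" for j
    using insert.prems(6) insert.hyps that by (fastforce simp: disjoint_family_on_def)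
  \<comment> \<open>The induction hypothesis is used with \<open>h * x k\<close> as test function:
    \<open>x k\<close> lives on \<open>R k\<close>, which misses all other shells.\<close>
  have 1: "E (\<lambda>z. (h z * x k z) * ((\<Prod>k\<in>T. x k z) - (\<Prod>k\<in>T. y k z))) = 0"
  proof (rule insert.IH)
    show "dep (- (\<Union>k\<in>T. R k - R' k)) (\<lambda>z. h z * x k z)"
    proof (rule dep_comp2[where g = "(*)"])
      show "dep (- (\<Union>k\<in>T. R k - R' k)) h" by (rule dep_mono[OF insert.prems(9)]) auto
      show "dep (- (\<Union>k\<in>T. R k - R' k)) (x k)"
        by (rule dep_mono[of "R k"]) (use insert.prems(3) disj in auto)
    qed
  qed (use insert.prems in \<open>auto intro: allmom_mult disjoint_family_on_mono[OF subset_insertI]\<close>)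
  have 2: "E (\<lambda>z. (h z * (\<Prod>k\<in>T. y k z)) * (x k z - y k z)) = 0"
  proof (rule insert.prems(7))
    show "dep (- (R k - R' k)) (\<lambda>z. h z * (\<Prod>k\<in>T. y k z))"
    proof (rule dep_comp2[where g = "(*)"])
      show "dep (- (R k - R' k)) h" by (rule dep_mono[OF insert.prems(9)]) auto
      show "dep (- (R k - R' k)) (\<lambda>z. \<Prod>k\<in>T. y k z)"
        by (rule dep_mono[OF dep_Union_prod[of T R' y]]) (use insert.prems(4,5) disj in blast)+
    qed
  qed (use insert.prems in \<open>auto intro!: allmom_mult allmom_prod\<close>)
  have "E (\<lambda>z. h z * ((\<Prod>k\<in>insert k T. x k z) - (\<Prod>k\<in>insert k T. y k z))) =
    E (\<lambda>z. (h z * x k z) * ((\<Prod>k\<in>T. x k z) - (\<Prod>k\<in>T. y k z)) +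
       (h z * (\<Prod>k\<in>T. y k z)) * (x k z - y k z))"
    using insert.hyps by (intro Bochner_Integration.integral_cong) (auto simp: algebra_simps)
  also have "\<dots> = 0"
    using insert.prems
    by (subst Bochner_Integration.integral_add)
      (auto simp: 1 2 intro!: allmom_integrable allmom_mult allmom_diff allmom_prod)
  finally show ?case .
qed simp

text \<open>By x^2 \<le> (1 + x^4) / 2, one constant C \<ge> 1 serves for second and fourth moments
  alike.\<close>

lemma E_square_le:
  assumes "allmom PM X" "E4 X \<le> C" "1 \<le> C"
  shows "E2 X \<le> C"
proof -
  have "E2 X \<le> E (\<lambda>z. (1 + X z ^ 4) / 2)"
  proof (rule integral_mono)
    show "integrable PM (\<lambda>z. (1 + X z ^ 4) / 2)" "integrable PM (\<lambda>z. (X z)\<^sup>2)"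
      using allmomD[OF assms(1), of 4] allmomD[OF assms(1), of 2] by auto
    have "x\<^sup>2 \<le> (1 + x ^ 4) / 2" for x :: real
      using sum_squares_bound[of 1 "x\<^sup>2"] by (simp flip: power_mult)
    then show "(X z)\<^sup>2 \<le> (1 + X z ^ 4) / 2" for z .
  qed
  also have "\<dots> = (1 + E4 X) / 2"
    using allmomD[OF assms(1), of 4] by (simp add: prob_space)
  also have "\<dots> \<le> C" using assms(2,3) by simp
  finally show ?thesis .
qed

text \<open>Splitting off one summand kills the terms of odd degree in it or in the rest. In the
  fourth power a cross term 6 E[Y^2] E[S^2] \<le> 6 C^2 n remains, and 3 n^2 + 6 n + 3 = 3 (n + 1)^2
  closes the induction. The second moment of S is needed there, hence the joint proof.\<close>

lemma
  assumes "finite B" "\<And>k. k \<in> B \<Longrightarrow> dep (W k) (Y k)" "disjoint_family_on W B"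
    "\<And>k. k \<in> B \<Longrightarrow> allmom PM (Y k)" "\<And>k. k \<in> B \<Longrightarrow> E (Y k) = 0"
  shows E_sum_square: "E (\<lambda>z. (\<Sum>k\<in>B. Y k z)\<^sup>2) = (\<Sum>k\<in>B. E2 (Y k))"
    and E_sum_power4: "1 \<le> C \<Longrightarrow> (\<And>k. k \<in> B \<Longrightarrow> E4 (Y k) \<le> C) \<Longrightarrow>
      E (\<lambda>z. (\<Sum>k\<in>B. Y k z) ^ 4) \<le> 3 * C\<^sup>2 * (real (card B))\<^sup>2"
proof -
  have "E (\<lambda>z. (\<Sum>k\<in>B. Y k z)\<^sup>2) = (\<Sum>k\<in>B. E2 (Y k)) \<and>
     (1 \<le> C \<longrightarrow> (\<forall>k\<in>B. E4 (Y k) \<le> C) \<longrightarrow>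
      E (\<lambda>z. (\<Sum>k\<in>B. Y k z) ^ 4) \<le> 3 * C\<^sup>2 * (real (card B))\<^sup>2)"
    using assms
  proof (induction B rule: finite_induct)
    case (insert k B)
    define S where "S z = (\<Sum>k\<in>B. Y k z)" for z
    have S: "allmom PM S" unfolding S_def using insert.prems by (auto intro: allmom_sum)
    have Yk: "allmom PM (Y k)" "E (Y k) = 0" using insert.prems by auto
    have dS: "dep (\<Union>k\<in>B. W k) S" unfolding S_def by (rule dep_Union_sum) (use insert in auto)
    have disj: "W k \<inter> (\<Union>k\<in>B. W k) = {}"
      using insert.prems(2) insert.hyps by (fastforce simp: disjoint_family_on_def)
    have fac: "E (\<lambda>z. Y k z ^ p * S z ^ q) = E (\<lambda>z. Y k z ^ p) * E (\<lambda>z. S z ^ q)" for p q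
      using insert.prems(1)[of k] dS disj S Yk
      by (intro E_mult_allmom[of "W k" _ "\<Union>k\<in>B. W k"])
        (auto intro: dep_comp[where g = "\<lambda>x. x ^ p"] dep_comp[where g = "\<lambda>x. x ^ q"] allmom_power)
    have ES: "E S = 0"
      unfolding S_def using insert.prems by (subst Bochner_Integration.integral_sum) (auto intro: allmom_integrable)
    have ip: "integrable PM (\<lambda>z. Y k z ^ p * S z ^ q)" for p q
      using S Yk by (intro allmom_integrable allmom_mult allmom_power)
    have iS: "integrable PM (\<lambda>z. S z ^ q)" and iY: "integrable PM (\<lambda>z. Y k z ^ q)" for q
      using S Yk by (auto intro: allmomD)
    have fac1: "E (\<lambda>z. Y k z * S z ^ q) = 0" for q
      using fac[of 1 q] Yk by simp
    have fac2: "E (\<lambda>z. Y k z ^ p * S z) = 0" for p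
      using fac[of p 1] ES by simp
    have IH: "E2 S = (\<Sum>k\<in>B. E2 (Y k))"
      "1 \<le> C \<longrightarrow> (\<forall>k\<in>B. E4 (Y k) \<le> C) \<longrightarrow>
        E4 S \<le> 3 * C\<^sup>2 * (real (card B))\<^sup>2"
      using insert unfolding S_def by (simp_all add: disjoint_family_on_mono[OF subset_insertI])
    have i1: "integrable PM (\<lambda>z. Y k z * S z ^ q)" "integrable PM (\<lambda>z. Y k z ^ q * S z)" for q
      using ip[of 1 q] ip[of q 1] by simp_all
    have sq: "(Y k z + S z)\<^sup>2 = (Y k z)\<^sup>2 + 2 * (Y k z * S z ^ 1) + (S z)\<^sup>2" for z
      by (simp add: power2_eq_square algebra_simps)
    have E2: "E (\<lambda>z. (Y k z + S z)\<^sup>2) = E2 (Y k) + E2 S"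
      unfolding sq using iS iY i1(1)[of 1] fac1[of 1] by simp
    have p4: "(Y k z + S z) ^ 4 = Y k z ^ 4 + 4 * (Y k z ^ 3 * S z) + 6 * ((Y k z)\<^sup>2 * (S z)\<^sup>2)
        + 4 * (Y k z * S z ^ 3) + S z ^ 4" for z
      by (simp add: power2_eq_square power3_eq_cube power4_eq_xxxx algebra_simps)
    have E4: "E (\<lambda>z. (Y k z + S z) ^ 4) = E4 (Y k)
       + 6 * (E2 (Y k) * E2 S) + E4 S"
      unfolding p4 using iS iY i1 ip by (simp add: fac1 fac2 fac)
    have le: "E (\<lambda>z. (Y k z + S z) ^ 4) \<le> 3 * C\<^sup>2 * (real (card (insert k B)))\<^sup>2"
      if C: "1 \<le> C" and b: "\<forall>k\<in>insert k B. E4 (Y k) \<le> C"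
    proof -
      have v: "E2 (Y j) \<le> C" if "j \<in> insert k B" for j
        using insert.prems(3) b C that by (intro E_square_le) auto
      have "E2 S \<le> real (card B) * C"
        unfolding IH using v by (intro sum_bounded_above) auto
      then have "E2 (Y k) * E2 S \<le> C * (real (card B) * C)"
        using v[of k] C by (intro mult_mono) (auto intro: integral_nonneg_AE)
      moreover have "E4 (Y k) \<le> C" using b by simp
      moreover have "E4 S \<le> 3 * C\<^sup>2 * (real (card B))\<^sup>2" using IH C b by simp
      moreover have "C \<le> C\<^sup>2" "0 \<le> C\<^sup>2" using C by (simp_all add: power2_eq_square)
      ultimately have "E (\<lambda>z. (Y k z + S z) ^ 4)
          \<le> 3 * C\<^sup>2 + 6 * (C * (real (card B) * C)) + 3 * C\<^sup>2 * (real (card B))\<^sup>2"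
        unfolding E4 by linarith
      also have "\<dots> = 3 * C\<^sup>2 * (real (card (insert k B)))\<^sup>2"
        using insert.hyps by (simp add: power2_eq_square algebra_simps)
      finally show ?thesis .
    qed
    have eq: "(\<Sum>k\<in>insert k B. Y k z) = Y k z + S z" for z using insert.hyps by (simp add: S_def)
    show ?case unfolding eq using E2 IH le insert.hyps by simp
  qed simp
  then show "E (\<lambda>z. (\<Sum>k\<in>B. Y k z)\<^sup>2) = (\<Sum>k\<in>B. E2 (Y k))"
    "1 \<le> C \<Longrightarrow> (\<And>k. k \<in> B \<Longrightarrow> E4 (Y k) \<le> C) \<Longrightarrow>
      E (\<lambda>z. (\<Sum>k\<in>B. Y k z) ^ 4) \<le> 3 * C\<^sup>2 * (real (card B))\<^sup>2" by auto
qed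

text \<open>The centred squares are independent with variance at most C, so their average has second
  moment at most C / n. The inequality |x| \<le> (sqrt n x^2 + 1 / sqrt n) / 2 then yields a bound
  on the first absolute moment without a square root of an expectation.\<close>

lemma E_abs_avg_square_dev:
  assumes "finite B" "B \<noteq> {}" "\<And>k. k \<in> B \<Longrightarrow> dep (W k) (Y k)" "disjoint_family_on W B"
    "\<And>k. k \<in> B \<Longrightarrow> allmom PM (Y k)" "\<And>k. k \<in> B \<Longrightarrow> E4 (Y k) \<le> C"
  shows "E (\<lambda>z. \<bar>(\<Sum>k\<in>B. (Y k z)\<^sup>2 - E2 (Y k)) / card B\<bar>)
     \<le> (C + 1) / (2 * sqrt (card B))"
proof -
  define n where "n = real (card B)"
  have n: "n > 0" using assms(1,2) by (simp add: n_def card_gt_0_iff)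
  define Q where "Q k z = (Y k z)\<^sup>2 - E2 (Y k)" for k z
  have Q: "allmom PM (Q k)" "E (Q k) = 0" "dep (W k) (Q k)"
    "E2 (Q k) \<le> C" if "k \<in> B" for k
  proof -
    define m where "m = E2 (Y k)"
    have Y: "allmom PM (\<lambda>z. (Y k z)\<^sup>2)" using assms that by (auto intro: allmom_power)
    show "allmom PM (Q k)" unfolding Q_def by (intro allmom_diff Y allmom_const)
    show "E (Q k) = 0" unfolding Q_def using allmom_integrable[OF Y] by (simp add: prob_space)
    show "dep (W k) (Q k)" unfolding Q_def m_def[symmetric]
      using dep_comp[OF assms(3)[OF that], of "\<lambda>x. x\<^sup>2 - m"] .
    have "(Q k z)\<^sup>2 = (Y k z) ^ 4 - 2 * m * (Y k z)\<^sup>2 + m\<^sup>2" for z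
      by (simp add: Q_def m_def power2_diff algebra_simps flip: power_mult)
    then have "E2 (Q k) = E (\<lambda>z. (Y k z) ^ 4) - 2 * m * m + m\<^sup>2"
      using allmom_integrable[OF Y] allmomD[OF assms(5)[OF that], of 4] by (simp add: m_def prob_space)
    also have "\<dots> \<le> C" using assms(6)[OF that] zero_le_power2[of m] unfolding power2_eq_square by linarith
    finally show "E2 (Q k) \<le> C" .
  qed
  define S where "S z = (\<Sum>k\<in>B. Q k z)" for z
  have S: "allmom PM S" unfolding S_def using Q by (auto intro: allmom_sum)
  have "E2 S = (\<Sum>k\<in>B. E2 (Q k))"
    unfolding S_def by (rule E_sum_square) (use assms Q in auto)
  also have "\<dots> \<le> n * C" unfolding n_def using Q by (intro sum_bounded_above) auto
  finally have S2: "E2 S \<le> n * C" .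
  have "E (\<lambda>z. \<bar>S z / n\<bar>) \<le> E (\<lambda>z. (sqrt n * (S z / n)\<^sup>2 + 1 / sqrt n) / 2)"
  proof (rule integral_mono)
    show "integrable PM (\<lambda>z. \<bar>S z / n\<bar>)" using allmom_integrable[OF S] by auto
    show "integrable PM (\<lambda>z. (sqrt n * (S z / n)\<^sup>2 + 1 / sqrt n) / 2)"
      using allmomD[OF S, of 2] by (auto simp: power_divide)
    have "\<bar>x\<bar> \<le> (sqrt n * x\<^sup>2 + 1 / sqrt n) / 2" for x
    proof -
      have s: "sqrt n * sqrt n = n" "sqrt n > 0" using n by auto
      have "0 \<le> (sqrt n * \<bar>x\<bar> - 1)\<^sup>2 / sqrt n" using n by simp
      also have "\<dots> = sqrt n * x\<^sup>2 + 1 / sqrt n - 2 * \<bar>x\<bar>"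
        using s by (simp add: power2_diff power_mult_distrib field_simps power2_eq_square)
      finally show ?thesis by simp
    qed
    then show "\<bar>S z / n\<bar> \<le> (sqrt n * (S z / n)\<^sup>2 + 1 / sqrt n) / 2" for z .
  qed
  also have "\<dots> = (sqrt n * (E2 S / n\<^sup>2) + 1 / sqrt n) / 2"
    using allmomD[OF S, of 2] by (simp add: power_divide prob_space)
  also have "\<dots> \<le> (sqrt n * (n * C / n\<^sup>2) + 1 / sqrt n) / 2"
    using S2 n by (intro divide_right_mono add_right_mono mult_left_mono) auto
  also have "sqrt n * (n * C / n\<^sup>2) = C / sqrt n"
    using n by (simp add: field_simps power2_eq_square)
  finally show ?thesis unfolding S_def Q_def n_def by (simp add: add_divide_distrib)
qed

text \<open>Independence factors the characteristic function. Each factor differs from exp (- v /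
  (2n)) by O(n^(-3/2)), and n such errors add up to O(n^(-1/2)). The summands need not be
  identically distributed: only the average of their variances appears.\<close>

lemma char_sum_approx:
  assumes "finite B" "B \<noteq> {}" "\<And>k. k \<in> B \<Longrightarrow> dep (W k) (Y k)" "disjoint_family_on W B"
    "\<And>k. k \<in> B \<Longrightarrow> allmom PM (Y k)" "\<And>k. k \<in> B \<Longrightarrow> E (Y k) = 0"
    "1 \<le> C" "\<And>k. k \<in> B \<Longrightarrow> E4 (Y k) \<le> C"
  shows "cmod (E (\<lambda>z. iexp ((\<Sum>k\<in>B. Y k z) / sqrt (card B)))
      - of_real (exp (- ((\<Sum>k\<in>B. E2 (Y k)) / card B) / 2))) \<le> C\<^sup>2 / sqrt (card B)"
proof -
  define n where "n = real (card B)"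
  have n: "n \<ge> 1" using assms(1,2) by (simp add: n_def Suc_le_eq card_gt_0_iff)
  define s where "s = sqrt n"
  have s: "s \<ge> 1" "s * s = n" using n by (auto simp: s_def)
  define v where "v k = E2 (Y k)" for k
  have v: "0 \<le> v k" "v k \<le> C" if "k \<in> B" for k
    using E_square_le[of "Y k" C] assms that by (auto simp: v_def intro: integral_nonneg_AE)
  define \<phi> where "\<phi> k = E (\<lambda>z. iexp (Y k z / s))" for k
  have cos_meas: "(\<lambda>z. iexp (Y k z / s)) \<in> borel_measurable PM" if "k \<in> B" for k
    using allmom_measurable[OF assms(5)[OF that]] by measurable
  have int_e: "integrable PM (\<lambda>z. iexp (Y k z / s))" if "k \<in> B" for k
    by (rule integrable_const_bound[of _ 1]) (use cos_meas that in auto)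
  have prodform: "E (\<lambda>z. iexp ((\<Sum>k\<in>B. Y k z) / s)) = (\<Prod>k\<in>B. \<phi> k)"
  proof -
    have "iexp ((\<Sum>k\<in>B. Y k z) / s) = (\<Prod>k\<in>B. iexp (Y k z / s))" for z
      using assms(1) by (simp add: sum_divide_distrib sum_distrib_left exp_sum)
    moreover have "E (\<lambda>z. \<Prod>k\<in>B. iexp (Y k z / s)) = (\<Prod>k\<in>B. \<phi> k)"
      unfolding \<phi>_def
    proof (rule E_prod_bounded[of B W])
      show "dep (W k) (\<lambda>z. iexp (Y k z / s))" if "k \<in> B" for k
        using dep_comp[OF assms(3)[OF that], of "\<lambda>x. iexp (x / s)"] .
    qed (use assms cos_meas in auto)
    ultimately show ?thesis by simp
  qed
  \<comment> \<open>Second-order Taylor polynomial of the exponential: the linear term has mean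
    zero, and |y|^3 \<le> 1 + y^4 reduces the third moment in the remainder to the fourth.\<close>
  have third: "cmod (\<phi> k - of_real (1 - v k / (2 * n))) \<le> (1 + C) / (6 * n * s)" if k: "k \<in> B" for k
  proof -
    have Y: "allmom PM (Y k)" using assms(5) k .
    have i1: "integrable PM (\<lambda>z. complex_of_real (Y k z))" "integrable PM (\<lambda>z. complex_of_real ((Y k z)\<^sup>2))"
      using allmom_integrable[OF Y] allmomD[OF Y, of 2]
      by (simp_all del: of_real_power)
    define T where "T z = 1 + \<i> * (Y k z / s) - (Y k z / s)\<^sup>2 / 2" for z
    have T: "T z = 1 + (\<i> / s) * Y k z - (1 / (2 * n)) * of_real ((Y k z)\<^sup>2)" for z
      using s by (simp add: T_def power_divide flip: s(2)) (simp add: power2_eq_square)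
    have Tint: "integrable PM T" unfolding T using i1 by auto
    have ET: "E T = of_real (1 - v k / (2 * n))"
    proof -
      have "E T = 1 + (\<i> / s) * of_real (E (Y k)) - (1 / (2 * n)) * of_real (v k)"
        unfolding T v_def using i1 by (simp add: prob_space del: of_real_power)
      then show ?thesis using assms(6)[OF k] by (simp add: field_simps)
    qed
    have "cmod (\<phi> k - of_real (1 - v k / (2 * n))) = cmod (E (\<lambda>z. iexp (Y k z / s) - T z))"
      unfolding \<phi>_def ET[symmetric] using int_e[OF k] Tint by simp
    also have "\<dots> \<le> E (\<lambda>z. cmod (iexp (Y k z / s) - T z))"
      by (rule integral_norm_bound)
    also have "\<dots> \<le> E (\<lambda>z. (1 + Y k z ^ 4) / (6 * n * s))"
    proof (rule integral_mono)
      show "integrable PM (\<lambda>z. cmod (iexp (Y k z / s) - T z))" using int_e[OF k] Tint by auto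
      show "integrable PM (\<lambda>z. (1 + Y k z ^ 4) / (6 * n * s))" using allmomD[OF Y, of 4] by auto
      fix z
      have "(\<Sum>j\<le>2. (\<i> * of_real (Y k z / s)) ^ j / fact j) = T z"
      proof -
        have "(\<Sum>j\<le>2. g j) = g 0 + g 1 + g 2" for g :: "nat \<Rightarrow> complex"
          by (simp add: numeral_2_eq_2)
        then show ?thesis by (simp add: T_def power_mult_distrib power_divide)
      qed
      then have "cmod (iexp (Y k z / s) - T z) \<le> \<bar>Y k z / s\<bar> ^ 3 / fact 3"
        using iexp_approx1[of "Y k z / s" 2] by simp
      also have "\<dots> = \<bar>Y k z\<bar> ^ 3 / (6 * n * s)"
        using s by (simp add: power_divide fact_numeral power3_eq_cube abs_mult flip: s(2))
      also have "\<dots> \<le> (1 + Y k z ^ 4) / (6 * n * s)"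
      proof (intro divide_right_mono)
        have "a ^ 3 \<le> 1 + a ^ 4" if "0 \<le> a" for a :: real
        proof (cases "a \<le> 1")
          case True then show ?thesis using power_le_one[of a 3] that by (smt (verit) zero_le_power)
        next
          case False then show ?thesis using power_increasing[of 3 4 a] by linarith
        qed
        from this[of "\<bar>Y k z\<bar>"] show "\<bar>Y k z\<bar> ^ 3 \<le> 1 + Y k z ^ 4" by (simp add: power_even_abs)
      qed (use n s in auto)
      finally show "cmod (iexp (Y k z / s) - T z) \<le> (1 + Y k z ^ 4) / (6 * n * s)" .
    qed
    also have "\<dots> = (1 + E4 (Y k)) / (6 * n * s)"
      using allmomD[OF Y, of 4] by (simp add: prob_space)
    also have "\<dots> \<le> (1 + C) / (6 * n * s)"
      using assms(8)[OF k] n s by (intro divide_right_mono) auto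
    finally show ?thesis .
  qed
  have each: "cmod (\<phi> k - of_real (exp (- (v k / (2 * n))))) \<le> C\<^sup>2 / (n * s)" if k: "k \<in> B" for k
  proof -
    have "cmod (of_real (1 - v k / (2 * n)) - of_real (exp (- (v k / (2 * n))))) \<le> (v k / (2 * n))\<^sup>2 / 2"
      unfolding of_real_diff[symmetric] norm_of_real
      by (rule exp_minus_approx) (use v[OF k] n in auto)
    also have "\<dots> \<le> (C / (2 * n))\<^sup>2 / 2"
      using v[OF k] n by (intro divide_right_mono power_mono) auto
    also have "\<dots> \<le> C\<^sup>2 / 8 / (n * s)"
    proof -
      have "s \<le> n" using mult_left_mono[of 1 s s] s by simp
      then have "C\<^sup>2 / 8 / (n * n) \<le> C\<^sup>2 / 8 / (n * s)" using n s by (intro divide_left_mono) auto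
      then show ?thesis by (simp add: power_divide power_mult_distrib power2_eq_square)
    qed
    finally have "cmod (\<phi> k - of_real (exp (- (v k / (2 * n))))) \<le> (1 + C) / (6 * n * s) + C\<^sup>2 / 8 / (n * s)"
      using third[OF k] norm_triangle_ineq[of "\<phi> k - of_real (1 - v k / (2 * n))"
        "of_real (1 - v k / (2 * n)) - of_real (exp (- (v k / (2 * n))))"] by simp
    also have "\<dots> = ((1 + C) / 6 + C\<^sup>2 / 8) / (n * s)"
      using n s by (simp add: field_simps)
    also have "\<dots> \<le> C\<^sup>2 / (n * s)"
    proof (intro divide_right_mono)
      have "C \<le> C\<^sup>2" using assms(7) by (simp add: power2_eq_square)
      moreover have "(1 + C) / 6 + q / 8 \<le> q" if "C \<le> q" for q
        using assms(7) that by (simp add: field_simps)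
      ultimately show "(1 + C) / 6 + C\<^sup>2 / 8 \<le> C\<^sup>2" by blast
    qed (use n s in auto)
    finally show ?thesis .
  qed
  \<comment> \<open>All factors lie in the closed unit disc, so the difference of the products is at
    most the sum of the differences.\<close>
  have "cmod ((\<Prod>k\<in>B. \<phi> k) - (\<Prod>k\<in>B. of_real (exp (- (v k / (2 * n)))))) \<le> (\<Sum>k\<in>B. cmod (\<phi> k - of_real (exp (- (v k / (2 * n))))))"
  proof (rule norm_prod_diff)
    show "cmod (\<phi> k) \<le> 1" if "k \<in> B" for k
    proof -
      have "cmod (\<phi> k) \<le> E (\<lambda>z. cmod (iexp (Y k z / s)))"
        unfolding \<phi>_def by (rule integral_norm_bound)
      then show ?thesis by (simp add: prob_space)
    qed
    show "cmod (of_real (exp (- (v k / (2 * n))))) \<le> 1" if "k \<in> B" for k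
      using v[OF that] n by simp
  qed
  also have "\<dots> \<le> n * (C\<^sup>2 / (n * s))"
    unfolding n_def by (rule sum_bounded_above) (use each n_def in auto)
  also have "\<dots> = C\<^sup>2 / s" using n by simp
  finally have fin: "cmod ((\<Prod>k\<in>B. \<phi> k) - (\<Prod>k\<in>B. of_real (exp (- (v k / (2 * n)))))) \<le> C\<^sup>2 / s" .
  have "(\<Prod>k\<in>B. complex_of_real (exp (- (v k / (2 * n))))) = of_real (exp (- ((\<Sum>k\<in>B. v k) / n) / 2))"
    using assms(1) by (simp add: sum_divide_distrib sum_negf flip: of_real_prod exp_sum) (simp add: mult.commute)
  then show ?thesis using fin prodform unfolding s_def n_def v_def by simp
qed

end

section \<open>Approximation by trigonometric polynomials\<close>

lemma enorm_restrict [simp]: "enorm l (restrict x {..<l}) = enorm l x"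
  and enorm_diff_restrict [simp]: "enorm l (\<lambda>t. restrict x {..<l} t - restrict y {..<l} t) = enorm l (\<lambda>t. x t - y t)"
  by (simp_all add: enorm_def)

lemma continuous_on_enorm: "continuous_on UNIV (\<lambda>x. enorm l (\<lambda>t. x t - y t))"
  unfolding enorm_def by (intro continuous_intros continuous_on_product_coordinates)

text \<open>The hypothesis controls \<open>\<psi>\<close> on extensional functions only. Composing
  with \<open>restrict\<close> gives a function on the whole product space, where compactness and
  Stone-Weierstrass are available.\<close>

lemma pseudo_lipschitz_continuous:
  assumes "pseudo_lipschitz l \<psi>"
  shows "continuous_on UNIV (\<lambda>x. \<psi> (restrict x {..<l}))"
  unfolding continuous_on_def
proof
  fix x :: "nat \<Rightarrow> real"
  obtain C where C: "C > 0" and le: "\<And>x y. x \<in> PiE {..<l} (\<lambda>_. UNIV) \<Longrightarrow> y \<in> PiE {..<l} (\<lambda>_. UNIV) \<Longrightarrow>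
      \<bar>\<psi> x - \<psi> y\<bar> \<le> C * (1 + enorm l x + enorm l y) * enorm l (\<lambda>t. x t - y t)"
    using assms unfolding pseudo_lipschitz_def by blast
  have e: "((\<lambda>y. enorm l (\<lambda>t. y t - w t)) \<longlongrightarrow> enorm l (\<lambda>t. x t - w t)) (at x within UNIV)" for w
    using continuous_on_enorm[of l w] by (auto simp: continuous_on_def)
  have "((\<lambda>y. C * (1 + enorm l (\<lambda>t. y t - 0) + enorm l x) * enorm l (\<lambda>t. y t - x t)) \<longlongrightarrow>
      C * (1 + enorm l (\<lambda>t. x t - 0) + enorm l x) * enorm l (\<lambda>t. x t - x t)) (at x within UNIV)"
    by (intro tendsto_intros e)
  then have lim: "((\<lambda>y. C * (1 + enorm l y + enorm l x) * enorm l (\<lambda>t. y t - x t)) \<longlongrightarrow> 0) (at x within UNIV)"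
    by (simp add: enorm_def)
  have "((\<lambda>y. \<psi> (restrict y {..<l}) - \<psi> (restrict x {..<l})) \<longlongrightarrow> 0) (at x within UNIV)"
  proof (rule Lim_null_comparison[OF _ lim])
    have "\<bar>\<psi> (restrict y {..<l}) - \<psi> (restrict x {..<l})\<bar>
        \<le> C * (1 + enorm l y + enorm l x) * enorm l (\<lambda>t. y t - x t)" for y
      using le[of "restrict y {..<l}" "restrict x {..<l}"] unfolding enorm_diff_restrict by simp
    then show "\<forall>\<^sub>F y in at x. norm (\<psi> (restrict y {..<l}) - \<psi> (restrict x {..<l}))
        \<le> C * (1 + enorm l y + enorm l x) * enorm l (\<lambda>t. y t - x t)"
      by (auto intro!: always_eventually)
  qed
  then show "((\<lambda>y. \<psi> (restrict y {..<l})) \<longlongrightarrow> \<psi> (restrict x {..<l})) (at x within UNIV)"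
    by (simp add: LIM_zero_iff)
qed

lemma pseudo_lipschitz_growth:
  assumes "pseudo_lipschitz l \<psi>"
  shows "\<exists>c\<ge>1. \<forall>x. \<bar>\<psi> (restrict x {..<l})\<bar> \<le> c * (1 + (\<Sum>t<l. (x t)\<^sup>2))"
proof -
  obtain C where C: "C > 0" and le: "\<And>x y. x \<in> PiE {..<l} (\<lambda>_. UNIV) \<Longrightarrow> y \<in> PiE {..<l} (\<lambda>_. UNIV) \<Longrightarrow>
      \<bar>\<psi> x - \<psi> y\<bar> \<le> C * (1 + enorm l x + enorm l y) * enorm l (\<lambda>t. x t - y t)"
    using assms unfolding pseudo_lipschitz_def by blast
  define a where "a = \<bar>\<psi> (restrict (\<lambda>t. 0) {..<l})\<bar>"
  have "\<bar>\<psi> (restrict x {..<l})\<bar> \<le> (1 + a + 2 * C) * (1 + (\<Sum>t<l. (x t)\<^sup>2))" for x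
  proof -
    define e where "e = enorm l x"
    have e: "e \<ge> 0" "e\<^sup>2 = (\<Sum>t<l. (x t)\<^sup>2)" by (auto simp: e_def enorm_def sum_nonneg)
    have "\<bar>\<psi> (restrict x {..<l}) - \<psi> (restrict (\<lambda>t. 0) {..<l})\<bar> \<le> C * (1 + e) * e"
      using le[of "restrict x {..<l}" "restrict (\<lambda>t. 0) {..<l}"] by (simp add: e_def) (simp add: enorm_def)
    then have "\<bar>\<psi> (restrict x {..<l})\<bar> \<le> a + C * (e + e\<^sup>2)"
      unfolding a_def by (simp add: algebra_simps power2_eq_square)
    also have "\<dots> \<le> a + C * (2 * (1 + e\<^sup>2))"
    proof -
      have "e \<le> 1 + e\<^sup>2" using sum_squares_bound[of 1 e] e by simp
      then show ?thesis using C by (intro add_left_mono mult_left_mono) auto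
    qed
    also have "\<dots> \<le> (1 + a + 2 * C) * (1 + e\<^sup>2)"
      using mult_nonneg_nonneg[of a "e\<^sup>2"] by (simp add: algebra_simps a_def)
    finally show ?thesis using e by simp
  qed
  then show ?thesis using C by (intro exI[of _ "1 + a + 2 * C"]) (auto simp: a_def)
qed

lemma pseudo_lipschitz_measurable:
  assumes "pseudo_lipschitz l \<psi>"
  shows "\<psi> \<in> borel_measurable (PiM {..<l} (\<lambda>_. borel))"
proof -
  \<comment> \<open>Extension by 0 leads from the finite product sigma-algebra to Borel sets of the
    full function space, and restriction undoes it on extensional functions.\<close>
  let ?e = "\<lambda>x t. if t < l then x t else (0::real)"
  have e: "?e \<in> borel_measurable (PiM {..<l} (\<lambda>_. borel))"
  proof (rule measurable_coordinatewise_then_product)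
    show "(\<lambda>x. ?e x t) \<in> borel_measurable (PiM {..<l} (\<lambda>_. borel))" for t
      by (cases "t < l") auto
  qed
  have "(\<lambda>x. \<psi> (restrict x {..<l})) \<in> borel_measurable borel"
    by (rule borel_measurable_continuous_onI[OF pseudo_lipschitz_continuous[OF assms]])
  from measurable_compose[OF e this]
  show ?thesis
  proof (rule measurable_cong[THEN iffD1, rotated])
    fix x :: "nat \<Rightarrow> real" assume "x \<in> space (PiM {..<l} (\<lambda>_. borel))"
    then have "restrict (?e x) {..<l} = x"
      by (auto simp: space_PiM PiE_def extensional_def restrict_def fun_eq_iff)
    then show "\<psi> (restrict (?e x) {..<l}) = \<psi> x" by simp
  qed
qed

inductive_set sin_algebra :: "nat \<Rightarrow> real \<Rightarrow> ((nat \<Rightarrow> real) \<Rightarrow> real) set" for l c where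
  sin_algebra_const: "(\<lambda>_. k) \<in> sin_algebra l c"
| sin_algebra_sin: "t < l \<Longrightarrow> (\<lambda>x. sin (c * x t)) \<in> sin_algebra l c"
| sin_algebra_add: "g \<in> sin_algebra l c \<Longrightarrow> h \<in> sin_algebra l c \<Longrightarrow> (\<lambda>x. g x + h x) \<in> sin_algebra l c"
| sin_algebra_mult: "g \<in> sin_algebra l c \<Longrightarrow> h \<in> sin_algebra l c \<Longrightarrow> (\<lambda>x. g x * h x) \<in> sin_algebra l c"

text \<open>This is why the generators are sines without cosines. Any point can be folded by arcsin
  into the box [-M, M]^l without changing the sines; cosines would not survive the folding, being
  nonnegative on the box for c = pi / (2M).\<close>

lemma sin_algebra_cong:
  assumes "h \<in> sin_algebra l c" "\<And>t. t < l \<Longrightarrow> sin (c * x t) = sin (c * y t)"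
  shows "h x = h y"
  using assms by induction auto

lemma sin_algebra_continuous: "h \<in> sin_algebra l c \<Longrightarrow> continuous_on UNIV h"
  by (induction rule: sin_algebra.induct)
    (auto intro!: continuous_intros continuous_on_product_coordinates)

definition phase :: "nat \<Rightarrow> (nat \<Rightarrow> real) \<Rightarrow> (nat \<Rightarrow> real) \<Rightarrow> real" where
  "phase l \<theta> x = (\<Sum>t<l. \<theta> t * x t)"

abbreviation "char_fn l \<theta> N \<equiv> (\<integral>x. iexp (phase l \<theta> x) \<partial>N)"

definition trig_poly :: "nat \<Rightarrow> (complex \<times> (nat \<Rightarrow> real)) list \<Rightarrow> (nat \<Rightarrow> real) \<Rightarrow> complex" where
  "trig_poly l ps x = (\<Sum>p\<leftarrow>ps. fst p * iexp (phase l (snd p) x))"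

lemma trig_poly_append: "trig_poly l (ps @ qs) x = trig_poly l ps x + trig_poly l qs x"
  by (simp add: trig_poly_def)

definition tp_mult :: "(complex \<times> (nat \<Rightarrow> real)) list \<Rightarrow> (complex \<times> (nat \<Rightarrow> real)) list \<Rightarrow> (complex \<times> (nat \<Rightarrow> real)) list" where
  "tp_mult ps qs = concat (map (\<lambda>p. map (\<lambda>q. (fst p * fst q, \<lambda>t. snd p t + snd q t)) qs) ps)"

lemma trig_poly_mult: "trig_poly l (tp_mult ps qs) x = trig_poly l ps x * trig_poly l qs x"
proof (induction ps)
  case (Cons p ps)
  have "trig_poly l (map (\<lambda>q. (fst p * fst q, \<lambda>t. snd p t + snd q t)) qs) x
      = fst p * iexp (phase l (snd p) x) * trig_poly l qs x"
  proof (induction qs)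
    case (Cons q qs)
    have "phase l (\<lambda>t. snd p t + snd q t) x = phase l (snd p) x + phase l (snd q) x"
      by (simp add: phase_def algebra_simps sum.distrib)
    then show ?case using Cons by (simp add: trig_poly_def exp_add algebra_simps)
  qed (simp add: trig_poly_def)
  moreover have "trig_poly l (p # ps) x = fst p * iexp (phase l (snd p) x) + trig_poly l ps x"
    by (simp add: trig_poly_def)
  moreover have "tp_mult (p # ps) qs = map (\<lambda>q. (fst p * fst q, \<lambda>t. snd p t + snd q t)) qs @ tp_mult ps qs"
    by (simp add: tp_mult_def)
  ultimately show ?case using Cons by (simp add: trig_poly_append algebra_simps)
qed (simp add: trig_poly_def tp_mult_def)

lemma sin_algebra_trig_poly:
  assumes "h \<in> sin_algebra l c"
  shows "\<exists>ps. \<forall>x. complex_of_real (h x) = trig_poly l ps x"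
  using assms
proof induction
  case (sin_algebra_const k)
  show ?case by (rule exI[of _ "[(of_real k, \<lambda>_. 0)]"]) (simp add: trig_poly_def phase_def)
next
  case (sin_algebra_sin t)
  have *: "phase l (\<lambda>s. if s = t then a else 0) x = a * x t" for a x
  proof -
    have "phase l (\<lambda>s. if s = t then a else 0) x = (\<Sum>s<l. if s = t then a * x s else 0)"
      unfolding phase_def by (intro sum.cong) auto
    then show ?thesis using sin_algebra_sin by simp
  qed
  have "complex_of_real (sin (c * x t)) = trig_poly l
      [(1 / (2 * \<i>), \<lambda>s. if s = t then c else 0), (- 1 / (2 * \<i>), \<lambda>s. if s = t then - c else 0)] x" for x
    unfolding sin_of_real[symmetric] sin_exp_eq trig_poly_def
    by (simp add: * diff_divide_distrib right_diff_distrib)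
  then show ?case by blast
next
  case (sin_algebra_add g h)
  then show ?case using trig_poly_append by (metis of_real_add)
next
  case (sin_algebra_mult g h)
  then show ?case using trig_poly_mult by (metis of_real_mult)
qed

text \<open>For c = pi / (2M) the map x -> sin (c x) is injective on [-M, M], so the generators
  separate the points of the box. The box is realised in the space of all functions, with the
  coordinates from \<open>l\<close> on pinned to 0, and is compact there by Tychonoff.\<close>

lemma sin_algebra_approx:
  assumes M: "M > 0" and g: "continuous_on UNIV g" and e: "e > 0"
  shows "\<exists>h\<in>sin_algebra l (pi / (2 * M)). \<forall>x. (\<forall>t<l. \<bar>x t\<bar> \<le> M) \<longrightarrow> (\<forall>t\<ge>l. x t = 0) \<longrightarrow> \<bar>g x - h x\<bar> < e"
proof -
  define c where "c = pi / (2 * M)"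
  define S :: "(nat \<Rightarrow> real) set" where "S = PiE UNIV (\<lambda>t. if t < l then {-M..M} else {0})"
  have "compactin (product_topology (\<lambda>i. euclidean) UNIV) S"
    unfolding S_def by (subst compactin_PiE) auto
  then have S: "compact S" by (simp add: euclidean_product_topology)
  interpret function_ring_on "sin_algebra l c" S
  proof
    show "compact S" by fact
    show "continuous_on S f" if "f \<in> sin_algebra l c" for f
      using sin_algebra_continuous[OF that] continuous_on_subset by blast
    show "\<exists>f\<in>sin_algebra l c. f x \<noteq> f y" if xy: "x \<in> S" "y \<in> S" "x \<noteq> y" for x y
    proof -
      obtain t where t: "x t \<noteq> y t" using xy by auto
      have tl: "t < l"
      proof (rule ccontr)
        assume "\<not> t < l"
        moreover have "x t \<in> (if t < l then {-M..M} else {0})" "y t \<in> (if t < l then {-M..M} else {0})"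
          using xy(1,2) unfolding S_def by (auto simp only: PiE_iff UNIV_I)
        ultimately have "x t = 0" "y t = 0" by auto
        then show False using t by simp
      qed
      have "\<bar>c * z\<bar> \<le> pi / 2" if "z \<in> {-M..M}" for z
      proof -
        have "\<bar>c * z\<bar> = c * \<bar>z\<bar>" using M by (simp add: abs_mult c_def)
        also have "\<dots> \<le> c * M" using that M by (intro mult_left_mono) (auto simp: c_def)
        finally have "\<bar>c * z\<bar> \<le> c * M" .
        then show ?thesis using M by (simp add: c_def)
      qed
      moreover have "x t \<in> (if t < l then {-M..M} else {0})" "y t \<in> (if t < l then {-M..M} else {0})"
        using xy(1,2) unfolding S_def by (auto simp only: PiE_iff UNIV_I)
      then have "x t \<in> {-M..M}" "y t \<in> {-M..M}" using tl by auto
      ultimately have "\<bar>c * x t\<bar> \<le> pi / 2" "\<bar>c * y t\<bar> \<le> pi / 2" by blast+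
      then have "- (pi / 2) \<le> c * x t" "c * x t \<le> pi / 2" "- (pi / 2) \<le> c * y t" "c * y t \<le> pi / 2"
        unfolding abs_le_iff by linarith+
      note inj = sin_inj_pi[OF this]
      have "c * x t \<noteq> c * y t" using t M by (simp add: c_def)
      with inj have "sin (c * x t) \<noteq> sin (c * y t)" by blast
      then show ?thesis using sin_algebra_sin[OF tl, of c] by (intro bexI[of _ "\<lambda>x. sin (c * x t)"]) auto
    qed
  qed (auto intro: sin_algebra.intros)
  obtain h where h: "h \<in> sin_algebra l c" "\<forall>x\<in>S. \<bar>g x - h x\<bar> < e"
    using Stone_Weierstrass_basic[OF continuous_on_subset[OF g] e] by auto
  have "\<bar>g x - h x\<bar> < e" if "\<forall>t<l. \<bar>x t\<bar> \<le> M" "\<forall>t\<ge>l. x t = 0" for x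
  proof -
    have "x t \<in> (if t < l then {-M..M} else {0})" for t
      using that by (cases "t < l") (auto simp: abs_le_iff)
    then have "x \<in> S" unfolding S_def by (simp add: PiE_iff)
    then show ?thesis using h(2) by blast
  qed
  then show ?thesis using h(1) unfolding c_def by blast
qed

text \<open>A trigonometric polynomial built from \<open>sin (\<pi> x / (2 M))\<close> attains on the box \<open>[-M, M]\<close> all its
  values, so a uniform approximation of \<open>\<psi>\<close> on the box stays controlled on the whole space.\<close>

lemma pseudo_lipschitz_sin_approx:
  assumes "pseudo_lipschitz l \<psi>"
  shows "\<exists>c1\<ge>0. \<forall>M\<ge>1. \<forall>e>0. e \<le> 1 \<longrightarrow> (\<exists>ps. \<forall>x\<in>PiE {..<l} (\<lambda>_. UNIV).
      Im (trig_poly l ps x) = 0 \<and>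
      \<bar>\<psi> x - Re (trig_poly l ps x)\<bar> \<le> e + c1 * (\<Sum>t<l. x t ^ 4) / M)"
proof -
  obtain c0 where c0: "c0 \<ge> 1" and gr: "\<And>x. \<bar>\<psi> (restrict x {..<l})\<bar> \<le> c0 * (1 + (\<Sum>t<l. (x t)\<^sup>2))"
    using pseudo_lipschitz_growth[OF assms] by blast
  show ?thesis
  \<comment> \<open>The factor \<open>l + 4\<close> comes from adding the growth bounds of
    \<open>\<psi>\<close> and of its approximation outside the box; the last factor \<open>l\<close>
    comes from Cauchy-Schwarz between squares and fourth powers.\<close>
  proof (intro exI[of _ "c0 * (real l + 4) * real l"] conjI allI impI)
    show "0 \<le> c0 * (real l + 4) * real l" using c0 by auto
    fix M e :: real assume M: "M \<ge> 1" and e: "e > 0" "e \<le> 1"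
    define c where "c = pi / (2 * M)"
    have c: "c > 0" using M by (simp add: c_def)
    obtain h where h: "h \<in> sin_algebra l c"
      and happ: "\<And>x. (\<forall>t<l. \<bar>x t\<bar> \<le> M) \<Longrightarrow> (\<forall>t\<ge>l. x t = 0) \<Longrightarrow> \<bar>\<psi> (restrict x {..<l}) - h x\<bar> < e"
      using sin_algebra_approx[OF _ pseudo_lipschitz_continuous[OF assms] e(1), of M l] M
      unfolding c_def by auto
    obtain ps where ps: "\<And>x. complex_of_real (h x) = trig_poly l ps x"
      using sin_algebra_trig_poly[OF h] by blast
    have hb: "\<bar>h x\<bar> \<le> c0 * (1 + real l * M\<^sup>2) + 1" for x
    proof -
      define y where "y t = (if t < l then arcsin (sin (c * x t)) / c else 0)" for t
      have yM: "\<bar>y t\<bar> \<le> M" for t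
      proof -
        have "\<bar>arcsin (sin (c * x t))\<bar> \<le> pi / 2"
          using arcsin_bounded[of "sin (c * x t)"] by (simp add: abs_le_iff) linarith
        then have "\<bar>arcsin (sin (c * x t))\<bar> / c \<le> (pi / 2) / c"
          using c by (intro divide_right_mono) auto
        also have "(pi / 2) / c = M" using M by (simp add: c_def)
        finally show ?thesis using c M by (simp add: y_def)
      qed
      have "h x = h y"
        by (rule sin_algebra_cong[OF h]) (use c in \<open>simp add: y_def\<close>)
      moreover have "\<bar>\<psi> (restrict y {..<l}) - h y\<bar> < e"
        by (rule happ) (use yM in blast, simp add: y_def)
      moreover have "\<bar>\<psi> (restrict y {..<l})\<bar> \<le> c0 * (1 + real l * M\<^sup>2)"
      proof -
        have "(y t)\<^sup>2 \<le> M\<^sup>2" for t using yM[of t] power_mono[of "\<bar>y t\<bar>" M 2] by simp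
        then have "(\<Sum>t<l. (y t)\<^sup>2) \<le> (\<Sum>t<l. M\<^sup>2)" by (intro sum_mono)
        then show ?thesis
          using c0 by (intro order_trans[OF gr] mult_left_mono) auto
      qed
      ultimately show ?thesis using e by linarith
    qed
    have main: "\<bar>\<psi> x - h x\<bar> \<le> e + c0 * (real l + 4) * real l * (\<Sum>t<l. x t ^ 4) / M"
      if x: "x \<in> PiE {..<l} (\<lambda>_. UNIV)" for x
    proof (cases "\<forall>t<l. \<bar>x t\<bar> \<le> M")
      case True
      define y where "y t = (if t < l then x t else 0)" for t
      have "restrict y {..<l} = x"
        using x by (auto simp: y_def PiE_def extensional_def restrict_def fun_eq_iff)
      moreover have "h x = h y" by (rule sin_algebra_cong[OF h]) (simp add: y_def)
      moreover have "\<bar>\<psi> (restrict y {..<l}) - h y\<bar> < e" by (rule happ) (use True in \<open>auto simp: y_def\<close>)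
      moreover have "0 \<le> c0 * (real l + 4) * real l * (\<Sum>t<l. x t ^ 4) / M"
        using c0 M by (intro divide_nonneg_nonneg mult_nonneg_nonneg sum_nonneg) auto
      ultimately show ?thesis by simp
    next
      \<comment> \<open>Some coordinate exceeds M, so the sum s of squares dominates 1, M and M^2.
        Both functions are then O(s), and s \<le> s^2 / M produces the small factor 1 / M against
        fourth powers.\<close>
      case False
      then obtain u where u: "u < l" "\<bar>x u\<bar> > M" by force
      define s where "s = (\<Sum>t<l. (x t)\<^sup>2)"
      have "M\<^sup>2 \<le> \<bar>x u\<bar>\<^sup>2" using u M by (intro power_mono) auto
      also have "\<dots> \<le> s" unfolding s_def using u by (auto intro: member_le_sum)
      finally have sM: "M\<^sup>2 \<le> s" .
      have "M \<le> M\<^sup>2" using M by (simp add: power2_eq_square)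
      then have s1: "s \<ge> 1" "s \<ge> M" using M sM by linarith+
      have xr: "restrict x {..<l} = x" using x by (simp add: PiE_restrict)
      have "\<bar>\<psi> x - h x\<bar> \<le> c0 * (1 + s) + (c0 * (1 + real l * M\<^sup>2) + 1)"
        using gr[of x] hb[of x] unfolding xr s_def by linarith
      also have "\<dots> \<le> c0 * (s + s) + (c0 * (s + real l * s) + c0 * s)"
        using c0 s1 sM mult_mono[of 1 c0 1 s] by (intro add_mono mult_left_mono) auto
      also have "\<dots> = c0 * (real l + 4) * s" by (simp add: algebra_simps)
      also have "\<dots> \<le> c0 * (real l + 4) * (s\<^sup>2 / M)"
      proof (intro mult_left_mono)
        show "s \<le> s\<^sup>2 / M" using M s1 by (simp add: field_simps power2_eq_square)
      qed (use c0 in auto)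
      also have "\<dots> \<le> c0 * (real l + 4) * (l * (\<Sum>t<l. x t ^ 4) / M)"
      proof (intro mult_left_mono divide_right_mono)
        show "s\<^sup>2 \<le> l * (\<Sum>t<l. x t ^ 4)"
          using sum_squared_le_sum_of_squares[of "\<lambda>t. (x t)\<^sup>2" "{..<l}"]
          by (simp add: s_def mult.commute flip: power_mult)
      qed (use c0 M in auto)
      finally show ?thesis using e by (simp add: mult.assoc)
    qed
    show "\<exists>ps. \<forall>x\<in>PiE {..<l} (\<lambda>_. UNIV). Im (trig_poly l ps x) = 0 \<and>
      \<bar>\<psi> x - Re (trig_poly l ps x)\<bar> \<le> e + c0 * (real l + 4) * real l * (\<Sum>t<l. x t ^ 4) / M"
      by (rule exI[of _ ps]) (use main in \<open>auto simp flip: ps\<close>)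
  qed
qed

section \<open>Expectations compared through finitely many values of characteristic
  functions\<close>

definition fourth_moments_le :: "nat \<Rightarrow> real \<Rightarrow> (nat \<Rightarrow> real) measure \<Rightarrow> bool" where
  "fourth_moments_le l B N \<longleftrightarrow> prob_space N \<and> sets N = sets (PiM {..<l} (\<lambda>_. borel)) \<and>
     (\<forall>t<l. integrable N (\<lambda>x. x t ^ 4) \<and> (\<integral>x. x t ^ 4 \<partial>N) \<le> B)"

lemma iexp_phase_integrable:
  assumes "fourth_moments_le l B N"
  shows "integrable N (\<lambda>x. iexp (phase l \<theta> x))"
proof -
  interpret prob_space N using assms by (simp add: fourth_moments_le_def)
  have sets: "sets N = sets (PiM {..<l} (\<lambda>_. borel))" using assms by (simp add: fourth_moments_le_def)
  have "phase l \<theta> \<in> borel_measurable (PiM {..<l} (\<lambda>_. borel))"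
    unfolding phase_def by (intro borel_measurable_sum borel_measurable_times) auto
  then have "phase l \<theta> \<in> borel_measurable N" using measurable_cong_sets[OF sets refl] by blast
  then have "(\<lambda>x. iexp (phase l \<theta> x)) \<in> borel_measurable N" by measurable
  then show ?thesis by (intro integrable_const_bound[of _ 1]) auto
qed

lemma trig_poly_integrable:
  assumes "fourth_moments_le l B N"
  shows "integrable N (trig_poly l ps)"
proof (induction ps)
  case (Cons p ps)
  have "trig_poly l (p # ps) = (\<lambda>x. fst p * iexp (phase l (snd p) x) + trig_poly l ps x)"
    by (simp add: trig_poly_def fun_eq_iff)
  then show ?case using Cons iexp_phase_integrable[OF assms, of "snd p"] by simp
qed (simp add: trig_poly_def[abs_def])

lemma trig_poly_integral_diff:
  assumes N: "fourth_moments_le l B N" and N': "fourth_moments_le l B N'"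
    and "\<And>p. p \<in> set ps \<Longrightarrow>
      cmod (char_fn l (snd p) N - char_fn l (snd p) N') \<le> \<eta>"
  shows "cmod ((\<integral>x. trig_poly l ps x \<partial>N) - (\<integral>x. trig_poly l ps x \<partial>N')) \<le> \<eta> * (\<Sum>p\<leftarrow>ps. cmod (fst p))"
  using assms(3)
proof (induction ps)
  case (Cons p ps)
  define I where "I Q = char_fn l (snd p) Q" for Q
  define J where "J Q = (\<integral>x. trig_poly l ps x \<partial>Q)" for Q
  have int: "(\<integral>x. trig_poly l (p # ps) x \<partial>Q) = fst p * I Q + J Q"
    if "fourth_moments_le l B Q" for Q
  proof -
    have "trig_poly l (p # ps) = (\<lambda>x. fst p * iexp (phase l (snd p) x) + trig_poly l ps x)"
      by (simp add: trig_poly_def fun_eq_iff)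
    then show ?thesis
      using iexp_phase_integrable[OF that] trig_poly_integrable[OF that] by (simp add: I_def J_def)
  qed
  have "cmod (J N - J N') \<le> \<eta> * (\<Sum>p\<leftarrow>ps. cmod (fst p))" unfolding J_def by (rule Cons.IH) (use Cons.prems in auto)
  moreover have "cmod (fst p * (I N - I N')) \<le> \<eta> * cmod (fst p)"
    using Cons.prems[of p] unfolding norm_mult I_def mult.commute[of \<eta>] by (intro mult_left_mono) auto
  moreover have "cmod ((fst p * I N + J N) - (fst p * I N' + J N')) \<le> cmod (fst p * (I N - I N')) + cmod (J N - J N')"
    using norm_triangle_ineq[of "fst p * (I N - I N')" "J N - J N'"] by (simp add: algebra_simps)
  ultimately show ?case unfolding int[OF N] int[OF N'] by (simp add: algebra_simps)
qed (simp add: trig_poly_def[abs_def])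

text \<open>A uniform form of the continuity theorem: the frequencies and the tolerance depend only
  on \<open>\<psi>\<close>, \<open>B\<close> and \<open>\<epsilon>\<close>, never on the two
  measures. A statement about convergent sequences would not give an error uniform over all
  hypergraphs of large degree.\<close>

lemma pseudo_lipschitz_comparison:
  assumes psi: "pseudo_lipschitz l \<psi>" and B: "B \<ge> 0" and eps: "\<epsilon> > 0"
  shows "\<exists>\<Theta> \<eta>. finite \<Theta> \<and> \<eta> > 0 \<and> (\<forall>N N'. fourth_moments_le l B N \<and> fourth_moments_le l B N' \<and>
     (\<forall>\<theta>\<in>\<Theta>. cmod (char_fn l \<theta> N - char_fn l \<theta> N') \<le> \<eta>) \<longrightarrow>
     \<bar>(\<integral>x. \<psi> x \<partial>N) - (\<integral>x. \<psi> x \<partial>N')\<bar> < \<epsilon>)"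
proof -
  obtain c1 where c1: "c1 \<ge> 0" and ap: "\<And>M e. M \<ge> 1 \<Longrightarrow> e > 0 \<Longrightarrow> e \<le> 1 \<Longrightarrow> \<exists>ps. \<forall>x\<in>PiE {..<l} (\<lambda>_. UNIV).
      Im (trig_poly l ps x) = 0 \<and> \<bar>\<psi> x - Re (trig_poly l ps x)\<bar> \<le> e + c1 * (\<Sum>t<l. x t ^ 4) / M"
    using pseudo_lipschitz_sin_approx[OF psi] by blast
  \<comment> \<open>The budget is \<open>\<epsilon> / 4\<close> for replacing \<open>\<psi>\<close>
    by the trigonometric polynomial under each measure, half of it from \<open>e\<close> and half
    from the tail through the choice of \<open>M\<close>, and \<open>\<epsilon> / 4\<close> for the
    polynomial itself.\<close>
  define e where "e = min 1 (\<epsilon> / 8)"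
  define M where "M = 1 + 8 * c1 * real l * B / \<epsilon>"
  have e: "e > 0" "e \<le> 1" "e \<le> \<epsilon> / 8" using eps by (auto simp: e_def)
  have M: "M \<ge> 1" using c1 B eps by (simp add: M_def)
  have MB: "c1 * (real l * B) / M \<le> \<epsilon> / 8"
  proof -
    have "c1 * (real l * B) \<le> (\<epsilon> / 8) * M" using eps by (simp add: M_def field_simps)
    then show ?thesis using M by (simp add: field_simps)
  qed
  obtain ps where ps: "\<And>x. x \<in> PiE {..<l} (\<lambda>_. UNIV) \<Longrightarrow>
      \<bar>\<psi> x - Re (trig_poly l ps x)\<bar> \<le> e + c1 * (\<Sum>t<l. x t ^ 4) / M"
    using ap[OF M e(1,2)] by blast
  define s where "s = (\<Sum>p\<leftarrow>ps. cmod (fst p))"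
  have s: "s \<ge> 0" unfolding s_def by (intro sum_list_nonneg) auto
  define \<eta> where "\<eta> = \<epsilon> / (4 * (1 + s))"
  have \<eta>: "\<eta> > 0" "\<eta> * s \<le> \<epsilon> / 4" using eps s by (auto simp: \<eta>_def field_simps)
  have one: "\<bar>(\<integral>x. \<psi> x \<partial>N) - Re (\<integral>x. trig_poly l ps x \<partial>N)\<bar> \<le> \<epsilon> / 4" if N: "fourth_moments_le l B N" for N
  proof -
    interpret prob_space N using N by (simp add: fourth_moments_le_def)
    have sets: "sets N = sets (PiM {..<l} (\<lambda>_. borel))" using N by (simp add: fourth_moments_le_def)
    have sp: "space N = PiE {..<l} (\<lambda>_. UNIV)" using sets_eq_imp_space_eq[OF sets] by (simp add: space_PiM)
    have tp: "integrable N (\<lambda>x. Re (trig_poly l ps x))" using trig_poly_integrable[OF N] by simp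
    have b: "integrable N (\<lambda>x. e + c1 * (\<Sum>t<l. x t ^ 4) / M)"
      using N unfolding fourth_moments_le_def
      by (intro Bochner_Integration.integrable_add integrable_divide_zero integrable_mult_right
          Bochner_Integration.integrable_sum integrable_const) auto
    have m: "\<psi> \<in> borel_measurable N"
      using pseudo_lipschitz_measurable[OF psi] measurable_cong_sets[OF sets refl] by blast
    have "integrable N (\<lambda>x. \<psi> x - Re (trig_poly l ps x))"
    proof (rule Bochner_Integration.integrable_bound[OF b])
      show "(\<lambda>x. \<psi> x - Re (trig_poly l ps x)) \<in> borel_measurable N" using m tp by measurable
      show "AE x in N. norm (\<psi> x - Re (trig_poly l ps x)) \<le> norm (e + c1 * (\<Sum>t<l. x t ^ 4) / M)"
      proof (rule AE_I2)
        fix x assume "x \<in> space N"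
        then have "\<bar>\<psi> x - Re (trig_poly l ps x)\<bar> \<le> e + c1 * (\<Sum>t<l. x t ^ 4) / M" using ps sp by blast
        then show "norm (\<psi> x - Re (trig_poly l ps x)) \<le> norm (e + c1 * (\<Sum>t<l. x t ^ 4) / M)"
          unfolding real_norm_def by linarith
      qed
    qed
    note d = this
    have "integrable N (\<lambda>x. (\<psi> x - Re (trig_poly l ps x)) + Re (trig_poly l ps x))"
      by (rule Bochner_Integration.integrable_add[OF d tp])
    then have psii: "integrable N \<psi>" by simp
    have "\<bar>(\<integral>x. \<psi> x \<partial>N) - Re (\<integral>x. trig_poly l ps x \<partial>N)\<bar> = \<bar>\<integral>x. \<psi> x - Re (trig_poly l ps x) \<partial>N\<bar>"
      using psii tp trig_poly_integrable[OF N] by simp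
    also have "\<dots> \<le> (\<integral>x. \<bar>\<psi> x - Re (trig_poly l ps x)\<bar> \<partial>N)" by (rule integral_abs_bound)
    also have "\<dots> \<le> (\<integral>x. e + c1 * (\<Sum>t<l. x t ^ 4) / M \<partial>N)"
      by (rule integral_mono) (use d b ps sp in auto)
    also have "\<dots> = e + c1 * (\<Sum>t<l. \<integral>x. x t ^ 4 \<partial>N) / M"
    proof -
      have i: "\<And>t. t \<in> {..<l} \<Longrightarrow> integrable N (\<lambda>x. x t ^ 4)"
        using N unfolding fourth_moments_le_def by auto
      have "integrable N (\<lambda>x. c1 * (\<Sum>t<l. x t ^ 4) / M)"
        by (intro integrable_divide_zero integrable_mult_right Bochner_Integration.integrable_sum i) auto
      then show ?thesis
        using Bochner_Integration.integral_sum[of "{..<l}" N "\<lambda>t x. x t ^ 4", OF i]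
        by (simp add: prob_space)
    qed
    also have "\<dots> \<le> e + c1 * (real l * B) / M"
    proof -
      have "(\<Sum>t<l. \<integral>x. x t ^ 4 \<partial>N) \<le> real (card {..<l}) * B"
        using N unfolding fourth_moments_le_def by (intro sum_bounded_above) auto
      then show ?thesis using c1 M by (intro add_left_mono divide_right_mono mult_left_mono) auto
    qed
    also have "\<dots> \<le> \<epsilon> / 4" using MB e(3) by linarith
    finally show ?thesis .
  qed
  show ?thesis
  proof (intro exI[of _ "snd ` set ps"] exI[of _ \<eta>] conjI allI impI; (elim conjE)?)
    fix N N' assume N: "fourth_moments_le l B N" and N': "fourth_moments_le l B N'"
      and c: "\<forall>\<theta>\<in>snd ` set ps. cmod (char_fn l \<theta> N - char_fn l \<theta> N') \<le> \<eta>"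
    have "cmod ((\<integral>x. trig_poly l ps x \<partial>N) - (\<integral>x. trig_poly l ps x \<partial>N')) \<le> \<eta> * s"
      unfolding s_def by (rule trig_poly_integral_diff[OF N N']) (use c in auto)
    then have "\<bar>Re (\<integral>x. trig_poly l ps x \<partial>N) - Re (\<integral>x. trig_poly l ps x \<partial>N')\<bar> \<le> \<epsilon> / 4"
      using \<eta>(2) abs_Re_le_cmod[of "(\<integral>x. trig_poly l ps x \<partial>N) - (\<integral>x. trig_poly l ps x \<partial>N')"] by simp
    then show "\<bar>(\<integral>x. \<psi> x \<partial>N) - (\<integral>x. \<psi> x \<partial>N')\<bar> < \<epsilon>"
      using one[OF N] one[OF N'] eps by linarith
  qed (use \<eta> in auto)
qed

section \<open>Non-backtracking walks and disjoint balls\<close>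

definition nb_walk :: "('v \<Rightarrow> 'v \<Rightarrow> bool) \<Rightarrow> (nat \<Rightarrow> 'v) \<Rightarrow> nat \<Rightarrow> bool" where
  "nb_walk E f n \<longleftrightarrow> (\<forall>k<n. E (f k) (f (Suc k))) \<and> (\<forall>k. Suc (Suc k) \<le> n \<longrightarrow> f k \<noteq> f (Suc (Suc k)))"

definition has_cycle :: "('v \<Rightarrow> 'v \<Rightarrow> bool) \<Rightarrow> nat \<Rightarrow> bool" where
  "has_cycle E k \<longleftrightarrow> 3 \<le> k \<and> (\<exists>xs. length xs = k \<and> distinct xs \<and> (\<forall>j<k. E (xs ! j) (xs ! (Suc j mod k))))"

text \<open>Take a shortest return \<open>f i = f (i + m)\<close> with m > 0. Minimality makes its
  vertices distinct, irreflexivity excludes m = 1, and the absence of backtracking excludes m =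
  2.\<close>

lemma closed_nb_walk_cycle:
  assumes w: "nb_walk E f n" and "0 < n" "f 0 = f n" and irr: "\<And>x. \<not> E x x"
  shows "\<exists>k\<le>n. has_cycle E k"
proof -
  define P where "P m \<longleftrightarrow> 0 < m \<and> (\<exists>i. i + m \<le> n \<and> f i = f (i + m))" for m
  have "P n" unfolding P_def using assms by (auto intro: exI[of _ 0])
  define m where "m = (LEAST m. P m)"
  have Pm: "P m" unfolding m_def by (rule LeastI) fact
  have least: "m \<le> k" if "P k" for k unfolding m_def by (rule Least_le) fact
  obtain i where i: "0 < m" "i + m \<le> n" "f i = f (i + m)" using Pm by (auto simp: P_def)
  have "m \<noteq> 1" using i w irr by (auto simp: nb_walk_def) (metis Suc_le_eq)
  moreover have "m \<noteq> 2" using i w by (auto simp: nb_walk_def)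
  ultimately have m3: "3 \<le> m" using i by linarith
  define xs where "xs = map (\<lambda>k. f (i + k)) [0..<m]"
  have "has_cycle E m" unfolding has_cycle_def
  proof (intro conjI exI[of _ xs] allI impI)
    show "3 \<le> m" by fact
    show "length xs = m" by (simp add: xs_def)
    have "f (i + p) \<noteq> f (i + q)" if "p < q" "q < m" for p q
    proof
      assume "f (i + p) = f (i + q)"
      then have "P (q - p)" unfolding P_def using that i by (intro conjI exI[of _ "i + p"]) auto
      from least[OF this] show False using that by linarith
    qed
    then have "inj_on (\<lambda>k. f (i + k)) {0..<m}"
      by (intro linorder_inj_onI) auto
    then show "distinct xs" by (simp add: xs_def distinct_map)
    fix j assume j: "j < m"
    have "E (f (i + j)) (f (Suc (i + j)))" using w i j by (auto simp: nb_walk_def)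
    moreover have "xs ! (Suc j mod m) = f (Suc (i + j))"
    proof (cases "Suc j = m")
      case True then show ?thesis using i by (simp add: xs_def) (metis add_Suc_right)
    next
      case False then show ?thesis using j by (simp add: xs_def)
    qed
    ultimately show "E (xs ! j) (xs ! (Suc j mod m))" using j by (simp add: xs_def)
  qed
  moreover have "m \<le> n" using i by linarith
  ultimately show ?thesis by blast
qed

lemma nb_walk_Suc: "nb_walk E f (Suc n) \<Longrightarrow> nb_walk E (\<lambda>k. f (Suc k)) n"
  unfolding nb_walk_def by auto

text \<open>Common first steps are dropped. If the first steps differ, running back along one walk
  and then along the other is a closed walk without backtracking, and it would contain a cycle that
  is too short.\<close>

lemma nb_walk_unique:
  assumes sym: "\<And>x y. E x y \<Longrightarrow> E y x" and irr: "\<And>x. \<not> E x x"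
    and nc: "\<And>k. k < N \<Longrightarrow> \<not> has_cycle E k"
    and "nb_walk E f m" "nb_walk E g n" "f 0 = g 0" "f m = g n" "m + n < N"
  shows "m = n \<and> (\<forall>k\<le>m. f k = g k)"
  using assms(4-)
proof (induction m arbitrary: n f g)
  case 0
  then show ?case using closed_nb_walk_cycle[of E g n] irr nc
    by (cases n) force+
next
  case (Suc m)
  show ?case
  proof (cases n)
    case 0
    then show ?thesis using closed_nb_walk_cycle[of E f "Suc m"] irr nc Suc.prems by force
  next
    case (Suc n')
    show ?thesis
    proof (cases "f 1 = g 1")
      case True
      have "m = n' \<and> (\<forall>k\<le>m. f (Suc k) = g (Suc k))"
        using Suc.prems Suc True by (intro Suc.IH nb_walk_Suc) auto
      then show ?thesis using Suc Suc.prems(3) by (metis le_Suc_eq Suc_le_mono not0_implies_Suc)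
    next
      case False
      define M where "M = Suc m"
      \<comment> \<open>The walk \<open>f\<close> reversed, followed by \<open>g\<close>. At the
        junction, position \<open>M\<close>, it does not backtrack because
        \<open>f 1 \<noteq> g 1\<close>.\<close>
      define h where "h k = (if k \<le> M then f (M - k) else g (k - M))" for k
      have w: "nb_walk E f M" "nb_walk E g n" "f 0 = g 0" using Suc.prems by (simp_all add: M_def)
      have "nb_walk E h (M + n)" unfolding nb_walk_def
      proof (intro conjI allI impI)
        fix k assume k: "k < M + n"
        show "E (h k) (h (Suc k))"
        proof (cases "k < M")
          case True
          then have "E (f (M - Suc k)) (f (Suc (M - Suc k)))" using w by (simp add: nb_walk_def)
          then show ?thesis using True sym by (simp add: h_def Suc_diff_Suc)
        next
          case False
          then have "E (g (k - M)) (g (Suc (k - M)))" using w k by (simp add: nb_walk_def)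
          then show ?thesis using False w by (auto simp: h_def Suc_diff_le)
        qed
      next
        fix k assume k: "Suc (Suc k) \<le> M + n"
        consider "Suc (Suc k) \<le> M" | "Suc k = M" | "k \<ge> M" by linarith
        then show "h k \<noteq> h (Suc (Suc k))"
        proof cases
          case 1
          define q where "q = M - Suc (Suc k)"
          have "M - k = Suc (Suc q)" "Suc (Suc q) \<le> M" using 1 by (auto simp: q_def)
          then show ?thesis using w(1) 1 by (auto simp: nb_walk_def h_def q_def)
        next
          case 2
          then show ?thesis using False by (auto simp: h_def)
        next
          case 3
          define q where "q = k - M"
          have "k = q + M" using 3 by (simp add: q_def)
          then show ?thesis using w(2,3) k by (auto simp: nb_walk_def h_def)
        qed
      qed
      moreover have "h 0 = h (M + n)" using Suc.prems Suc by (simp add: h_def M_def)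
      ultimately show ?thesis
        using closed_nb_walk_cycle[of E h "M + n"] irr nc Suc.prems(5) by (force simp: M_def)
    qed
  qed
qed

section \<open>Balls in a factor graph of large girth\<close>

locale hypergraph =
  fixes r d L :: nat and V Fc :: "nat set" and vtx :: "nat \<Rightarrow> nat \<Rightarrow> nat"
  assumes regular: "index_regular_hypergraph r d V Fc vtx"
    and girth: "\<And>k. k < 4 * L + 4 \<Longrightarrow> \<not> fg_has_cycle_of_length r V Fc vtx k"
begin

abbreviation "nb \<equiv> nbhd r Fc vtx"
abbreviation "adj \<equiv> fg_adj r V Fc vtx"

lemma finite_V: "finite V" and finite_Fc: "finite Fc"
  and vtx_V: "b \<in> Fc \<Longrightarrow> \<kappa> < r \<Longrightarrow> vtx b \<kappa> \<in> V"
  and inj_vtx: "b \<in> Fc \<Longrightarrow> inj_on (vtx b) {..<r}"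
  and card_nb: "i \<in> V \<Longrightarrow> card (nb i) = d"
  and card_index: "i \<in> V \<Longrightarrow> \<kappa> < r \<Longrightarrow> r * card {a\<in>Fc. vtx a \<kappa> = i} = d"
  using regular unfolding index_regular_hypergraph_def by blast+

lemma finite_nb: "finite (nb i)" and nb_Fc: "b \<in> nb i \<Longrightarrow> b \<in> Fc"
  using finite_Fc by (auto simp: nbhd_def)

lemma vtx_nb: "b \<in> Fc \<Longrightarrow> \<kappa> < r \<Longrightarrow> b \<in> nb (vtx b \<kappa>)"
  by (auto simp: nbhd_def)

lemma pos_nb:
  assumes "b \<in> nb i"
  shows "pos r vtx b i < r" "vtx b (pos r vtx b i) = i"
proof -
  from assms obtain \<kappa> where "\<kappa> < r" "vtx b \<kappa> = i" by (auto simp: nbhd_def)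
  then have "\<exists>!\<kappa>. \<kappa> < r \<and> vtx b \<kappa> = i"
    using inj_vtx[OF nb_Fc[OF assms]] by (auto simp: inj_on_def)
  from theI'[OF this] show "pos r vtx b i < r" "vtx b (pos r vtx b i) = i"
    unfolding pos_def by auto
qed

lemma pos_vtx: "b \<in> Fc \<Longrightarrow> \<kappa> < r \<Longrightarrow> pos r vtx b (vtx b \<kappa>) = \<kappa>"
  using pos_nb[OF vtx_nb] inj_vtx by (metis inj_onD lessThan_iff)

text \<open>\<open>ball l i a\<close> collects the variables on which \<open>z\<^bsup>l-1\<^esup>\<close> from \<open>i\<close> to \<open>a\<close> depends; the shift makes
  \<open>ball 0\<close> empty, matching the convention \<open>z\<^bsup>-1\<^esup> = 0\<close>.\<close>

primrec ball :: "nat \<Rightarrow> nat \<Rightarrow> nat \<Rightarrow> nat set" where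
  "ball 0 i a = {}"
| "ball (Suc l) i a = insert i (\<Union>b\<in>nb i - {a}. \<Union>\<kappa>\<in>{..<r} - {pos r vtx b i}. ball l (vtx b \<kappa>) b)"

lemma ball_mono_Suc: "ball l i a \<subseteq> ball (Suc l) i a"
proof (induction l arbitrary: i a)
  case (Suc l)
  show ?case
    by (subst (1 2) ball.simps(2)) (use Suc in \<open>fast\<close>)
qed simp

lemma ball_mono: "l \<le> l' \<Longrightarrow> ball l i a \<subseteq> ball l' i a"
  by (rule lift_Suc_mono_le[of "\<lambda>l. ball l i a"]) (rule ball_mono_Suc)

lemma adj_sym: "adj x y \<Longrightarrow> adj y x" and adj_irrefl: "\<not> adj x x"
  by (auto simp: fg_adj_def)

lemma adj_nb: "i \<in> V \<Longrightarrow> b \<in> nb i \<Longrightarrow> adj (Inl i) (Inr b) \<and> adj (Inr b) (Inl i)"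
  by (auto simp: fg_adj_def nbhd_def)

lemma other_vtx:
  assumes "b \<in> nb i" "\<kappa> \<in> {..<r} - {pos r vtx b i}"
  shows "vtx b \<kappa> \<noteq> i" "vtx b \<kappa> \<in> V" "b \<in> nb (vtx b \<kappa>)"
  using assms nb_Fc[OF assms(1)] pos_vtx[of b \<kappa>] vtx_V vtx_nb by auto

text \<open>The walk runs from \<open>v\<close> to the root and ends with the step to
  \<open>a\<close>. Prolonging it from \<open>b\<close> through \<open>i\<close> to \<open>a\<close>
  then cannot backtrack, since \<open>vtx b \<kappa> \<noteq> i\<close> and
  \<open>b \<noteq> a\<close>. Every level of the ball costs two steps.\<close>

lemma ball_walk:
  assumes "v \<in> ball l i a" "i \<in> V" "a \<in> nb i"
  shows "\<exists>f n. nb_walk adj f (Suc n) \<and> f 0 = Inl v \<and> f n = Inl i \<and> f (Suc n) = Inr a \<and> n + 2 \<le> 2 * l"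
  using assms
proof (induction l arbitrary: i a)
  case (Suc l)
  show ?case
  proof (cases "v = i")
    case True
    then show ?thesis
      using Suc.prems adj_nb[of i a]
      by (intro exI[of _ "\<lambda>k. if k = 0 then Inl i else Inr a"] exI[of _ 0]) (auto simp: nb_walk_def)
  next
    case False
    then obtain b \<kappa> where b: "b \<in> nb i" "b \<noteq> a" and \<kappa>: "\<kappa> \<in> {..<r} - {pos r vtx b i}" and v: "v \<in> ball l (vtx b \<kappa>) b"
      using Suc.prems by auto
    note o = other_vtx[OF b(1) \<kappa>]
    obtain f n where f: "nb_walk adj f (Suc n)" "f 0 = Inl v" "f n = Inl (vtx b \<kappa>)" "f (Suc n) = Inr b" "n + 2 \<le> 2 * l"
      using Suc.IH[OF v o(2,3)] by blast
    define g where "g = f(n + 2 := Inl i, n + 3 := Inr a)"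
    have g: "g k = f k" if "k \<le> Suc n" for k using that by (simp add: g_def)
    have "nb_walk adj g (Suc (n + 2))" unfolding nb_walk_def
    proof (intro conjI allI impI)
      fix k assume "k < Suc (n + 2)"
      then consider "k < Suc n" | "k = Suc n" | "k = n + 2" by linarith
      then show "adj (g k) (g (Suc k))"
        using f adj_nb[OF Suc.prems(2,3)] adj_nb[OF Suc.prems(2) b(1)]
        by cases (auto simp: g_def nb_walk_def)
    next
      fix k assume "Suc (Suc k) \<le> Suc (n + 2)"
      then consider "Suc (Suc k) \<le> Suc n" | "k = n" | "k = Suc n" by linarith
      then show "g k \<noteq> g (Suc (Suc k))"
        using f o(1) b(2) by cases (auto simp: g_def nb_walk_def)
    qed
    moreover have "g 0 = Inl v" "g (n + 2) = Inl i" "g (Suc (n + 2)) = Inr a" using f by (auto simp: g_def)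
    ultimately show ?thesis using f(5) by (intro exI[of _ g] exI[of _ "n + 2"]) auto
  qed
qed simp

lemma ball_walk_root:
  assumes "i \<in> V" "b \<in> nb i" "\<kappa> \<in> {..<r} - {pos r vtx b i}" "v \<in> ball l (vtx b \<kappa>) b"
  shows "\<exists>f n. nb_walk adj f (n + 2) \<and> f 0 = Inl v \<and> f n = Inl (vtx b \<kappa>) \<and> f (n + 1) = Inr b \<and> f (n + 2) = Inl i
    \<and> n + 2 \<le> 2 * l"
proof -
  note o = other_vtx[OF assms(2,3)]
  obtain f n where f: "nb_walk adj f (Suc n)" "f 0 = Inl v" "f n = Inl (vtx b \<kappa>)" "f (Suc n) = Inr b" "n + 2 \<le> 2 * l"
    using ball_walk[OF assms(4) o(2,3)] by blast
  have "nb_walk adj (f(n + 2 := Inl i)) (n + 2)"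
    using f(1,3,4) o(1) adj_nb[OF assms(1,2)] unfolding nb_walk_def
    by (auto simp: less_Suc_eq le_Suc_eq)
  then show ?thesis using f by (intro exI[of _ "f(n + 2 := Inl i)"] exI[of _ n]) auto
qed

lemma no_cycle: "k < 4 * L + 4 \<Longrightarrow> \<not> has_cycle adj k"
  using girth unfolding has_cycle_def fg_has_cycle_of_length_def by blast

text \<open>A common variable \<open>v\<close> would start two walks to \<open>i\<close>, each of
  length at most 2L. Their total 4L is below the girth bound, so they coincide; their last vertices
  before \<open>i\<close> identify \<open>b\<close> and \<open>\<kappa>\<close>.\<close>

lemma ball_disjoint:
  assumes i: "i \<in> V" and b: "b \<in> nb i" "\<kappa> \<in> {..<r} - {pos r vtx b i}"
    and b': "b' \<in> nb i" "\<kappa>' \<in> {..<r} - {pos r vtx b' i}"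
    and ne: "(b, \<kappa>) \<noteq> (b', \<kappa>')" and l: "l \<le> L" "l' \<le> L"
  shows "ball l (vtx b \<kappa>) b \<inter> ball l' (vtx b' \<kappa>') b' = {}"
proof (rule ccontr)
  assume "\<not> ?thesis"
  then obtain v where v: "v \<in> ball l (vtx b \<kappa>) b" "v \<in> ball l' (vtx b' \<kappa>') b'" by blast
  obtain f m where f: "nb_walk adj f (m + 2)" "f 0 = Inl v" "f m = Inl (vtx b \<kappa>)" "f (m + 1) = Inr b" "f (m + 2) = Inl i" "m + 2 \<le> 2 * l"
    using ball_walk_root[OF i b v(1)] by blast
  obtain g n where g: "nb_walk adj g (n + 2)" "g 0 = Inl v" "g n = Inl (vtx b' \<kappa>')" "g (n + 1) = Inr b'" "g (n + 2) = Inl i" "n + 2 \<le> 2 * l'"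
    using ball_walk_root[OF i b' v(2)] by blast
  have "m + 2 = n + 2 \<and> (\<forall>k\<le>m + 2. f k = g k)"
    by (rule nb_walk_unique[OF adj_sym adj_irrefl no_cycle f(1) g(1)]) (use f g l in auto)
  then have "m = n" "f m = g m" "f (m + 1) = g (m + 1)" by auto
  then have "b = b'" "vtx b \<kappa> = vtx b' \<kappa>'" using f g by auto
  then have "\<kappa> = \<kappa>'" using inj_vtx[OF nb_Fc[OF b(1)]] b b' by (auto simp: inj_on_def)
  then show False using ne \<open>b = b'\<close> by simp
qed

text \<open>Otherwise a walk from \<open>i\<close> back to \<open>i\<close> would have to coincide
  with the walk of length 0.\<close>

lemma root_notin_ball:
  assumes i: "i \<in> V" and b: "b \<in> nb i" "\<kappa> \<in> {..<r} - {pos r vtx b i}" and l: "l \<le> L"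
  shows "i \<notin> ball l (vtx b \<kappa>) b"
proof
  assume v: "i \<in> ball l (vtx b \<kappa>) b"
  obtain f m where f: "nb_walk adj f (m + 2)" "f 0 = Inl i" "f (m + 2) = Inl i" "m + 2 \<le> 2 * l"
    using ball_walk_root[OF i b v] by blast
  have "m + 2 = 0 \<and> (\<forall>k\<le>m + 2. f k = Inl i)"
    by (rule nb_walk_unique[OF adj_sym adj_irrefl no_cycle f(1), where g = "\<lambda>_. Inl i" and n = 0])
      (use f l in \<open>auto simp: nb_walk_def\<close>)
  then show False by simp
qed

text \<open>A variable new in one branch could be old at \<open>i\<close> only as the root or
  through another branch, and girth rules out both. This passes test functions from the shell at
  \<open>i\<close> down to the shells of its branches.\<close>

lemma ball_shell_subset:
  assumes i: "i \<in> V" and b: "b \<in> nb i - {a}" "\<kappa> \<in> {..<r} - {pos r vtx b i}" and l: "Suc l \<le> L"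
  shows "ball (Suc l) (vtx b \<kappa>) b - ball l (vtx b \<kappa>) b \<subseteq> ball (Suc (Suc l)) i a - ball (Suc l) i a"
proof
  fix v assume v: "v \<in> ball (Suc l) (vtx b \<kappa>) b - ball l (vtx b \<kappa>) b"
  have "v \<in> ball (Suc (Suc l)) i a"
    using v b by (subst ball.simps(2)) blast
  moreover have "v \<notin> ball (Suc l) i a"
  proof
    assume "v \<in> ball (Suc l) i a"
    then consider "v = i" | b' \<kappa>' where "b' \<in> nb i - {a}" "\<kappa>' \<in> {..<r} - {pos r vtx b' i}" "v \<in> ball l (vtx b' \<kappa>') b'"
      by auto
    then show False
    proof cases
      case 1
      then show False using root_notin_ball[OF i _ b(2) l] v b(1) by blast
    next
      case 2
      have "(b, \<kappa>) \<noteq> (b', \<kappa>')" using 2 v by blast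
      then have "ball (Suc l) (vtx b \<kappa>) b \<inter> ball l (vtx b' \<kappa>') b' = {}"
        using ball_disjoint[OF i _ b(2) _ 2(2) _ l] 2 b(1) l by simp
      then show False using v 2 by blast
    qed
  qed
  ultimately show "v \<in> ball (Suc (Suc l)) i a - ball (Suc l) i a" by blast
qed

end

section \<open>The message iteration\<close>

lemma gauss_eq: "0 < v \<Longrightarrow> gauss v = density lborel (normal_density 0 (sqrt v))"
  by (simp add: gauss_def)

lemma sets_gauss [measurable_cong, simp]: "sets (gauss v) = sets borel"
  by (simp add: gauss_def)

lemma prob_space_gauss: "prob_space (gauss v)"
  by (auto simp: gauss_def intro: prob_space_normal_density prob_space_return)

lemma gauss_moment: "0 < v \<Longrightarrow> integrable (gauss v) (\<lambda>x. x ^ k)"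
  using integrable_normal_moment[of "sqrt v" 0 k]
  by (simp add: gauss_eq integrable_density)

lemma gauss_mean: "0 < v \<Longrightarrow> (\<integral>x. x \<partial>gauss v) = 0"
  using integral_normal_moment_nz_1[of "sqrt v" 0]
  by (simp add: gauss_eq integral_density)

lemma gauss_variance: "0 < v \<Longrightarrow> (\<integral>x. x\<^sup>2 \<partial>gauss v) = v"
  using integral_normal_moment_even[of "sqrt v" 0 1]
  by (simp add: gauss_eq integral_density fact_numeral)

text \<open>A multilinear polynomial is affine in each coordinate, so the derivative is the
  coefficient of that coordinate.\<close>

lemma pdiff_eq:
  "pdiff r f \<iota> y = (\<Sum>S\<in>{S\<in>Pow {..<r}. \<iota> \<in> S}. fhat r f S * (\<Prod>\<kappa>\<in>S - {\<iota>}. y \<kappa>))"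
proof -
  define c where "c S = fhat r f S * (\<Prod>\<kappa>\<in>S - {\<iota>}. y \<kappa>)" for S
  define A where "A = {S\<in>Pow {..<r}. \<iota> \<in> S}"
  define B where "B = {S\<in>Pow {..<r}. \<iota> \<notin> S}"
  have PAB: "Pow {..<r} = A \<union> B" "A \<inter> B = {}" and fin: "finite A" "finite B" by (auto simp: A_def B_def)
  have "mlext r f (y(\<iota> := t)) = (\<Sum>S\<in>A. c S) * t + (\<Sum>S\<in>B. c S)" for t
  proof -
    have "(\<Prod>\<kappa>\<in>S. (y(\<iota> := t)) \<kappa>) = t * (\<Prod>\<kappa>\<in>S - {\<iota>}. y \<kappa>)" if "S \<in> A" for S
    proof -
      have "finite S" using that finite_subset by (auto simp: A_def)
      then have "(\<Prod>\<kappa>\<in>S. (y(\<iota> := t)) \<kappa>) = t * (\<Prod>\<kappa>\<in>S - {\<iota>}. (y(\<iota> := t)) \<kappa>)"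
        using that by (subst prod.remove[of S \<iota>]) (auto simp: A_def)
      also have "(\<Prod>\<kappa>\<in>S - {\<iota>}. (y(\<iota> := t)) \<kappa>) = (\<Prod>\<kappa>\<in>S - {\<iota>}. y \<kappa>)" by (intro prod.cong) auto
      finally show ?thesis .
    qed
    moreover have "(\<Prod>\<kappa>\<in>S. (y(\<iota> := t)) \<kappa>) = (\<Prod>\<kappa>\<in>S - {\<iota>}. y \<kappa>)" if "S \<in> B" for S
      using that by (intro prod.cong) (auto simp: B_def)
    ultimately have "mlext r f (y(\<iota> := t)) = (\<Sum>S\<in>A. c S * t) + (\<Sum>S\<in>B. c S)"
      unfolding mlext_def PAB(1) sum.union_disjoint[OF fin PAB(2)]
      by (intro arg_cong2[where f = "(+)"] sum.cong) (simp_all add: c_def del: fun_upd_apply)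
    then show ?thesis by (simp add: sum_distrib_right)
  qed
  moreover have "((\<lambda>t. (\<Sum>S\<in>A. c S) * t + (\<Sum>S\<in>B. c S)) has_field_derivative (\<Sum>S\<in>A. c S)) (at (y \<iota>))"
    by (auto intro!: derivative_eq_intros)
  ultimately show ?thesis
    unfolding pdiff_def using DERIV_imp_deriv by (simp add: A_def c_def)
qed

lemma length_amp_w_msg: "length (amp_w_msg r f d Fc vtx Fm z l) = Suc l"
  by (induction l) (simp_all add: Let_def)

lemma amp_w_msg_nth:
  "s \<le> l \<Longrightarrow> amp_w_msg r f d Fc vtx Fm z l ! s = amp_w_msg r f d Fc vtx Fm z s ! s"
  by (induction l) (auto simp: Let_def nth_append length_amp_w_msg le_Suc_eq)

lemma (in iid_space) E_lincomb:
  assumes "allmom PM h" "\<And>k. k \<in> I \<Longrightarrow> allmom PM (X k)"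
  shows "E (\<lambda>z. h z * (\<Sum>k\<in>I. c k * X k z)) = (\<Sum>k\<in>I. c k * E (\<lambda>z. h z * X k z))"
proof -
  have "E (\<lambda>z. h z * (\<Sum>k\<in>I. c k * X k z)) = E (\<lambda>z. \<Sum>k\<in>I. c k * (h z * X k z))"
    by (simp add: sum_distrib_left mult_ac)
  also have "\<dots> = (\<Sum>k\<in>I. E (\<lambda>z. c k * (h z * X k z)))"
    by (rule Bochner_Integration.integral_sum)
      (intro integrable_mult_right allmom_integrable allmom_mult assms)
  finally show ?thesis by simp
qed

text \<open>Only the data that stay fixed as d grows. Constants defined in this locale cannot depend
  on the degree, the hypergraph or the nonlinearities, which enforces the uniformity of the error
  terms.\<close>

locale amp_params =
  fixes r :: nat and f :: "(nat \<Rightarrow> real) \<Rightarrow> real" and \<delta> K :: real and L :: nat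
  assumes r2: "r \<ge> 2"
    and no_deg1: "\<And>S. S \<subseteq> {..<r} \<Longrightarrow> card S = 1 \<Longrightarrow> fhat r f S = 0"
    and delta_pos: "\<delta> > 0"
    and K_pos: "K > 0"
    and L_def: "L = nat \<lfloor>1 / \<delta>\<rfloor>"

locale amp = amp_params + hypergraph r d L V Fc vtx
  for d :: nat and V Fc :: "nat set" and vtx :: "nat \<Rightarrow> nat \<Rightarrow> nat" +
  fixes Fm :: "nat \<Rightarrow> (nat \<Rightarrow> real) \<Rightarrow> real"
  assumes d2: "2 \<le> d"
    and admissible: "admissible_nonlin K L Fm"
    and E_A_square: "\<And>k i a. k < L \<Longrightarrow> i \<in> V \<Longrightarrow> a \<in> nb i \<Longrightarrow>
      (\<integral>z. (A_msg r f d Fc vtx Fm z k i a)\<^sup>2 \<partial>init_measure V \<delta>) = \<delta> / nu r f \<delta> (Suc k)"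
begin

sublocale iid_space V "gauss \<delta>"
  by (rule iid_space.intro[OF finite_V prob_space_gauss])

lemma PM_eq: "PM = init_measure V \<delta>"
  by (simp add: PM_def init_measure_def)

definition um :: "nat \<Rightarrow> nat \<Rightarrow> nat \<Rightarrow> (nat \<Rightarrow> real) \<Rightarrow> real" where
  "um l i a z = u_msg r f d Fc vtx Fm z l i a"

definition Am :: "nat \<Rightarrow> nat \<Rightarrow> nat \<Rightarrow> (nat \<Rightarrow> real) \<Rightarrow> real" where
  "Am k i a z = A_msg r f d Fc vtx Fm z k i a"

text \<open>Iterates are shifted by one: \<open>zz l i a\<close> is \<open>z\<^bsup>l-1\<^esup>\<close> from \<open>i\<close> to \<open>a\<close> and \<open>DD l b i\<close> is \<open>D\<^bsub>i;b\<^esub> f(z\<^bsup>l-1\<^esup>)\<close>, with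
  \<open>z\<^bsup>-1\<^esup> = 0\<close>. Since \<open>f\<close> has no terms of degree one, \<open>DD 0 = 0\<close>, which makes \<open>w\<^sup>0 = 0\<close> an instance of the recursion.\<close>

primrec zz :: "nat \<Rightarrow> nat \<Rightarrow> nat \<Rightarrow> (nat \<Rightarrow> real) \<Rightarrow> real" where
  "zz 0 i a z = 0"
| "zz (Suc l) i a z = (if l = 0 then z i else zz l i a z + Am (l - 1) i a z * um l i a z)"

abbreviation "oth b i \<equiv> {..<r} - {pos r vtx b i}"

definition DD :: "nat \<Rightarrow> nat \<Rightarrow> nat \<Rightarrow> (nat \<Rightarrow> real) \<Rightarrow> real" where
  "DD l b i z = (\<Sum>S\<in>{S\<in>Pow {..<r}. pos r vtx b i \<in> S}.
     fhat r f S * (\<Prod>\<kappa>\<in>S - {pos r vtx b i}. zz l (vtx b \<kappa>) b z))"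

text \<open>The share of the factor \<open>b\<close> in u^(l+1) before normalisation; in unshifted
  indices the increment runs from z^(l-1) to z^l.\<close>

definition YY :: "nat \<Rightarrow> nat \<Rightarrow> nat \<Rightarrow> (nat \<Rightarrow> real) \<Rightarrow> real" where
  "YY l b i z = DD (Suc l) b i z - DD l b i z"

lemma msg_A_eq: "msg_A Fm (amp_w_msg r f d Fc vtx Fm z l) k i a = Am k i a z" if "k \<le> l"
proof -
  have "(amp_w_msg r f d Fc vtx Fm z l ! Suc t) i a - (amp_w_msg r f d Fc vtx Fm z l ! t) i a
      = u_msg r f d Fc vtx Fm z (Suc t) i a" if "t < k" for t
    using that \<open>k \<le> l\<close> by (simp add: u_msg_def Let_def amp_w_msg_nth[of "Suc t" l] amp_w_msg_nth[of t l] amp_w_msg_nth[of t "Suc t"] del: amp_w_msg.simps)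
  then show ?thesis unfolding msg_A_def Am_def A_msg_def
    by (intro arg_cong[where f = "Fm k"]) (auto simp: restrict_def)
qed

lemma msg_z_eq: "msg_z z Fm (amp_w_msg r f d Fc vtx Fm z l) l i a = zz (Suc l) i a z"
proof -
  have "z i + (\<Sum>s=1..m. msg_A Fm (amp_w_msg r f d Fc vtx Fm z l) (s - 1) i a
      * ((amp_w_msg r f d Fc vtx Fm z l ! s) i a - (amp_w_msg r f d Fc vtx Fm z l ! (s - 1)) i a)) = zz (Suc m) i a z"
    if "m \<le> l" for m
    using that
  proof (induction m)
    case (Suc m)
    have "(amp_w_msg r f d Fc vtx Fm z l ! Suc m) i a - (amp_w_msg r f d Fc vtx Fm z l ! m) i a = um (Suc m) i a z"
      using Suc.prems by (simp add: um_def u_msg_def Let_def amp_w_msg_nth[of "Suc m" l] amp_w_msg_nth[of m l] amp_w_msg_nth[of m "Suc m"] del: amp_w_msg.simps)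
    then show ?case using Suc msg_A_eq[of m l z i a] by simp
  qed simp
  from this[of l] show ?thesis by (simp add: msg_z_def)
qed

lemma DD_0: "DD 0 b i z = 0"
  unfolding DD_def
proof (intro sum.neutral ballI)
  fix S assume S: "S \<in> {S\<in>Pow {..<r}. pos r vtx b i \<in> S}"
  show "fhat r f S * (\<Prod>\<kappa>\<in>S - {pos r vtx b i}. zz 0 (vtx b \<kappa>) b z) = 0"
  proof (cases "S = {pos r vtx b i}")
    case True
    then have "fhat r f S = 0" using S by (intro no_deg1) auto
    then show ?thesis by simp
  next
    case False
    then obtain \<kappa> where "\<kappa> \<in> S - {pos r vtx b i}" using S by blast
    moreover have "finite S" using S finite_subset by auto
    ultimately show ?thesis by auto
  qed
qed

lemma w_msg_eq: "(amp_w_msg r f d Fc vtx Fm z l ! l) i a = (\<Sum>b\<in>nb i - {a}. DD l b i z) / sqrt (real d - 1)"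
proof (cases l)
  case (Suc m)
  then show ?thesis
    by (simp add: Let_def nth_append length_amp_w_msg pdiff_eq msg_z_eq DD_def del: zz.simps)
qed (simp add: DD_0)

lemma um_eq: "um (Suc l) i a z = (\<Sum>b\<in>nb i - {a}. YY l b i z) / sqrt (real d - 1)"
  unfolding um_def u_msg_def Let_def
  by (simp add: amp_w_msg_nth[of l "Suc l"] w_msg_eq YY_def sum_subtractf diff_divide_distrib del: amp_w_msg.simps)

lemma w_node_eq: "w_node r f d Fc vtx Fm z l i = (\<Sum>b\<in>nb i. DD l b i z) / sqrt d"
  by (cases l) (simp_all add: w_node_def Let_def pdiff_eq msg_z_eq DD_0 DD_def[of "Suc _"] del: zz.simps)

lemma u_node_eq: "u_node r f d Fc vtx Fm z (Suc l) i = (\<Sum>b\<in>nb i. YY l b i z) / sqrt d"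
  by (simp add: u_node_def w_node_eq YY_def sum_subtractf diff_divide_distrib)

definition branch :: "nat \<Rightarrow> nat \<Rightarrow> nat \<Rightarrow> nat set" where
  "branch l b i = (\<Union>\<kappa>\<in>oth b i. ball l (vtx b \<kappa>) b)"

declare ball.simps(2) [simp del]

lemma branch_mono: "l \<le> l' \<Longrightarrow> branch l b i \<subseteq> branch l' b i"
  unfolding branch_def using ball_mono by fast

lemma ball_Suc_branch: "ball (Suc l) i a = insert i (\<Union>b\<in>nb i - {a}. branch l b i)"
  by (simp add: branch_def ball.simps(2))

lemma branch_disjoint:
  assumes "i \<in> V" "b \<in> nb i" "b' \<in> nb i" "b \<noteq> b'" "l \<le> L" "l' \<le> L"
  shows "branch l b i \<inter> branch l' b' i = {}"
  unfolding branch_def using ball_disjoint[OF assms(1,2) _ assms(3) _ _ assms(5,6)] assms(4) by blast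

lemma branch_disjoint_family:
  assumes "i \<in> V" "B \<subseteq> nb i" "l \<le> L"
  shows "disjoint_family_on (\<lambda>b. branch l b i) B"
  using branch_disjoint assms unfolding disjoint_family_on_def by blast

text \<open>Locality and moments are carried through one induction: \<open>A\<close> at one level is
  a function of all earlier \<open>u\<close>, which need both properties.\<close>

definition good :: "nat \<Rightarrow> bool" where
  "good l \<longleftrightarrow> (\<forall>i\<in>V. \<forall>a\<in>nb i. dep (ball l i a) (zz l i a) \<and> allmom PM (zz l i a))"

lemma good_DD:
  assumes "good l" "b \<in> nb i"
  shows "dep (branch l b i) (DD l b i)" "allmom PM (DD l b i)"
proof -
  have *: "dep (ball l (vtx b \<kappa>) b) (zz l (vtx b \<kappa>) b)" "allmom PM (zz l (vtx b \<kappa>) b)" if "\<kappa> \<in> oth b i" for \<kappa>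
    using assms(1) other_vtx[OF assms(2) that] by (auto simp: good_def)
  have "dep (branch l b i) (zz l (vtx b \<kappa>) b)" if "\<kappa> \<in> oth b i" for \<kappa>
    by (rule dep_mono[OF *(1)[OF that]]) (use that in \<open>auto simp: branch_def\<close>)
  then show "dep (branch l b i) (DD l b i)"
    unfolding DD_def[abs_def]
    by (intro dep_sum dep_comp2[where g = "(*)"] dep_const dep_prod) auto
  show "allmom PM (DD l b i)"
    unfolding DD_def[abs_def] by (intro allmom_sum allmom_cmult allmom_prod *) auto
qed

lemma good_YY:
  assumes "good l" "good (Suc l)" "b \<in> nb i"
  shows "dep (branch (Suc l) b i) (YY l b i)" "allmom PM (YY l b i)"
proof -
  have "dep (branch (Suc l) b i) (DD l b i)"
    using good_DD(1)[OF assms(1,3)] branch_mono[of l "Suc l" b i] dep_mono by auto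
  then show "dep (branch (Suc l) b i) (YY l b i)"
    unfolding YY_def[abs_def] using good_DD(1)[OF assms(2,3)] by (intro dep_comp2[where g = "(-)"])
  show "allmom PM (YY l b i)"
    unfolding YY_def[abs_def] by (intro allmom_diff good_DD assms)
qed

lemma good_um:
  assumes "good l" "good (Suc l)"
  shows "dep (ball (Suc (Suc l)) i a) (um (Suc l) i a)" "allmom PM (um (Suc l) i a)"
proof -
  have "dep (ball (Suc (Suc l)) i a) (YY l b i)" if "b \<in> nb i - {a}" for b
    by (rule dep_mono[OF good_YY(1)[OF assms]]) (use that in \<open>auto simp: ball_Suc_branch\<close>)
  then show "dep (ball (Suc (Suc l)) i a) (um (Suc l) i a)"
    unfolding um_eq[abs_def] by (intro dep_comp2[where g = "(/)"] dep_sum dep_const) auto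
  show "allmom PM (um (Suc l) i a)"
    unfolding um_eq[abs_def] by (intro allmom_divide allmom_sum good_YY assms) auto
qed

text \<open>Measurability of the nonlinearity with its bound K already gives all moments. The radius
  is \<open>Suc k\<close> because the last argument u^k reaches exactly that far.\<close>

lemma good_Am:
  assumes "\<And>s. s \<le> k \<Longrightarrow> good s" "k < L"
  shows "dep (ball (Suc k) i a) (Am k i a)" "allmom PM (Am k i a)" "\<bar>Am k i a z\<bar> \<le> K"
proof -
  have u: "dep (ball (Suc k) i a) (um (Suc t) i a)" "um (Suc t) i a \<in> borel_measurable PM" if "t < k" for t
  proof -
    have g: "good t" "good (Suc t)" using assms(1) that by auto
    show "dep (ball (Suc k) i a) (um (Suc t) i a)"
      by (rule dep_mono[OF good_um(1)[OF g] ball_mono]) (use that in simp)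
    show "um (Suc t) i a \<in> borel_measurable PM"
      by (rule allmom_measurable[OF good_um(2)[OF g]])
  qed
  have eq: "Am k i a z = Fm k (\<lambda>t\<in>{..<k}. um (Suc t) i a z)" for z
    by (simp add: Am_def A_msg_def um_def)
  show "dep (ball (Suc k) i a) (Am k i a)"
    unfolding eq[abs_def]
    by (rule dep_family[where I = "{..<k}" and X = "\<lambda>t. um (Suc t) i a" and g = "\<lambda>p. Fm k (restrict p {..<k})"])
      (use u in \<open>auto intro!: arg_cong[where f = "Fm k"]\<close>)
  show b: "\<bar>Am k i a z\<bar> \<le> K" for z
    unfolding eq using admissible assms(2) by (auto simp: admissible_nonlin_def)
  have "Fm k \<in> borel_measurable (PiM {..<k} (\<lambda>_. borel))"
    using admissible assms(2) by (auto simp: admissible_nonlin_def)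
  moreover have "(\<lambda>z. \<lambda>t\<in>{..<k}. um (Suc t) i a z) \<in> measurable PM (PiM {..<k} (\<lambda>_. borel))"
    using u by (intro measurable_restrict) auto
  ultimately have "Am k i a \<in> borel_measurable PM"
    unfolding eq[abs_def] by (rule measurable_compose[rotated])
  then show "allmom PM (Am k i a)" using b by (rule allmom_bounded)
qed

lemma allmom_init: "i \<in> V \<Longrightarrow> allmom PM (\<lambda>z. z i)"
  and E_init: "i \<in> V \<Longrightarrow> E (\<lambda>z. z i) = 0"
  and E_init_power: "i \<in> V \<Longrightarrow> E (\<lambda>z. z i ^ k) = (\<integral>x. x ^ k \<partial>gauss \<delta>)"
proof -
  assume i: "i \<in> V"
  interpret PP: product_prob_space "\<lambda>_. gauss \<delta>" V by (rule product_prob_spaceI) (rule prob_space_gauss)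
  have m: "(\<lambda>z. z i) \<in> measurable PM (gauss \<delta>)" unfolding PM_def using i by (rule measurable_component_singleton)
  have d: "distr PM (gauss \<delta>) (\<lambda>z. z i) = gauss \<delta>"
    unfolding PM_def by (rule PP.PiM_component[OF i])
  have g: "(\<lambda>x. x ^ k) \<in> borel_measurable (gauss \<delta>)" for k :: nat
    unfolding measurable_cong_sets[OF sets_gauss refl] by measurable
  show E: "E (\<lambda>z. z i ^ k) = (\<integral>x. x ^ k \<partial>gauss \<delta>)" for k
    using integral_distr[OF m g] unfolding d by simp
  have "integrable PM (\<lambda>z. z i ^ k)" for k
    using integrable_distr_eq[OF m g] gauss_moment[OF delta_pos] unfolding d by simp
  moreover have "(\<lambda>z. z i) \<in> borel_measurable PM"
    using m measurable_cong_sets[OF refl sets_gauss] by blast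
  ultimately show "allmom PM (\<lambda>z. z i)" by (simp add: allmom_def)
  show "E (\<lambda>z. z i) = 0" using E[of 1] gauss_mean[OF delta_pos] by simp
qed

lemma good: "l \<le> L \<Longrightarrow> good l"
proof (induction l rule: less_induct)
  case (less l)
  consider "l = 0" | "l = 1" | m where "l = Suc (Suc m)" by (metis One_nat_def not0_implies_Suc)
  then show ?case
  proof cases
    case 1
    moreover have "zz 0 i a = (\<lambda>z. 0)" for i a by (simp add: fun_eq_iff)
    ultimately show ?thesis by (simp add: good_def dep_const allmom_const)
  next
    case 2
    moreover have "zz (Suc 0) i a = (\<lambda>z. z i)" for i a by (simp add: fun_eq_iff)
    ultimately show ?thesis by (auto simp: good_def dep_def allmom_init ball.simps(2))
  next
    case 3
    have g: "good s" if "s \<le> Suc m" for s using less that 3 by auto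
    show ?thesis unfolding good_def
    proof (intro ballI conjI)
      fix i a assume ia: "i \<in> V" "a \<in> nb i"
      have z: "zz l i a z = zz (Suc m) i a z + Am m i a z * um (Suc m) i a z" for z by (simp add: 3)
      note A = good_Am[of m i a] and u = good_um[of m i a]
      have sub: "ball (Suc m) i a \<subseteq> ball l i a" using ball_mono 3 by simp
      have "dep (ball (Suc m) i a) (zz (Suc m) i a)" "dep (ball (Suc m) i a) (Am m i a)"
        using g[of "Suc m"] ia A g less.prems 3 by (auto simp: good_def)
      then have "dep (ball l i a) (zz (Suc m) i a)" "dep (ball l i a) (Am m i a)"
        using sub by (auto intro: dep_mono)
      then show "dep (ball l i a) (zz l i a)"
        unfolding z[abs_def] using u(1) g
        by (intro dep_comp2[where g = "(+)"] dep_comp2[where g = "(*)"]) (auto simp: 3 simp del: zz.simps)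
      have "allmom PM (zz (Suc m) i a)" using g[of "Suc m"] ia by (auto simp: good_def)
      then show "allmom PM (zz l i a)"
        unfolding z[abs_def] using u g A less.prems 3 by (intro allmom_add allmom_mult) (auto simp del: zz.simps)
    qed
  qed
qed

lemma zz_Suc_Suc: "zz (Suc (Suc l)) i a z = zz (Suc l) i a z + Am l i a z * um (Suc l) i a z"
  by simp

declare zz.simps [simp del]

lemmas dep_zz = good[unfolded good_def, rule_format, THEN conjunct1]
lemmas allmom_zz = good[unfolded good_def, rule_format, THEN conjunct2]

lemma dep_DD: "l \<le> L \<Longrightarrow> b \<in> nb i \<Longrightarrow> dep (branch l b i) (DD l b i)"
  and allmom_DD: "l \<le> L \<Longrightarrow> b \<in> nb i \<Longrightarrow> allmom PM (DD l b i)"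
  using good_DD good by blast+

lemma dep_YY: "l < L \<Longrightarrow> b \<in> nb i \<Longrightarrow> dep (branch (Suc l) b i) (YY l b i)"
  and allmom_YY: "l < L \<Longrightarrow> b \<in> nb i \<Longrightarrow> allmom PM (YY l b i)"
  using good_YY[OF good good] by simp_all

lemma allmom_um: "l < L \<Longrightarrow> allmom PM (um (Suc l) i a)"
  using good_um[OF good good] by simp

lemma dep_Am: "k < L \<Longrightarrow> dep (ball (Suc k) i a) (Am k i a)"
  and allmom_Am: "k < L \<Longrightarrow> allmom PM (Am k i a)"
  and Am_bound: "k < L \<Longrightarrow> \<bar>Am k i a z\<bar> \<le> K"
  using good_Am good by simp_all

text \<open>Says that the increment has conditional mean zero given all variables outside the new
  shell, in terms of test functions so that no conditional expectations are needed.\<close>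

definition zz_orth :: "nat \<Rightarrow> bool" where
  "zz_orth l \<longleftrightarrow> (\<forall>i\<in>V. \<forall>a\<in>nb i. \<forall>h. allmom PM h \<longrightarrow> dep (- (ball (Suc l) i a - ball l i a)) h \<longrightarrow>
     E (\<lambda>z. h z * (zz (Suc l) i a z - zz l i a z)) = 0)"

text \<open>\<open>YY\<close> is a combination of differences of monomials in the messages arriving
  at \<open>b\<close>. These messages live on disjoint balls, so \<open>E_telescope\<close> applies
  to every monomial.\<close>

lemma YY_orth_step:
  assumes zo: "zz_orth l" and l: "l < L" and b: "i \<in> V" "b \<in> nb i" and h: "allmom PM h"
    "dep (- (\<Union>\<kappa>\<in>oth b i. ball (Suc l) (vtx b \<kappa>) b - ball l (vtx b \<kappa>) b)) h"
  shows "E (\<lambda>z. h z * YY l b i z) = 0"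
proof -
  define \<iota> where "\<iota> = pos r vtx b i"
  let ?x = "\<lambda>\<kappa>. zz (Suc l) (vtx b \<kappa>) b" and ?y = "\<lambda>\<kappa>. zz l (vtx b \<kappa>) b"
  let ?P = "\<lambda>S z. (\<Prod>\<kappa>\<in>S - {\<iota>}. ?x \<kappa> z) - (\<Prod>\<kappa>\<in>S - {\<iota>}. ?y \<kappa> z)"
  have ov: "vtx b \<kappa> \<in> V" "b \<in> nb (vtx b \<kappa>)" if "\<kappa> \<in> oth b i" for \<kappa>
    using other_vtx[OF b(2) that] by auto
  have am: "allmom PM (?x \<kappa>)" "allmom PM (?y \<kappa>)" if "\<kappa> \<in> oth b i" for \<kappa>
    using that ov l by (auto intro!: allmom_zz)
  have 0: "E (\<lambda>z. h z * ?P S z) = 0" if "S \<in> {S\<in>Pow {..<r}. \<iota> \<in> S}" for S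
  proof (rule E_telescope[where R = "\<lambda>\<kappa>. ball (Suc l) (vtx b \<kappa>) b" and R' = "\<lambda>\<kappa>. ball l (vtx b \<kappa>) b"])
    have S: "\<kappa> \<in> oth b i" if "\<kappa> \<in> S - {\<iota>}" for \<kappa> using that \<open>S \<in> _\<close> by (auto simp: \<iota>_def)
    show "finite (S - {\<iota>})" using that finite_subset by auto
    show "allmom PM (?x \<kappa>)" "allmom PM (?y \<kappa>)" "dep (ball (Suc l) (vtx b \<kappa>) b) (?x \<kappa>)"
      "dep (ball l (vtx b \<kappa>) b) (?y \<kappa>)" if "\<kappa> \<in> S - {\<iota>}" for \<kappa>
      using am[OF S[OF that]] ov[OF S[OF that]] l dep_zz[of "Suc l"] dep_zz[of l] by auto
    show "ball l (vtx b \<kappa>) b \<subseteq> ball (Suc l) (vtx b \<kappa>) b" for \<kappa> by (rule ball_mono_Suc)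
    show "disjoint_family_on (\<lambda>\<kappa>. ball (Suc l) (vtx b \<kappa>) b) (S - {\<iota>})"
      unfolding disjoint_family_on_def using ball_disjoint[OF b _ b(2)] S l by simp
    show "E (\<lambda>z. h z * (?x \<kappa> z - ?y \<kappa> z)) = 0"
      if "\<kappa> \<in> S - {\<iota>}" "allmom PM h" "dep (- (ball (Suc l) (vtx b \<kappa>) b - ball l (vtx b \<kappa>) b)) h" for \<kappa> h
      using zo ov[OF S[OF that(1)]] that(2,3) unfolding zz_orth_def by blast
    show "allmom PM h" by fact
    show "dep (- (\<Union>\<kappa>\<in>S - {\<iota>}. ball (Suc l) (vtx b \<kappa>) b - ball l (vtx b \<kappa>) b)) h"
      by (rule dep_mono[OF h(2)]) (use S in blast)
  qed
  have eq: "YY l b i z = (\<Sum>S\<in>{S\<in>Pow {..<r}. \<iota> \<in> S}. fhat r f S * ?P S z)" for z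
    by (simp add: YY_def DD_def \<iota>_def right_diff_distrib sum_subtractf)
  have "allmom PM (?P S)" if "S \<in> {S\<in>Pow {..<r}. \<iota> \<in> S}" for S
    using that by (intro allmom_diff allmom_prod am) (auto simp: \<iota>_def)
  then have "E (\<lambda>z. h z * YY l b i z) = (\<Sum>S\<in>{S\<in>Pow {..<r}. \<iota> \<in> S}. fhat r f S * E (\<lambda>z. h z * ?P S z))"
    unfolding eq by (rule E_lincomb[OF h(1)])
  also have "\<dots> = 0" by (rule sum.neutral) (use 0 in auto)
  finally show ?thesis .
qed

text \<open>At the start the increment is \<open>z i\<close>, centred and independent of
  \<open>h\<close>. Later it is \<open>A\<close> times a sum of \<open>YY\<close>. Since
  \<open>A\<close> depends on the old ball only, \<open>h * A\<close> is again an admissible test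
  function, and the shells of the branches lie in the shell at \<open>i\<close>.\<close>

lemma zz_orth: "l < L \<Longrightarrow> zz_orth l"
proof (induction l)
  case 0
  show ?case unfolding zz_orth_def
  proof (intro ballI allI impI)
    fix i a h assume ia: "i \<in> V" "a \<in> nb i" and h: "allmom PM h" "dep (- (ball (Suc 0) i a - ball 0 i a)) h"
    have "dep (- {i}) h" using h(2) by (simp add: ball.simps(2))
    then have "E (\<lambda>z. h z * z i) = E h * E (\<lambda>z. z i)"
      using h ia by (intro E_mult_allmom[of "- {i}" _ "{i}"]) (auto simp: dep_def allmom_init)
    then show "E (\<lambda>z. h z * (zz (Suc 0) i a z - zz 0 i a z)) = 0"
      using E_init[OF ia(1)] by (simp add: zz.simps)
  qed
next
  case (Suc l)
  show ?case unfolding zz_orth_def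
  proof (intro ballI allI impI)
    fix i a h assume ia: "i \<in> V" "a \<in> nb i" and h: "allmom PM h" "dep (- (ball (Suc (Suc l)) i a - ball (Suc l) i a)) h"
    let ?h = "\<lambda>z. h z * Am l i a z"
    have am: "allmom PM ?h" using h allmom_Am[of l] Suc.prems by (intro allmom_mult) auto
    have "E (\<lambda>z. ?h z * YY l b i z) = 0" if b: "b \<in> nb i - {a}" for b
    proof (rule YY_orth_step)
      have sub: "(\<Union>\<kappa>\<in>oth b i. ball (Suc l) (vtx b \<kappa>) b - ball l (vtx b \<kappa>) b) \<subseteq> ball (Suc (Suc l)) i a - ball (Suc l) i a"
        using ball_shell_subset[OF ia(1) b] Suc.prems by (intro UN_least) auto
      show "dep (- (\<Union>\<kappa>\<in>oth b i. ball (Suc l) (vtx b \<kappa>) b - ball l (vtx b \<kappa>) b)) ?h"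
      proof (rule dep_comp2[where g = "(*)"])
        show "dep (- (\<Union>\<kappa>\<in>oth b i. ball (Suc l) (vtx b \<kappa>) b - ball l (vtx b \<kappa>) b)) h"
          by (rule dep_mono[OF h(2)]) (use sub in blast)
        show "dep (- (\<Union>\<kappa>\<in>oth b i. ball (Suc l) (vtx b \<kappa>) b - ball l (vtx b \<kappa>) b)) (Am l i a)"
          by (rule dep_mono[OF dep_Am]) (use sub Suc.prems in \<open>simp, blast\<close>)
      qed
    qed (use Suc ia b am in auto)
    note 0 = this
    have eq: "h z * (zz (Suc (Suc l)) i a z - zz (Suc l) i a z)
        = ?h z * (\<Sum>b\<in>nb i - {a}. (1 / sqrt (real d - 1)) * YY l b i z)" for z
      by (simp add: zz_Suc_Suc um_eq sum_distrib_left[symmetric] sum_divide_distrib[symmetric])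
    have "E (\<lambda>z. ?h z * (\<Sum>b\<in>nb i - {a}. (1 / sqrt (real d - 1)) * YY l b i z))
        = (\<Sum>b\<in>nb i - {a}. (1 / sqrt (real d - 1)) * E (\<lambda>z. ?h z * YY l b i z))"
      by (rule E_lincomb[OF am]) (use Suc.prems allmom_YY[of l] in auto)
    also have "\<dots> = 0" by (rule sum.neutral) (use 0 in auto)
    finally show "E (\<lambda>z. h z * (zz (Suc (Suc l)) i a z - zz (Suc l) i a z)) = 0"
      unfolding eq .
  qed
qed

lemma YY_orth:
  assumes "l < L" "i \<in> V" "b \<in> nb i" "allmom PM h" "dep W h"
    "W \<inter> (\<Union>\<kappa>\<in>oth b i. ball (Suc l) (vtx b \<kappa>) b - ball l (vtx b \<kappa>) b) = {}"
  shows "E (\<lambda>z. h z * YY l b i z) = 0"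
  by (rule YY_orth_step[OF zz_orth]) (use assms in \<open>auto intro: dep_mono[OF assms(5)]\<close>)

end

section \<open>Moments\<close>

text \<open>Division by C moves all factors into the unit interval, where errors of a product simply
  add.\<close>

lemma prod_diff_le:
  fixes x y :: "'k \<Rightarrow> real"
  assumes "finite T" "1 \<le> C" "\<And>k. k \<in> T \<Longrightarrow> 0 \<le> x k \<and> x k \<le> C" "\<And>k. k \<in> T \<Longrightarrow> 0 \<le> y k \<and> y k \<le> C"
  shows "\<bar>(\<Prod>k\<in>T. x k) - (\<Prod>k\<in>T. y k)\<bar> \<le> C ^ card T * (\<Sum>k\<in>T. \<bar>x k - y k\<bar>)"
proof -
  have C: "0 < C" using assms(2) by simp
  have "norm ((\<Prod>k\<in>T. x k / C) - (\<Prod>k\<in>T. y k / C)) \<le> (\<Sum>k\<in>T. norm (x k / C - y k / C))"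
    by (rule norm_prod_diff) (use assms C in auto)
  also have "\<dots> \<le> (\<Sum>k\<in>T. \<bar>x k - y k\<bar>)"
  proof (rule sum_mono)
    fix k
    have "\<bar>x k - y k\<bar> / C \<le> \<bar>x k - y k\<bar> / 1" by (intro divide_left_mono) (use assms(2) in auto)
    then show "norm (x k / C - y k / C) \<le> \<bar>x k - y k\<bar>" using C by (simp flip: diff_divide_distrib)
  qed
  finally have "C ^ card T * \<bar>(\<Prod>k\<in>T. x k / C) - (\<Prod>k\<in>T. y k / C)\<bar> \<le> C ^ card T * (\<Sum>k\<in>T. \<bar>x k - y k\<bar>)"
    using C by (intro mult_left_mono) auto
  moreover have "(\<Prod>k\<in>T. w k / C) = (\<Prod>k\<in>T. w k) / C ^ card T" for w
    by (simp add: prod_dividef)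
  ultimately show ?thesis using C by (simp add: abs_mult flip: diff_divide_distrib)
qed

lemma xi_eq: "xi r f s = (\<Sum>S\<in>Pow {..<r} - {{}}. (fhat r f S)\<^sup>2 * s ^ card S)"
proof -
  let ?P = "Pow {..<r} - {{}} :: nat set set"
  have fin: "finite ?P" by simp
  have c: "card ` ?P \<subseteq> {1..r}"
  proof
    fix j assume "j \<in> card ` ?P"
    then obtain S where S: "S \<subseteq> {..<r}" "S \<noteq> {}" "j = card S" by auto
    then have "finite S" using finite_subset by auto
    then show "j \<in> {1..r}" using S card_mono[of "{..<r}" S] by (simp add: Suc_le_eq card_gt_0_iff)
  qed
  have "xi r f s = (\<Sum>j\<in>{1..r}. \<Sum>S\<in>{S\<in>?P. card S = j}. (fhat r f S)\<^sup>2 * s ^ card S)"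
    unfolding xi_def sum_distrib_right
  proof (rule sum.cong[OF refl])
    fix j assume "j \<in> {1..r}"
    then have "{S\<in>Pow {..<r}. card S = j} = {S\<in>?P. card S = j}" by auto
    then show "(\<Sum>S\<in>{S\<in>Pow {..<r}. card S = j}. (fhat r f S)\<^sup>2 * s ^ j) = (\<Sum>S\<in>{S\<in>?P. card S = j}. (fhat r f S)\<^sup>2 * s ^ card S)"
      by simp
  qed
  also have "\<dots> = (\<Sum>S\<in>?P. (fhat r f S)\<^sup>2 * s ^ card S)"
    by (rule sum.group[OF fin _ c]) simp
  finally show ?thesis .
qed

lemma deriv_xi: "deriv (xi r f) s = (\<Sum>S\<in>Pow {..<r}. (fhat r f S)\<^sup>2 * (real (card S) * s ^ (card S - 1)))"
proof -
  have "((\<lambda>s. \<Sum>S\<in>Pow {..<r} - {{}}. (fhat r f S)\<^sup>2 * s ^ card S) has_field_derivative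
      (\<Sum>S\<in>Pow {..<r} - {{}}. (fhat r f S)\<^sup>2 * (real (card S) * s ^ (card S - 1)))) (at s)"
    by (auto intro!: derivative_eq_intros sum.cong)
  then have "deriv (xi r f) s = (\<Sum>S\<in>Pow {..<r} - {{}}. (fhat r f S)\<^sup>2 * (real (card S) * s ^ (card S - 1)))"
    unfolding xi_eq[abs_def] by (rule DERIV_imp_deriv)
  also have "\<dots> = (\<Sum>S\<in>Pow {..<r}. (fhat r f S)\<^sup>2 * (real (card S) * s ^ (card S - 1)))"
    by (rule sum.mono_neutral_left) auto
  finally show ?thesis .
qed

text \<open>The factor \<open>card S\<close> counts the members of S. Writing it as a sum over them
  exhibits xi' as a sum over positions, whose terms are the second moments of the partial
  derivatives when all inputs are independent and centred with variance s.\<close>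

lemma deriv_xi_index:
  "deriv (xi r f) s = (\<Sum>\<iota><r. \<Sum>S\<in>{S\<in>Pow {..<r}. \<iota> \<in> S}. (fhat r f S)\<^sup>2 * s ^ (card S - 1))"
proof -
  let ?h = "\<lambda>S. (fhat r f S)\<^sup>2 * s ^ (card S - 1)"
  have "(\<Sum>\<iota><r. \<Sum>S\<in>{S\<in>Pow {..<r}. \<iota> \<in> S}. ?h S) = (\<Sum>S\<in>Pow {..<r}. \<Sum>\<iota>\<in>{\<iota>\<in>{..<r}. \<iota> \<in> S}. ?h S)"
    by (rule sum.swap_restrict) auto
  also have "\<dots> = (\<Sum>S\<in>Pow {..<r}. real (card S) * ?h S)"
  proof (rule sum.cong[OF refl])
    fix S assume "S \<in> Pow {..<r}"
    then have "{\<iota>\<in>{..<r}. \<iota> \<in> S} = S" by auto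
    then show "(\<Sum>\<iota>\<in>{\<iota>\<in>{..<r}. \<iota> \<in> S}. ?h S) = real (card S) * ?h S" by simp
  qed
  finally show ?thesis unfolding deriv_xi by (simp add: mult_ac)
qed

section \<open>Constants that do not depend on degree or hypergraph\<close>

context amp_params
begin

abbreviation "\<nu> k \<equiv> nu r f \<delta> (Suc k)"

definition F2 :: real where "F2 = (\<Sum>S\<in>Pow {..<r}. (fhat r f S)\<^sup>2)"
text \<open>Here 8^r is (2^r)^3, the cost of the fourth power of a sum of at most 2^r monomials; the
  added 1 keeps the constant at least 1.\<close>

definition Q4 :: real where "Q4 = 1 + 8 ^ r * (\<Sum>S\<in>Pow {..<r}. fhat r f S ^ 4)"

text \<open>The factor 16 is 8 from (x + y)^4 \<le> 8 (x^4 + y^4), times the two derivatives whose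
  difference is \<open>YY\<close>.\<close>

definition step4 :: "real \<Rightarrow> real" where
  "step4 C = 16 * Q4 * C ^ r"

primrec mom4 :: "nat \<Rightarrow> real" where
  "mom4 0 = 1 + (\<integral>x. x ^ 4 \<partial>gauss \<delta>)"
| "mom4 (Suc l) = 8 * (mom4 l + K ^ 4 * (3 * (step4 (mom4 l))\<^sup>2))"

definition C4 :: real where "C4 = mom4 L"
definition CY :: real where "CY = step4 C4"

text \<open>All errors are counted in units of 1 / sqrt (d - 1). The first term is the change of
  products of at most r second moments when each moves by e; the lone \<open>F2\<close> pays for the
  factor left out of a message neighbourhood.\<close>

definition var_err :: "real \<Rightarrow> real" where
  "var_err e = F2 * (C4 ^ r * (real r * e)) + F2"

text \<open>Distance of E[z^2] from its target, in the shifted index and in units of 1 / sqrt (d -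
  1). Levels 0 and 1 are exact. A further step adds the variance error of \<open>u\<close>,
  amplified by E[A^2] = delta / nu, and the concentration error of the squares, weighted by
  K^2.\<close>

fun err :: "nat \<Rightarrow> real" where
  "err 0 = 0"
| "err (Suc 0) = 0"
| "err (Suc (Suc l)) = err (Suc l)
    + \<delta> / nu r f \<delta> (Suc l) * (var_err (err (Suc l)) + var_err (err l)) + K\<^sup>2 * ((CY + 1) / 2)"

lemma F2_nonneg: "0 \<le> F2"
  by (auto simp: F2_def intro: sum_nonneg)

lemma Q4_ge1: "1 \<le> Q4"
  by (auto simp: Q4_def intro!: mult_nonneg_nonneg sum_nonneg)

lemma step4_ge1: "1 \<le> C \<Longrightarrow> 1 \<le> step4 C"
proof -
  assume C: "1 \<le> C"
  then have "1 \<le> C ^ r" by (rule one_le_power)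
  then have "1 * 1 \<le> Q4 * C ^ r" using Q4_ge1 by (intro mult_mono) auto
  then show ?thesis by (simp add: step4_def)
qed

lemma mom4_ge1: "1 \<le> mom4 l"
proof (induction l)
  case (Suc l)
  have *: "1 \<le> 8 * (mom4 l + q)" if "0 \<le> q" for q using Suc that by simp
  show ?case unfolding mom4.simps by (rule *) (intro mult_nonneg_nonneg, auto)
qed (simp add: integral_nonneg_AE)

lemma mom4_mono: "l \<le> l' \<Longrightarrow> mom4 l \<le> mom4 l'"
proof (rule lift_Suc_mono_le[of mom4])
  fix n
  have *: "mom4 n \<le> 8 * (mom4 n + q)" if "0 \<le> q" for q using mom4_ge1[of n] that by simp
  show "mom4 n \<le> mom4 (Suc n)" unfolding mom4.simps by (rule *) (intro mult_nonneg_nonneg, auto)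
qed

lemma C4_ge1: "1 \<le> C4" by (simp add: C4_def mom4_ge1)
lemma CY_ge1: "1 \<le> CY" by (simp add: CY_def step4_ge1 C4_ge1)

lemma L_delta: "l \<le> L \<Longrightarrow> real l * \<delta> \<le> 1"
proof -
  assume "l \<le> L"
  then have "real l \<le> real L" by simp
  also have "real L \<le> 1 / \<delta>" using delta_pos by (simp add: L_def)
  finally show ?thesis using delta_pos by (simp add: field_simps)
qed

text \<open>In the degenerate case all \<open>u\<close> vanish and \<open>nu = 0\<close>; then \<open>\<delta> / nu = 0\<close> and (P2) does not say that
  \<open>E[z\<^sup>2]\<close> grows by \<open>\<delta>\<close>.\<close>

definition nondegenerate :: bool where
  "nondegenerate \<longleftrightarrow> (\<exists>S\<subseteq>{..<r}. 2 \<le> card S \<and> fhat r f S \<noteq> 0)"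

lemma degenerate_fhat:
  assumes "\<not> nondegenerate" "S \<subseteq> {..<r}" "S \<noteq> {}"
  shows "fhat r f S = 0"
proof -
  have "finite S" using assms(2) finite_subset by auto
  then have "0 < card S" using assms(3) by (simp add: card_gt_0_iff)
  then consider "card S = 1" | "2 \<le> card S" by linarith
  then show ?thesis using assms no_deg1[OF assms(2)] unfolding nondegenerate_def by cases auto
qed

lemma nu_Suc: "nu r f \<delta> (Suc k) = (deriv (xi r f) (real (Suc k) * \<delta>) - deriv (xi r f) (real k * \<delta>)) / real r"
  by (simp add: nu_def)

lemma nu_term_nonneg:
  "0 \<le> (fhat r f S)\<^sup>2 * (real (card S) * (real (Suc k) * \<delta>) ^ (card S - 1))
      - (fhat r f S)\<^sup>2 * (real (card S) * (real k * \<delta>) ^ (card S - 1))"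
proof -
  have "(real k * \<delta>) ^ (card S - 1) \<le> (real (Suc k) * \<delta>) ^ (card S - 1)"
    using delta_pos by (intro power_mono mult_right_mono) auto
  then show ?thesis by (simp add: mult_left_mono)
qed

lemma nu_nonneg: "0 \<le> nu r f \<delta> (Suc k)"
  unfolding nu_Suc deriv_xi sum_subtractf[symmetric]
  by (intro divide_nonneg_nonneg sum_nonneg nu_term_nonneg) auto

lemma nu_pos: "nondegenerate \<Longrightarrow> 0 < nu r f \<delta> (Suc k)"
proof -
  assume nondegenerate
  then obtain S where S: "S \<subseteq> {..<r}" "2 \<le> card S" "fhat r f S \<noteq> 0" unfolding nondegenerate_def by blast
  have "(real k * \<delta>) ^ (card S - 1) < (real (Suc k) * \<delta>) ^ (card S - 1)"
    using delta_pos S by (intro power_strict_mono mult_strict_right_mono) auto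
  then have "(fhat r f S)\<^sup>2 * (real (card S) * (real k * \<delta>) ^ (card S - 1)) < (fhat r f S)\<^sup>2 * (real (card S) * (real (Suc k) * \<delta>) ^ (card S - 1))"
    using S by (intro mult_strict_left_mono) auto
  then have "0 < (\<Sum>S\<in>Pow {..<r}. (fhat r f S)\<^sup>2 * (real (card S) * (real (Suc k) * \<delta>) ^ (card S - 1))
      - (fhat r f S)\<^sup>2 * (real (card S) * (real k * \<delta>) ^ (card S - 1)))"
    using S(1) nu_term_nonneg by (intro sum_pos2[of _ S]) auto
  then show ?thesis
    unfolding nu_Suc deriv_xi sum_subtractf[symmetric] using r2 by (intro divide_pos_pos) auto
qed

lemma var_err_nonneg: "0 \<le> e \<Longrightarrow> 0 \<le> var_err e"
  using F2_nonneg C4_ge1 by (simp add: var_err_def)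

lemma err_nonneg: "0 \<le> err l"
proof (induction l rule: err.induct)
  case (3 m)
  have "0 \<le> \<delta> / nu r f \<delta> (Suc m)" using delta_pos nu_nonneg[of m] by simp
  moreover have "0 \<le> var_err (err (Suc m)) + var_err (err m)" using 3 by (intro add_nonneg_nonneg var_err_nonneg)
  moreover have "0 \<le> K\<^sup>2 * ((CY + 1) / 2)" using CY_ge1 by simp
  ultimately show ?case
    using 3(1) mult_nonneg_nonneg unfolding err.simps by (intro add_nonneg_nonneg) blast+
qed simp_all

end

section \<open>Fourth and second moments of the messages\<close>

context amp
begin

lemma allmom_prod_zz:
  assumes "l \<le> L" "b \<in> nb i" "T \<subseteq> oth b i"
  shows "allmom PM (\<lambda>z. \<Prod>\<kappa>\<in>T. zz l (vtx b \<kappa>) b z)"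
  using other_vtx[OF assms(2)] assms by (intro allmom_prod allmom_zz) auto

lemma disjoint_zz:
  assumes "l \<le> L" "i \<in> V" "b \<in> nb i" "T \<subseteq> oth b i"
  shows "disjoint_family_on (\<lambda>\<kappa>. ball l (vtx b \<kappa>) b) T"
  unfolding disjoint_family_on_def
proof (intro ballI impI)
  fix \<kappa> \<kappa>' assume "\<kappa> \<in> T" "\<kappa>' \<in> T" "\<kappa> \<noteq> \<kappa>'"
  then show "ball l (vtx b \<kappa>) b \<inter> ball l (vtx b \<kappa>') b = {}"
    using assms(1,4) by (intro ball_disjoint[OF assms(2,3) _ assms(3)]) auto
qed

lemma E_prod_zz_power:
  assumes "l \<le> L" "i \<in> V" "b \<in> nb i" "T \<subseteq> oth b i"
  shows "E (\<lambda>z. (\<Prod>\<kappa>\<in>T. zz l (vtx b \<kappa>) b z) ^ p) = (\<Prod>\<kappa>\<in>T. E (\<lambda>z. zz l (vtx b \<kappa>) b z ^ p))"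
proof -
  have "E (\<lambda>z. \<Prod>\<kappa>\<in>T. zz l (vtx b \<kappa>) b z ^ p) = (\<Prod>\<kappa>\<in>T. E (\<lambda>z. zz l (vtx b \<kappa>) b z ^ p))"
  proof (rule E_prod_allmom)
    show "finite T" using assms(4) finite_subset by auto
    show "disjoint_family_on (\<lambda>\<kappa>. ball l (vtx b \<kappa>) b) T" by (rule disjoint_zz) fact+
    fix \<kappa> assume "\<kappa> \<in> T"
    then have "vtx b \<kappa> \<in> V" "b \<in> nb (vtx b \<kappa>)" using other_vtx[OF assms(3)] assms(4) by auto
    then show "dep (ball l (vtx b \<kappa>) b) (\<lambda>z. zz l (vtx b \<kappa>) b z ^ p)" "allmom PM (\<lambda>z. zz l (vtx b \<kappa>) b z ^ p)"
      using dep_comp[OF dep_zz, of l "vtx b \<kappa>" b "\<lambda>x. x ^ p"] allmom_zz assms(1) by (auto intro: allmom_power)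
  qed
  then show ?thesis by (simp add: prod_power_distrib)
qed

lemma power4_add_le: "(x + y) ^ 4 \<le> 8 * (x ^ 4 + y ^ 4)" for x y :: real
proof -
  have sq: "(u + v)\<^sup>2 \<le> 2 * (u\<^sup>2 + v\<^sup>2)" for u v :: real
    using sum_squares_bound[of u v] by (simp add: power2_sum)
  have p4: "u ^ 4 = (u\<^sup>2)\<^sup>2" for u :: real by (simp flip: power_mult)
  have "(x + y) ^ 4 \<le> (2 * (x\<^sup>2 + y\<^sup>2))\<^sup>2"
    unfolding p4 by (rule power_mono[OF sq zero_le_power2])
  also have "\<dots> = 4 * (x\<^sup>2 + y\<^sup>2)\<^sup>2" unfolding power_mult_distrib by simp
  also have "\<dots> \<le> 4 * (2 * ((x\<^sup>2)\<^sup>2 + (y\<^sup>2)\<^sup>2))"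
    using sq[of "x\<^sup>2" "y\<^sup>2"] by (rule mult_left_mono) simp
  finally show ?thesis unfolding p4 by simp
qed

lemma E_power4_add_le:
  assumes "allmom PM X" "allmom PM Y"
  shows "E (\<lambda>z. (X z + Y z) ^ 4) \<le> 8 * (E4 X + E4 Y)"
proof -
  have "E (\<lambda>z. (X z + Y z) ^ 4) \<le> E (\<lambda>z. 8 * (X z ^ 4 + Y z ^ 4))"
    using allmomD[OF allmom_add[OF assms], of 4] allmomD[OF assms(1), of 4] allmomD[OF assms(2), of 4]
    by (intro integral_mono power4_add_le) auto
  then show ?thesis using allmomD[OF assms(1), of 4] allmomD[OF assms(2), of 4] by simp
qed

text \<open>The messages in one monomial are independent, so its fourth moment is a product of
  fourth moments; C \<ge> 1 allows the common bound C^r.\<close>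

lemma E_DD_power4:
  assumes l: "l \<le> L" and b: "i \<in> V" "b \<in> nb i" and C: "1 \<le> C"
    and bd: "\<And>i a. i \<in> V \<Longrightarrow> a \<in> nb i \<Longrightarrow> E4 (zz l i a) \<le> C"
  shows "E4 (DD l b i) \<le> Q4 * C ^ r"
proof -
  define \<iota> where "\<iota> = pos r vtx b i"
  define A where "A = {S\<in>Pow {..<r}. \<iota> \<in> S}"
  define P where "P S z = (\<Prod>\<kappa>\<in>S - {\<iota>}. zz l (vtx b \<kappa>) b z)" for S z
  have sub: "S - {\<iota>} \<subseteq> oth b i" if "S \<in> A" for S using that by (auto simp: A_def \<iota>_def)
  have P: "allmom PM (P S)" if "S \<in> A" for S
    unfolding P_def using allmom_prod_zz[OF l b(2) sub[OF that]] .
  have cA: "real (card A) ^ 3 \<le> 8 ^ r"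
  proof -
    have "card A \<le> card (Pow {..<r})" unfolding A_def by (intro card_mono) auto
    from of_nat_mono[OF this, where 'a = real] have "real (card A) \<le> 2 ^ r" by (simp add: card_Pow)
    then have "real (card A) ^ 3 \<le> (2 ^ r) ^ 3" by (intro power_mono) auto
    also have "((2::real) ^ r) ^ 3 = (2 ^ 3) ^ r" by (simp only: power_mult[symmetric] mult.commute)
    finally show ?thesis by simp
  qed
  have EP: "E4 (P S) \<le> C ^ r" if "S \<in> A" for S
  proof -
    have "E4 (P S) = (\<Prod>\<kappa>\<in>S - {\<iota>}. E4 (zz l (vtx b \<kappa>) b))"
      unfolding P_def by (rule E_prod_zz_power[OF l b sub[OF that]])
    also have "\<dots> \<le> (\<Prod>\<kappa>\<in>S - {\<iota>}. C)"
      using other_vtx[OF b(2)] sub[OF that] by (intro prod_mono) (auto intro!: bd integral_nonneg_AE)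
    also have "\<dots> \<le> C ^ r"
    proof -
      have "card (S - {\<iota>}) \<le> card {..<r}" using that by (intro card_mono) (auto simp: A_def)
      then show ?thesis using C by (simp add: power_increasing)
    qed
    finally show ?thesis .
  qed
  have i4: "integrable PM (\<lambda>z. P S z ^ 4)" if "S \<in> A" for S using allmomD[OF P[OF that]] .
  have DD: "DD l b i z = (\<Sum>S\<in>A. fhat r f S * P S z)" for z by (simp add: DD_def A_def P_def \<iota>_def)
  have "E4 (DD l b i) \<le> E (\<lambda>z. 8 ^ r * (\<Sum>S\<in>A. fhat r f S ^ 4 * P S z ^ 4))"
  proof (rule integral_mono)
    show "integrable PM (\<lambda>z. DD l b i z ^ 4)" by (rule allmomD[OF allmom_DD[OF l b(2)]])
    show "integrable PM (\<lambda>z. 8 ^ r * (\<Sum>S\<in>A. fhat r f S ^ 4 * P S z ^ 4))"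
      by (intro integrable_mult_right Bochner_Integration.integrable_sum i4)
    fix z
    have "DD l b i z ^ 4 \<le> real (card A) ^ 3 * (\<Sum>S\<in>A. (fhat r f S * P S z) ^ 4)"
      unfolding DD by (rule sum_power4_le)
    also have "\<dots> \<le> 8 ^ r * (\<Sum>S\<in>A. (fhat r f S * P S z) ^ 4)"
      using cA by (intro mult_right_mono sum_nonneg) auto
    finally show "DD l b i z ^ 4 \<le> 8 ^ r * (\<Sum>S\<in>A. fhat r f S ^ 4 * P S z ^ 4)" by (simp add: power_mult_distrib)
  qed
  also have "\<dots> = 8 ^ r * (\<Sum>S\<in>A. fhat r f S ^ 4 * E4 (P S))"
    using i4 by (subst integral_mult_right_zero, subst Bochner_Integration.integral_sum) auto
  also have "\<dots> \<le> 8 ^ r * (\<Sum>S\<in>A. fhat r f S ^ 4 * C ^ r)"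
    using EP by (intro mult_left_mono sum_mono) auto
  also have "\<dots> \<le> 8 ^ r * (\<Sum>S\<in>Pow {..<r}. fhat r f S ^ 4 * C ^ r)"
    using C by (intro mult_left_mono sum_mono2) (auto simp: A_def)
  also have "\<dots> \<le> Q4 * C ^ r"
    using C by (simp add: Q4_def algebra_simps sum_distrib_left sum_distrib_right)
  finally show ?thesis .
qed

lemma E_YY_power4_step:
  assumes l: "l < L" and b: "i \<in> V" "b \<in> nb i" and C: "1 \<le> C"
    and bd: "\<And>i a s. s \<le> Suc l \<Longrightarrow> i \<in> V \<Longrightarrow> a \<in> nb i \<Longrightarrow> E4 (zz s i a) \<le> C"
  shows "E4 (YY l b i) \<le> step4 C"
proof -
  have "E (\<lambda>z. (DD (Suc l) b i z + (- DD l b i z)) ^ 4)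
      \<le> 8 * (E4 (DD (Suc l) b i) + E (\<lambda>z. (- DD l b i z) ^ 4))"
    using allmom_DD[of "Suc l" b i] allmom_cmult[OF allmom_DD[of l b i], of "-1"] l b by (intro E_power4_add_le) auto
  also have "\<dots> \<le> 8 * (Q4 * C ^ r + Q4 * C ^ r)"
    using E_DD_power4[of "Suc l" i b C] E_DD_power4[of l i b C] l b C bd by (intro mult_left_mono add_mono) auto
  also have "\<dots> = step4 C" by (simp add: step4_def)
  finally show ?thesis by (simp add: YY_def)
qed

lemma E_YY: "l < L \<Longrightarrow> i \<in> V \<Longrightarrow> b \<in> nb i \<Longrightarrow> E (YY l b i) = 0"
  using YY_orth[of l i b "\<lambda>_. 1" "{}"] allmom_const[of 1] by (simp add: dep_const)

lemma YY_family:
  assumes "l < L" "i \<in> V" "B \<subseteq> nb i"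
  shows "\<And>b. b \<in> B \<Longrightarrow> dep (branch (Suc l) b i) (YY l b i)" "disjoint_family_on (\<lambda>b. branch (Suc l) b i) B"
    "\<And>b. b \<in> B \<Longrightarrow> allmom PM (YY l b i)" "\<And>b. b \<in> B \<Longrightarrow> E (YY l b i) = 0" "finite B"
proof -
  show "dep (branch (Suc l) b i) (YY l b i)" "allmom PM (YY l b i)" "E (YY l b i) = 0" if "b \<in> B" for b
    using dep_YY[OF assms(1)] allmom_YY[OF assms(1)] E_YY[OF assms(1,2)] assms(3) that by blast+
  show "disjoint_family_on (\<lambda>b. branch (Suc l) b i) B"
    by (rule branch_disjoint_family) (use assms in auto)
  show "finite B" by (rule finite_subset[OF assms(3) finite_nb])
qed

lemma E_avg_YY_power4:
  assumes l: "l < L" and i: "i \<in> V" and B: "B \<subseteq> nb i" "B \<noteq> {}" and C: "1 \<le> C"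
    and bd: "\<And>b. b \<in> nb i \<Longrightarrow> E4 (YY l b i) \<le> C"
  shows "E (\<lambda>z. ((\<Sum>b\<in>B. YY l b i z) / sqrt (card B)) ^ 4) \<le> 3 * C\<^sup>2"
proof -
  note Y = YY_family[OF l i B(1)]
  have n: "0 < real (card B)" using B Y(5) by (simp add: card_gt_0_iff)
  have "E (\<lambda>z. (\<Sum>b\<in>B. YY l b i z) ^ 4) \<le> 3 * C\<^sup>2 * (real (card B))\<^sup>2"
    using bd B(1) by (intro E_sum_power4[OF Y(5,1,2,3,4) C]) auto
  moreover have "((\<Sum>b\<in>B. YY l b i z) / sqrt (card B)) ^ 4 = (\<Sum>b\<in>B. YY l b i z) ^ 4 / (real (card B))\<^sup>2" for z
  proof -
    have "sqrt (card B) ^ 4 = (sqrt (card B) ^ 2)\<^sup>2"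
      by (simp only: power4_eq_xxxx power2_eq_square mult.assoc)
    then show ?thesis by (simp add: power_divide)
  qed
  ultimately show ?thesis using n by (simp add: divide_le_eq)
qed

lemma message_set:
  assumes "i \<in> V" "a \<in> nb i"
  shows "nb i - {a} \<subseteq> nb i" "real (card (nb i - {a})) = real d - 1" "nb i - {a} \<noteq> {}"
proof -
  have c: "card (nb i - {a}) = d - 1" using assms card_nb[of i] finite_nb by simp
  then show "real (card (nb i - {a})) = real d - 1" using d2 by simp
  have "card (nb i - {a}) \<noteq> 0" using c d2 by simp
  then show "nb i - {a} \<noteq> {}" by (metis card.empty)
qed auto

lemma um_eq': "i \<in> V \<Longrightarrow> a \<in> nb i \<Longrightarrow> um (Suc l) i a z = (\<Sum>b\<in>nb i - {a}. YY l b i z) / sqrt (card (nb i - {a}))"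
  using message_set(2) by (simp add: um_eq)

text \<open>Strong induction, because \<open>YY\<close> at level m involves the messages at levels m
  and m + 1; monotonicity of \<open>mom4\<close> lets one constant bound both.\<close>

lemma E_zz_power4: "l \<le> L \<Longrightarrow> i \<in> V \<Longrightarrow> a \<in> nb i \<Longrightarrow> E4 (zz l i a) \<le> mom4 l"
proof (induction l arbitrary: i a rule: less_induct)
  case (less l)
  consider "l = 0" | "l = 1" | m where "l = Suc (Suc m)" by (metis One_nat_def not0_implies_Suc)
  then show ?case
  proof cases
    case 1
    then show ?thesis using mom4_ge1[of 0] by (simp add: zz.simps del: mom4.simps)
  next
    case 2
    have "E4 (zz l i a) = (\<integral>x. x ^ 4 \<partial>gauss \<delta>)"
      using E_init_power[OF less.prems(2)] by (simp add: 2 zz.simps)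
    also have "\<dots> \<le> mom4 0" by simp
    also have "\<dots> \<le> mom4 l" by (rule mom4_mono) simp
    finally show ?thesis .
  next
    case 3
    define C where "C = mom4 (Suc m)"
    have C: "1 \<le> C" unfolding C_def by (rule mom4_ge1)
    have bd: "E4 (zz s j b) \<le> C" if "s \<le> Suc m" "j \<in> V" "b \<in> nb j" for s j b
      using less.IH[of s j b] that less.prems 3 mom4_mono[of s "Suc m"] unfolding C_def by force
    have m: "m < L" using less.prems 3 by simp
    have Yb: "E4 (YY m b i) \<le> step4 C" if "b \<in> nb i" for b
      by (rule E_YY_power4_step[OF m less.prems(2) that C bd])
    have u4: "E4 (um (Suc m) i a) \<le> 3 * (step4 C)\<^sup>2"
      unfolding um_eq'[OF less.prems(2,3)]
      by (rule E_avg_YY_power4[OF m less.prems(2) message_set(1,3)[OF less.prems(2,3)] step4_ge1[OF C] Yb])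
    have "E (\<lambda>z. (Am m i a z * um (Suc m) i a z) ^ 4) \<le> E (\<lambda>z. K ^ 4 * um (Suc m) i a z ^ 4)"
    proof (rule integral_mono)
      show "integrable PM (\<lambda>z. (Am m i a z * um (Suc m) i a z) ^ 4)"
        by (rule allmomD[OF allmom_mult[OF allmom_Am[OF m] allmom_um[OF m]]])
      show "integrable PM (\<lambda>z. K ^ 4 * um (Suc m) i a z ^ 4)"
        by (rule integrable_mult_right[OF allmomD[OF allmom_um[OF m]]])
      have "Am m i a z ^ 4 \<le> K ^ 4" for z
        using power_mono[OF Am_bound[OF m, of i a z], of 4] by (simp add: power_even_abs)
      then show "(Am m i a z * um (Suc m) i a z) ^ 4 \<le> K ^ 4 * um (Suc m) i a z ^ 4" for z
        unfolding power_mult_distrib by (intro mult_right_mono) auto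
    qed
    also have "\<dots> \<le> K ^ 4 * (3 * (step4 C)\<^sup>2)" using u4 K_pos by simp
    finally have Au: "E (\<lambda>z. (Am m i a z * um (Suc m) i a z) ^ 4) \<le> K ^ 4 * (3 * (step4 C)\<^sup>2)" .
    have "E4 (zz l i a) \<le> 8 * (E4 (zz (Suc m) i a) + E (\<lambda>z. (Am m i a z * um (Suc m) i a z) ^ 4))"
      unfolding 3 zz_Suc_Suc
      by (rule E_power4_add_le[OF allmom_zz allmom_mult[OF allmom_Am[OF m] allmom_um[OF m]]]) (use m less.prems in auto)
    also have "\<dots> \<le> 8 * (C + K ^ 4 * (3 * (step4 C)\<^sup>2))"
      using bd[of "Suc m" i a] less.prems Au by (intro mult_left_mono add_mono) auto
    finally show ?thesis by (simp add: 3 C_def)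
  qed
qed

lemma E_zz_power4_C4: "l \<le> L \<Longrightarrow> i \<in> V \<Longrightarrow> a \<in> nb i \<Longrightarrow> E4 (zz l i a) \<le> C4"
  using E_zz_power4[of l i a] mom4_mono[of l L] by (simp add: C4_def)

lemma E_YY_power4: "l < L \<Longrightarrow> i \<in> V \<Longrightarrow> b \<in> nb i \<Longrightarrow> E4 (YY l b i) \<le> CY"
  unfolding CY_def by (rule E_YY_power4_step[OF _ _ _ C4_ge1 E_zz_power4_C4]) auto

lemma E_zz: "l \<le> L \<Longrightarrow> i \<in> V \<Longrightarrow> a \<in> nb i \<Longrightarrow> E (zz l i a) = 0"
proof (induction l)
  case 0
  then show ?case by (simp add: zz.simps)
next
  case (Suc l)
  have "E (\<lambda>z. 1 * (zz (Suc l) i a z - zz l i a z)) = 0"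
    by (rule zz_orth[of l, unfolded zz_orth_def, rule_format])
      (use Suc.prems in \<open>auto intro: allmom_const dep_const\<close>)
  then show ?case
    using Suc allmom_integrable[OF allmom_zz[of l i a]] allmom_integrable[OF allmom_zz[of "Suc l" i a]] by simp
qed

text \<open>Distinct monomials are orthogonal: a coordinate in exactly one of the two sets
  contributes a centred message independent of everything else. On the diagonal, independence yields
  products of second moments.\<close>

lemma E_DD_square:
  assumes l: "l \<le> L" and b: "i \<in> V" "b \<in> nb i"
  shows "E2 (DD l b i) = (\<Sum>S\<in>{S\<in>Pow {..<r}. pos r vtx b i \<in> S}.
     (fhat r f S)\<^sup>2 * (\<Prod>\<kappa>\<in>S - {pos r vtx b i}. E2 (zz l (vtx b \<kappa>) b)))"
proof -
  define \<iota> where "\<iota> = pos r vtx b i"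
  define A where "A = {S\<in>Pow {..<r}. \<iota> \<in> S}"
  define P where "P S z = (\<Prod>\<kappa>\<in>S - {\<iota>}. zz l (vtx b \<kappa>) b z)" for S z
  have sub: "S - {\<iota>} \<subseteq> oth b i" if "S \<in> A" for S using that by (auto simp: A_def \<iota>_def)
  have finA: "finite A" by (simp add: A_def)
  have P: "allmom PM (P S)" if "S \<in> A" for S
    unfolding P_def using allmom_prod_zz[OF l b(2) sub[OF that]] .
  have cross: "E (\<lambda>z. P S z * P T z) = 0" if S: "S \<in> A" and T: "T \<in> A" and \<kappa>: "\<kappa> \<in> S" "\<kappa> \<notin> T" for S T \<kappa>
  proof -
    have \<kappa>': "\<kappa> \<in> S - {\<iota>}" using \<kappa> T by (auto simp: A_def)
    have fS: "finite (S - {\<iota>})" using S finite_subset by (auto simp: A_def)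
    have o: "vtx b \<kappa> \<in> V" "b \<in> nb (vtx b \<kappa>)" using other_vtx[OF b(2)] sub[OF S] \<kappa>' by auto
    let ?R = "\<lambda>z. (\<Prod>\<kappa>\<in>S - {\<iota>} - {\<kappa>}. zz l (vtx b \<kappa>) b z) * P T z"
    have eq: "P S z * P T z = zz l (vtx b \<kappa>) b z * ?R z" for z
      unfolding P_def by (subst prod.remove[OF fS \<kappa>']) (simp add: mult_ac)
    have "E (\<lambda>z. zz l (vtx b \<kappa>) b z * ?R z) = E (zz l (vtx b \<kappa>) b) * E ?R"
    proof (rule E_mult_allmom)
      let ?W = "\<Union>\<kappa>'\<in>oth b i - {\<kappa>}. ball l (vtx b \<kappa>') b"
      show "dep (ball l (vtx b \<kappa>) b) (zz l (vtx b \<kappa>) b)" by (rule dep_zz) fact+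
      have dp: "dep ?W (\<lambda>z. \<Prod>\<kappa>\<in>Q. zz l (vtx b \<kappa>) b z)" if "Q \<subseteq> oth b i - {\<kappa>}" for Q
      proof (rule dep_prod)
        fix k assume "k \<in> Q"
        then have k: "k \<in> oth b i - {\<kappa>}" using that by blast
        then have "dep (ball l (vtx b k) b) (zz l (vtx b k) b)"
          using other_vtx[OF b(2), of k] l by (intro dep_zz) auto
        then show "dep ?W (zz l (vtx b k) b)" by (rule dep_mono) (use k in blast)
      qed
      show "dep ?W ?R" unfolding P_def
        by (intro dep_comp2[where g = "(*)"] dp) (use sub[OF S] sub[OF T] \<kappa> in auto)
      show "ball l (vtx b \<kappa>) b \<inter> ?W = {}"
        using disjoint_zz[OF l b subset_refl] sub[OF S] \<kappa>' unfolding disjoint_family_on_def by blast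
      show "allmom PM (zz l (vtx b \<kappa>) b)" by (rule allmom_zz) fact+
      show "allmom PM ?R"
        by (intro allmom_mult P T allmom_prod_zz[OF l b(2)]) (use sub[OF S] in auto)
    qed
    then show ?thesis unfolding eq using E_zz[OF l o] by simp
  qed
  have PP: "E (\<lambda>z. P S z * P T z) = (if S = T then (\<Prod>\<kappa>\<in>S - {\<iota>}. E2 (zz l (vtx b \<kappa>) b)) else 0)"
    if S: "S \<in> A" and T: "T \<in> A" for S T
  proof (cases "S = T")
    case True
    then show ?thesis using E_prod_zz_power[OF l b sub[OF S], of 2] by (simp add: P_def power2_eq_square)
  next
    case False
    then consider \<kappa> where "\<kappa> \<in> S" "\<kappa> \<notin> T" | \<kappa> where "\<kappa> \<in> T" "\<kappa> \<notin> S" by blast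
    then show ?thesis
    proof cases
      case 1 then show ?thesis using cross[OF S T] False by simp
    next
      case 2 then show ?thesis using cross[OF T S] False by (simp add: mult.commute)
    qed
  qed
  have DD: "DD l b i z = (\<Sum>S\<in>A. fhat r f S * P S z)" for z by (simp add: DD_def A_def P_def \<iota>_def)
  have DDm: "allmom PM (DD l b i)" by (rule allmom_DD[OF l b(2)])
  have inner: "E (\<lambda>z. P S z * DD l b i z) = fhat r f S * (\<Prod>\<kappa>\<in>S - {\<iota>}. E2 (zz l (vtx b \<kappa>) b))"
    if S: "S \<in> A" for S
  proof -
    have "E (\<lambda>z. P S z * DD l b i z) = (\<Sum>T\<in>A. fhat r f T * E (\<lambda>z. P S z * P T z))"
      unfolding DD by (rule E_lincomb[OF P[OF S] P])
    also have "\<dots> = (\<Sum>T\<in>A. if S = T then fhat r f S * (\<Prod>\<kappa>\<in>S - {\<iota>}. E2 (zz l (vtx b \<kappa>) b)) else 0)"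
      by (rule sum.cong) (use PP[OF S] in auto)
    also have "\<dots> = fhat r f S * (\<Prod>\<kappa>\<in>S - {\<iota>}. E2 (zz l (vtx b \<kappa>) b))"
      using S finA by simp
    finally show ?thesis .
  qed
  have "E2 (DD l b i) = E (\<lambda>z. DD l b i z * (\<Sum>S\<in>A. fhat r f S * P S z))"
    by (simp add: power2_eq_square flip: DD)
  also have "\<dots> = (\<Sum>S\<in>A. fhat r f S * E (\<lambda>z. DD l b i z * P S z))"
    by (rule E_lincomb[OF DDm P])
  also have "\<dots> = (\<Sum>S\<in>A. (fhat r f S)\<^sup>2 * (\<Prod>\<kappa>\<in>S - {\<iota>}. E2 (zz l (vtx b \<kappa>) b)))"
    by (rule sum.cong) (simp_all add: inner mult.commute[of "DD l b i _"] power2_eq_square)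
  finally show ?thesis unfolding A_def \<iota>_def .
qed

subsection \<open>Variances\<close>

text \<open>Common error scale; it dominates 1 / sqrt |B| for both kinds of neighbourhood as well as
  1 / (d - 1).\<close>

definition \<rho> :: real where "\<rho> = 1 / sqrt (real d - 1)"

text \<open>Treats messages (one factor left out) and nodes (all factors) by the same
  argument.\<close>

definition nbset :: "nat \<Rightarrow> nat set \<Rightarrow> bool" where
  "nbset i B \<longleftrightarrow> i \<in> V \<and> (B = nb i \<and> nb i \<noteq> {} \<or> (\<exists>a\<in>nb i. B = nb i - {a}))"

lemma rho: "0 < \<rho>" "1 / (real d - 1) \<le> \<rho>"
proof -
  have d: "1 \<le> real d - 1" using d2 by simp
  then show "0 < \<rho>" by (simp add: \<rho>_def)
  have "sqrt (real d - 1) \<le> sqrt ((real d - 1) * (real d - 1))"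
    using d mult_left_mono[of 1 "real d - 1" "real d - 1"] by (intro real_sqrt_le_mono) simp
  then have "sqrt (real d - 1) \<le> real d - 1" using d by simp
  then show "1 / (real d - 1) \<le> \<rho>" unfolding \<rho>_def using d by (intro divide_left_mono) auto
qed

lemma nbset:
  assumes "nbset i B"
  shows "i \<in> V" "B \<subseteq> nb i" "B \<noteq> {}" "finite B" "0 < real (card B)" "1 / sqrt (card B) \<le> \<rho>"
proof -
  show i: "i \<in> V" and B: "B \<subseteq> nb i" using assms by (auto simp: nbset_def)
  show fin: "finite B" using B finite_nb finite_subset by blast
  have c: "real d - 1 \<le> real (card B)"
    using assms card_nb[OF i] message_set(2)[OF i] by (auto simp: nbset_def)
  have d: "1 \<le> real d - 1" using d2 by simp
  show "0 < real (card B)" using c d by linarith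
  then show "B \<noteq> {}" by auto
  show "1 / sqrt (card B) \<le> \<rho>" unfolding \<rho>_def using c d by (intro divide_left_mono) auto
qed

text \<open>Each position is taken by exactly d / r of the factors at \<open>i\<close>, so averaging
  over factors is averaging over positions. This is where index regularity makes the variance
  independent of the variable.\<close>

lemma sum_index:
  fixes G :: "nat \<Rightarrow> real"
  assumes "i \<in> V"
  shows "(\<Sum>b\<in>nb i. G (pos r vtx b i)) = real d / real r * (\<Sum>\<iota><r. G \<iota>)"
proof -
  have "(\<Sum>b\<in>nb i. G (pos r vtx b i)) = (\<Sum>\<iota><r. \<Sum>b\<in>{b\<in>nb i. pos r vtx b i = \<iota>}. G (pos r vtx b i))"
    by (rule sum.group[symmetric]) (use finite_nb pos_nb in auto)
  also have "\<dots> = (\<Sum>\<iota><r. real d / real r * G \<iota>)"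
  proof (rule sum.cong[OF refl])
    fix \<iota> assume "\<iota> \<in> {..<r}"
    then have \<iota>: "\<iota> < r" by simp
    have eq: "{b\<in>nb i. pos r vtx b i = \<iota>} = {a\<in>Fc. vtx a \<iota> = i}"
      using pos_nb pos_vtx[OF _ \<iota>] nb_Fc vtx_nb[OF _ \<iota>] by fastforce
    have "real r * real (card {a\<in>Fc. vtx a \<iota> = i}) = real d"
      using card_index[OF assms \<iota>] by (metis of_nat_mult)
    then have c: "real (card {a\<in>Fc. vtx a \<iota> = i}) = real d / real r"
      using r2 by (simp add: field_simps)
    have "(\<Sum>b\<in>{b\<in>nb i. pos r vtx b i = \<iota>}. G (pos r vtx b i)) = (\<Sum>b\<in>{b\<in>nb i. pos r vtx b i = \<iota>}. G \<iota>)"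
      by (rule sum.cong) auto
    then show "(\<Sum>b\<in>{b\<in>nb i. pos r vtx b i = \<iota>}. G (pos r vtx b i)) = real d / real r * G \<iota>"
      unfolding eq by (simp add: c)
  qed
  finally show ?thesis by (simp add: sum_distrib_left)
qed

text \<open>For a node the average is exact. Leaving out \<open>a\<close> shifts it by (g - G_a) /
  (d - 1), where g is the average over positions and G_a the value at the position of
  \<open>i\<close> in \<open>a\<close>.\<close>

lemma avg_index:
  assumes B: "nbset i B" and G: "\<And>\<iota>. \<iota> < r \<Longrightarrow> 0 \<le> G \<iota> \<and> G \<iota> \<le> F"
  shows "\<bar>(\<Sum>b\<in>B. G (pos r vtx b i)) / card B - (\<Sum>\<iota><r. G \<iota>) / real r\<bar> \<le> F * \<rho>"
proof -
  note i = nbset(1)[OF B]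
  have F: "0 \<le> F" using G[of 0] r2 by force
  define g where "g = (\<Sum>\<iota><r. G \<iota>) / real r"
  have g: "0 \<le> g" "g \<le> F"
  proof -
    show "0 \<le> g" unfolding g_def using G by (intro divide_nonneg_nonneg sum_nonneg) auto
    have "(\<Sum>\<iota><r. G \<iota>) \<le> real (card {..<r}) * F" using G by (intro sum_bounded_above) auto
    then show "g \<le> F" unfolding g_def using r2 by (simp add: field_simps)
  qed
  have s: "(\<Sum>b\<in>nb i. G (pos r vtx b i)) = real d * g" using sum_index[OF i] by (simp add: g_def)
  have d: "0 < real d" "0 < real d - 1" using d2 by simp_all
  from B consider "B = nb i" | a where "a \<in> nb i" "B = nb i - {a}" by (auto simp: nbset_def)
  then have "\<bar>(\<Sum>b\<in>B. G (pos r vtx b i)) / card B - g\<bar> \<le> F * \<rho>"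
  proof cases
    case 1
    then show ?thesis using s card_nb[OF i] d F rho(1) by simp
  next
    case 2
    define ga where "ga = G (pos r vtx a i)"
    have ga: "0 \<le> ga" "ga \<le> F" using G pos_nb(1)[OF 2(1)] by (auto simp: ga_def)
    have S: "(\<Sum>b\<in>B. G (pos r vtx b i)) = real d * g - ga"
      using s finite_nb[of i] 2 by (simp add: sum_diff1 ga_def)
    have cB: "real (card B) = real d - 1" using message_set(2)[OF i 2(1)] 2(2) by simp
    have "(\<Sum>b\<in>B. G (pos r vtx b i)) / card B - g = (g - ga) / (real d - 1)"
      unfolding S cB using d by (simp add: field_simps)
    then have "\<bar>(\<Sum>b\<in>B. G (pos r vtx b i)) / card B - g\<bar> = \<bar>g - ga\<bar> * (1 / (real d - 1))"
      using d by (simp add: abs_divide)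
    also have "\<dots> \<le> F * \<rho>" using g ga rho d F by (intro mult_mono) auto
    finally show ?thesis .
  qed
  then show ?thesis by (simp add: g_def)
qed

definition zz_close :: "nat \<Rightarrow> bool" where
  "zz_close l \<longleftrightarrow> (\<forall>i\<in>V. \<forall>a\<in>nb i. \<bar>E2 (zz l i a) - real l * \<delta>\<bar> \<le> err l * \<rho>)"

lemma E_zz_square_le: "l \<le> L \<Longrightarrow> i \<in> V \<Longrightarrow> a \<in> nb i \<Longrightarrow> E2 (zz l i a) \<le> C4"
  by (rule E_square_le[OF allmom_zz E_zz_power4_C4 C4_ge1])

text \<open>Replacing the second moments in \<open>E_DD_square\<close> by
  \<open>l * \<delta>\<close> gives, for each position, its term of xi'. Closeness is assumed only
  in the nondegenerate case: otherwise the derivatives and xi' vanish, and nothing about E[z^2] is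
  needed.\<close>

lemma avg_DD:
  assumes l: "l \<le> L" and B: "nbset i B" and close: "nondegenerate \<Longrightarrow> zz_close l"
  shows "\<bar>(\<Sum>b\<in>B. E2 (DD l b i)) / card B - deriv (xi r f) (real l * \<delta>) / real r\<bar>
     \<le> var_err (err l) * \<rho>"
proof (cases nondegenerate)
  case False
  have DD0: "DD l b i z = 0" for b z
    unfolding DD_def by (intro sum.neutral ballI) (use degenerate_fhat[OF False] in auto)
  have "deriv (xi r f) (real l * \<delta>) = 0"
    unfolding deriv_xi
  proof (intro sum.neutral ballI)
    fix S assume "S \<in> Pow {..<r}"
    then show "(fhat r f S)\<^sup>2 * (real (card S) * (real l * \<delta>) ^ (card S - 1)) = 0"
      using degenerate_fhat[OF False, of S] by (cases "S = {}") auto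
  qed
  then show ?thesis using var_err_nonneg[OF err_nonneg] rho(1) by (simp add: DD0)
next
  case True
  note close = close[OF True, unfolded zz_close_def, rule_format]
  define m where "m = real l * \<delta>"
  have m: "0 \<le> m" "m \<le> 1" using L_delta[OF l] delta_pos by (auto simp: m_def)
  define G where "G \<iota> = (\<Sum>S\<in>{S\<in>Pow {..<r}. \<iota> \<in> S}. (fhat r f S)\<^sup>2 * m ^ (card S - 1))" for \<iota>
  have G: "0 \<le> G \<iota> \<and> G \<iota> \<le> F2" for \<iota>
  proof
    show "0 \<le> G \<iota>" unfolding G_def using m by (intro sum_nonneg) auto
    have "G \<iota> \<le> (\<Sum>S\<in>{S\<in>Pow {..<r}. \<iota> \<in> S}. (fhat r f S)\<^sup>2 * 1)"
      unfolding G_def using m by (intro sum_mono mult_left_mono power_le_one) auto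
    also have "\<dots> \<le> (\<Sum>S\<in>Pow {..<r}. (fhat r f S)\<^sup>2 * 1)" by (intro sum_mono2) auto
    finally show "G \<iota> \<le> F2" by (simp add: F2_def)
  qed
  have C4: "0 \<le> C4" "m \<le> C4" using C4_ge1 m by auto
  define bd where "bd = C4 ^ r * (real r * (err l * \<rho>))"
  have bd0: "0 \<le> bd" using C4 err_nonneg[of l] rho(1) by (simp add: bd_def)
  have each: "\<bar>E2 (DD l b i) - G (pos r vtx b i)\<bar> \<le> F2 * bd" if b: "b \<in> B" for b
  proof -
    have bn: "b \<in> nb i" using nbset(2)[OF B] b by blast
    define \<iota> where "\<iota> = pos r vtx b i"
    define A where "A = {S\<in>Pow {..<r}. \<iota> \<in> S}"
    define v where "v \<kappa> = E2 (zz l (vtx b \<kappa>) b)" for \<kappa>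
    have v: "0 \<le> v \<kappa> \<and> v \<kappa> \<le> C4" "\<bar>v \<kappa> - m\<bar> \<le> err l * \<rho>" if "\<kappa> \<in> oth b i" for \<kappa>
      using other_vtx[OF bn that] E_zz_square_le[OF l] close by (auto simp: v_def m_def intro: integral_nonneg_AE)
    have P: "\<bar>(\<Prod>\<kappa>\<in>S - {\<iota>}. v \<kappa>) - m ^ (card S - 1)\<bar> \<le> bd" if S: "S \<in> A" for S
    proof -
      have sub: "S - {\<iota>} \<subseteq> oth b i" and fin: "finite (S - {\<iota>})" and cS: "card (S - {\<iota>}) = card S - 1"
        using S finite_subset[of S "{..<r}"] by (auto simp: A_def \<iota>_def)
      have cr: "card (S - {\<iota>}) \<le> r" using card_mono[of "{..<r}" "S - {\<iota>}"] S by (auto simp: A_def)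
      have "\<bar>(\<Prod>\<kappa>\<in>S - {\<iota>}. v \<kappa>) - (\<Prod>\<kappa>\<in>S - {\<iota>}. m)\<bar> \<le> C4 ^ card (S - {\<iota>}) * (\<Sum>\<kappa>\<in>S - {\<iota>}. \<bar>v \<kappa> - m\<bar>)"
        using v sub m C4 by (intro prod_diff_le[OF fin C4_ge1]) auto
      also have "\<dots> \<le> C4 ^ r * (real r * (err l * \<rho>))"
      proof (rule mult_mono)
        show "C4 ^ card (S - {\<iota>}) \<le> C4 ^ r" using C4_ge1 cr by (intro power_increasing)
        have "(\<Sum>\<kappa>\<in>S - {\<iota>}. \<bar>v \<kappa> - m\<bar>) \<le> real (card (S - {\<iota>})) * (err l * \<rho>)"
          using v sub by (intro sum_bounded_above) auto
        also have "\<dots> \<le> real r * (err l * \<rho>)" using cr err_nonneg[of l] rho(1) by (intro mult_right_mono) auto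
        finally show "(\<Sum>\<kappa>\<in>S - {\<iota>}. \<bar>v \<kappa> - m\<bar>) \<le> real r * (err l * \<rho>)" .
      qed (use C4 in \<open>auto intro: sum_nonneg\<close>)
      finally show ?thesis by (simp add: cS bd_def)
    qed
    have "E2 (DD l b i) - G (pos r vtx b i)
        = (\<Sum>S\<in>A. (fhat r f S)\<^sup>2 * ((\<Prod>\<kappa>\<in>S - {\<iota>}. v \<kappa>) - m ^ (card S - 1)))"
      unfolding E_DD_square[OF l nbset(1)[OF B] bn] G_def A_def v_def \<iota>_def
      by (simp add: right_diff_distrib sum_subtractf)
    then have "\<bar>E2 (DD l b i) - G (pos r vtx b i)\<bar>
        \<le> (\<Sum>S\<in>A. (fhat r f S)\<^sup>2 * \<bar>(\<Prod>\<kappa>\<in>S - {\<iota>}. v \<kappa>) - m ^ (card S - 1)\<bar>)"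
      using sum_abs[of "\<lambda>S. (fhat r f S)\<^sup>2 * ((\<Prod>\<kappa>\<in>S - {\<iota>}. v \<kappa>) - m ^ (card S - 1))" A] by (simp add: abs_mult)
    also have "\<dots> \<le> (\<Sum>S\<in>A. (fhat r f S)\<^sup>2 * bd)" using P by (intro sum_mono mult_left_mono) auto
    also have "\<dots> \<le> (\<Sum>S\<in>Pow {..<r}. (fhat r f S)\<^sup>2 * bd)"
      using bd0 by (intro sum_mono2) (auto simp: A_def)
    finally show ?thesis by (simp add: F2_def sum_distrib_right)
  qed
  note n = nbset(5)[OF B]
  have "\<bar>(\<Sum>b\<in>B. E2 (DD l b i)) - (\<Sum>b\<in>B. G (pos r vtx b i))\<bar> \<le> (\<Sum>b\<in>B. F2 * bd)"
    unfolding sum_subtractf[symmetric] by (rule order_trans[OF sum_abs sum_mono]) (rule each)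
  then have "\<bar>(\<Sum>b\<in>B. E2 (DD l b i)) / card B - (\<Sum>b\<in>B. G (pos r vtx b i)) / card B\<bar> \<le> F2 * bd"
    using n by (simp add: divide_le_eq abs_divide mult.commute flip: diff_divide_distrib)
  moreover have "\<bar>(\<Sum>b\<in>B. G (pos r vtx b i)) / card B - (\<Sum>\<iota><r. G \<iota>) / real r\<bar> \<le> F2 * \<rho>"
    by (rule avg_index[OF B G])
  moreover have xi: "deriv (xi r f) (real l * \<delta>) = (\<Sum>\<iota><r. G \<iota>)"
    unfolding deriv_xi_index G_def m_def ..
  moreover have ve: "var_err (err l) * \<rho> = F2 * bd + F2 * \<rho>" by (simp add: var_err_def bd_def algebra_simps)
  ultimately show ?thesis unfolding xi ve by linarith
qed

text \<open>Pythagoras: the old derivative does not see the new shells, hence is orthogonal to the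
  increment.\<close>

lemma E_YY_square:
  assumes l: "l < L" and b: "i \<in> V" "b \<in> nb i"
  shows "E2 (YY l b i) = E2 (DD (Suc l) b i) - E2 (DD l b i)"
proof -
  have am: "allmom PM (DD l b i)" "allmom PM (YY l b i)" using allmom_DD allmom_YY l b(2) by auto
  have "ball l (vtx b \<kappa>) b \<inter> (ball (Suc l) (vtx b \<kappa>') b - ball l (vtx b \<kappa>') b) = {}"
    if "\<kappa> \<in> oth b i" "\<kappa>' \<in> oth b i" for \<kappa> \<kappa>'
    using ball_disjoint[OF b that(1) b(2) that(2), of l "Suc l"] l by (cases "\<kappa> = \<kappa>'") auto
  then have "E (\<lambda>z. DD l b i z * YY l b i z) = 0"
    using dep_DD[of l b i] l b by (intro YY_orth[OF l b am(1), of "branch l b i"]) (auto simp: branch_def)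
  moreover have "(DD (Suc l) b i z)\<^sup>2 = (DD l b i z)\<^sup>2 + 2 * (DD l b i z * YY l b i z) + (YY l b i z)\<^sup>2" for z
    by (simp add: YY_def power2_eq_square algebra_simps)
  ultimately show ?thesis
    using allmomD[OF am(1), of 2] allmomD[OF am(2), of 2] allmom_integrable[OF allmom_mult[OF am]] by simp
qed

lemma avg_YY:
  assumes l: "l < L" and B: "nbset i B"
    and close: "nondegenerate \<Longrightarrow> zz_close l" "nondegenerate \<Longrightarrow> zz_close (Suc l)"
  shows "\<bar>(\<Sum>b\<in>B. E2 (YY l b i)) / card B - (\<nu> l)\<bar>
    \<le> (var_err (err (Suc l)) + var_err (err l)) * \<rho>"
proof -
  have "(\<Sum>b\<in>B. E2 (YY l b i))
      = (\<Sum>b\<in>B. E2 (DD (Suc l) b i)) - (\<Sum>b\<in>B. E2 (DD l b i))"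
    unfolding sum_subtractf[symmetric] using nbset[OF B] by (intro sum.cong E_YY_square[OF l]) auto
  then have "(\<Sum>b\<in>B. E2 (YY l b i)) / card B - (\<nu> l) =
      ((\<Sum>b\<in>B. E2 (DD (Suc l) b i)) / card B - deriv (xi r f) (real (Suc l) * \<delta>) / real r)
     - ((\<Sum>b\<in>B. E2 (DD l b i)) / card B - deriv (xi r f) (real l * \<delta>) / real r)"
    unfolding nu_Suc by (simp add: diff_divide_distrib)
  moreover have "\<bar>(\<Sum>b\<in>B. E2 (DD (Suc l) b i)) / card B - deriv (xi r f) (real (Suc l) * \<delta>) / real r\<bar> \<le> var_err (err (Suc l)) * \<rho>"
    by (rule avg_DD) (use l B close in auto)
  moreover have "\<bar>(\<Sum>b\<in>B. E2 (DD l b i)) / card B - deriv (xi r f) (real l * \<delta>) / real r\<bar> \<le> var_err (err l) * \<rho>"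
    by (rule avg_DD) (use l B close in auto)
  ultimately show ?thesis by (simp add: algebra_simps)
qed

lemma nbset_message: "i \<in> V \<Longrightarrow> a \<in> nb i \<Longrightarrow> nbset i (nb i - {a})"
  and nbset_node: "i \<in> V \<Longrightarrow> a \<in> nb i \<Longrightarrow> nbset i (nb i)"
  by (auto simp: nbset_def)

text \<open>\<open>A\<close> shares variables with the \<open>YY\<close>, so the expectation does
  not factor. For b \<noteq> c, however, the product of A^2 and the term of b avoids the shell newly
  reached through c, so the cross term vanishes and only the diagonal survives.\<close>

lemma E_A_sum_square:
  assumes l: "Suc l < L" and ia: "i \<in> V" "a \<in> nb i"
  shows "E (\<lambda>z. (Am l i a z)\<^sup>2 * (\<Sum>b\<in>nb i - {a}. YY l b i z)\<^sup>2)
     = E (\<lambda>z. (Am l i a z)\<^sup>2 * (\<Sum>b\<in>nb i - {a}. (YY l b i z)\<^sup>2))"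
proof -
  define B where "B = nb i - {a}"
  define S where "S z = (\<Sum>b\<in>B. YY l b i z)" for z
  have l': "l < L" using l by simp
  have Y: "allmom PM (YY l b i)" if "b \<in> B" for b using allmom_YY[OF l'] that by (auto simp: B_def)
  have A2: "allmom PM (\<lambda>z. (Am l i a z)\<^sup>2)" by (rule allmom_power[OF allmom_Am[OF l']])
  have S: "allmom PM S" unfolding S_def using Y by (rule allmom_sum)
  have AY: "allmom PM (\<lambda>z. (Am l i a z)\<^sup>2 * YY l b i z)" if "b \<in> B" for b by (rule allmom_mult[OF A2 Y[OF that]])
  have cross: "E (\<lambda>z. ((Am l i a z)\<^sup>2 * YY l b i z) * YY l c i z) = 0" if b: "b \<in> B" and c: "c \<in> B" and ne: "b \<noteq> c" for b c
  proof (rule YY_orth[OF l' ia(1) _ AY[OF b]])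
    let ?W = "ball (Suc l) i a \<union> branch (Suc l) b i"
    let ?sh = "\<Union>\<kappa>\<in>oth c i. ball (Suc l) (vtx c \<kappa>) c - ball l (vtx c \<kappa>) c"
    show "c \<in> nb i" using c by (simp add: B_def)
    show "dep ?W (\<lambda>z. (Am l i a z)\<^sup>2 * YY l b i z)"
    proof (rule dep_comp2[where g = "(*)"])
      have "dep ?W (Am l i a)" by (rule dep_mono[OF dep_Am[OF l']]) auto
      from dep_comp[OF this, of "\<lambda>x. x\<^sup>2"] show "dep ?W (\<lambda>z. (Am l i a z)\<^sup>2)" .
      show "dep ?W (YY l b i)" by (rule dep_mono[OF dep_YY[OF l']]) (use b in \<open>auto simp: B_def\<close>)
    qed
    have "?sh \<subseteq> ball (Suc (Suc l)) i a - ball (Suc l) i a"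
      using ball_shell_subset[OF ia(1), of c a _ l] c l by (intro UN_least) (auto simp: B_def)
    moreover have "?sh \<subseteq> branch (Suc l) c i" by (auto simp: branch_def)
    moreover have "branch (Suc l) b i \<inter> branch (Suc l) c i = {}"
      by (rule branch_disjoint) (use b c ne l ia in \<open>auto simp: B_def\<close>)
    ultimately show "?W \<inter> ?sh = {}" by blast
  qed
  have inner: "E (\<lambda>z. ((Am l i a z)\<^sup>2 * S z) * YY l b i z) = E (\<lambda>z. (Am l i a z)\<^sup>2 * (YY l b i z)\<^sup>2)" if b: "b \<in> B" for b
  proof -
    have "E (\<lambda>z. ((Am l i a z)\<^sup>2 * YY l b i z) * (\<Sum>c\<in>B. 1 * YY l c i z))
        = (\<Sum>c\<in>B. 1 * E (\<lambda>z. ((Am l i a z)\<^sup>2 * YY l b i z) * YY l c i z))"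
      by (rule E_lincomb[OF AY[OF b] Y])
    also have "\<dots> = (\<Sum>c\<in>B. if c = b then E (\<lambda>z. (Am l i a z)\<^sup>2 * (YY l b i z)\<^sup>2) else 0)"
      by (rule sum.cong) (use cross[OF b] in \<open>auto simp: power2_eq_square mult.assoc\<close>)
    also have "\<dots> = E (\<lambda>z. (Am l i a z)\<^sup>2 * (YY l b i z)\<^sup>2)" using b finite_nb[of i] by (simp add: B_def)
    finally show ?thesis by (simp add: S_def mult_ac)
  qed
  have "E (\<lambda>z. (Am l i a z)\<^sup>2 * (S z)\<^sup>2) = E (\<lambda>z. ((Am l i a z)\<^sup>2 * S z) * (\<Sum>b\<in>B. 1 * YY l b i z))"
    by (simp add: S_def power2_eq_square mult.assoc)
  also have "\<dots> = (\<Sum>b\<in>B. 1 * E (\<lambda>z. ((Am l i a z)\<^sup>2 * S z) * YY l b i z))"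
    by (rule E_lincomb[OF allmom_mult[OF A2 S] Y])
  also have "\<dots> = (\<Sum>b\<in>B. 1 * E (\<lambda>z. (Am l i a z)\<^sup>2 * (YY l b i z)\<^sup>2))" using inner by simp
  also have "\<dots> = E (\<lambda>z. (Am l i a z)\<^sup>2 * (\<Sum>b\<in>B. 1 * (YY l b i z)\<^sup>2))"
    by (rule E_lincomb[OF A2 allmom_power[OF Y], symmetric])
  finally show ?thesis by (simp add: S_def B_def)
qed

text \<open>The average of the squares is replaced by its mean \<open>vbar\<close>. The deviation is
  integrated against A^2 \<le> K^2; the mean is a number, so E[A^2] suffices to evaluate the main
  term, whatever the dependence between A and the squares.\<close>

lemma E_increment_square:
  assumes l: "Suc l < L" and ia: "i \<in> V" "a \<in> nb i"
  defines "vbar \<equiv> (\<Sum>b\<in>nb i - {a}. E2 (YY l b i)) / card (nb i - {a})"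
  shows "\<bar>E (\<lambda>z. (Am l i a z * um (Suc l) i a z)\<^sup>2) - \<delta> / (\<nu> l) * vbar\<bar> \<le> K\<^sup>2 * ((CY + 1) / 2) * \<rho>"
proof -
  define B where "B = nb i - {a}"
  define n where "n = real (card B)"
  have l': "l < L" using l by simp
  note B = nbset[OF nbset_message[OF ia], folded B_def]
  have n: "0 < n" using B by (simp add: n_def)
  note Yf = YY_family[OF l' ia(1) B(2)]
  have A2: "allmom PM (\<lambda>z. (Am l i a z)\<^sup>2)" by (rule allmom_power[OF allmom_Am[OF l']])
  define v where "v b = E2 (YY l b i)" for b
  define Q where "Q z = (\<Sum>b\<in>B. (YY l b i z)\<^sup>2 - v b) / n" for z
  have Q: "allmom PM Q"
    unfolding Q_def by (intro allmom_divide allmom_sum allmom_diff allmom_power Yf allmom_const)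
  have EA: "E2 (Am l i a) = \<delta> / (\<nu> l)"
    using E_A_square[OF l' ia] by (simp add: PM_eq Am_def)
  have "E (\<lambda>z. (Am l i a z * um (Suc l) i a z)\<^sup>2)
      = E (\<lambda>z. (Am l i a z)\<^sup>2 * (\<Sum>b\<in>B. YY l b i z)\<^sup>2 / n)"
    using n unfolding um_eq'[OF ia] B_def[symmetric] n_def
    by (simp add: power_mult_distrib power_divide)
  also have "\<dots> = E (\<lambda>z. (Am l i a z)\<^sup>2 * (\<Sum>b\<in>B. (YY l b i z)\<^sup>2)) / n"
    using E_A_sum_square[OF l ia] by (simp add: B_def)
  also have "\<dots> = E (\<lambda>z. (Am l i a z)\<^sup>2 * (\<Sum>b\<in>B. (YY l b i z)\<^sup>2) / n)" by simp
  also have "\<dots> = E (\<lambda>z. (Am l i a z)\<^sup>2 * Q z + (Am l i a z)\<^sup>2 * vbar)"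
    by (intro Bochner_Integration.integral_cong)
      (simp_all add: Q_def vbar_def v_def B_def n_def sum_subtractf diff_divide_distrib right_diff_distrib)
  also have "\<dots> = E (\<lambda>z. (Am l i a z)\<^sup>2 * Q z) + \<delta> / (\<nu> l) * vbar"
    using allmom_integrable[OF A2] allmom_integrable[OF allmom_mult[OF A2 Q]] EA by simp
  finally have "\<bar>E (\<lambda>z. (Am l i a z * um (Suc l) i a z)\<^sup>2) - \<delta> / (\<nu> l) * vbar\<bar>
      = \<bar>E (\<lambda>z. (Am l i a z)\<^sup>2 * Q z)\<bar>" by simp
  also have "\<dots> \<le> E (\<lambda>z. \<bar>(Am l i a z)\<^sup>2 * Q z\<bar>)" by (rule integral_abs_bound)
  also have "\<dots> \<le> E (\<lambda>z. K\<^sup>2 * \<bar>Q z\<bar>)"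
  proof (rule integral_mono)
    show "integrable PM (\<lambda>z. \<bar>(Am l i a z)\<^sup>2 * Q z\<bar>)" using allmom_integrable[OF allmom_mult[OF A2 Q]] by (rule integrable_abs)
    show "integrable PM (\<lambda>z. K\<^sup>2 * \<bar>Q z\<bar>)" using allmom_integrable[OF Q] by (intro integrable_mult_right integrable_abs)
    fix z
    have "(Am l i a z)\<^sup>2 \<le> K\<^sup>2" using power_mono[OF Am_bound[OF l', of i a z], of 2] by simp
    then show "\<bar>(Am l i a z)\<^sup>2 * Q z\<bar> \<le> K\<^sup>2 * \<bar>Q z\<bar>" by (simp add: abs_mult mult_right_mono)
  qed
  also have "\<dots> = K\<^sup>2 * E (\<lambda>z. \<bar>Q z\<bar>)" by simp
  also have "\<dots> \<le> K\<^sup>2 * ((CY + 1) / (2 * sqrt n))"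
    unfolding Q_def v_def n_def
    by (intro mult_left_mono E_abs_avg_square_dev[where W = "\<lambda>b. branch (Suc l) b i"] Yf B)
      (use E_YY_power4[OF l' ia(1)] B(2) in auto)
  also have "\<dots> = K\<^sup>2 * ((CY + 1) / 2) * (1 / sqrt n)" by simp
  also have "\<dots> \<le> K\<^sup>2 * ((CY + 1) / 2) * \<rho>"
    using B(6) CY_ge1 by (intro mult_left_mono) (auto simp: n_def)
  finally show ?thesis .
qed

text \<open>The increment is orthogonal to the previous iterate, so second moments add. Its own
  second moment is near (delta / nu) \<open>vbar\<close> with \<open>vbar\<close> near nu, that is
  near delta; the cancellation needs nu > 0. The induction follows the recursion of
  \<open>err\<close>, because \<open>vbar\<close> involves two levels.\<close>

lemma zz_close: "nondegenerate \<Longrightarrow> l \<le> L \<Longrightarrow> zz_close l"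
proof (induction l rule: err.induct)
  case 1
  then show ?case by (simp add: zz_close_def zz.simps)
next
  case 2
  then show ?case using E_init_power[of _ 2] gauss_variance[OF delta_pos] by (simp add: zz_close_def zz.simps)
next
  case (3 l)
  have l: "Suc l < L" using 3 by simp
  have c: "zz_close l" "zz_close (Suc l)" using 3 by auto
  show ?case unfolding zz_close_def
  proof (intro ballI)
    fix i a assume ia: "i \<in> V" "a \<in> nb i"
    let ?u = "\<lambda>z. Am l i a z * um (Suc l) i a z"
    define vbar where "vbar = (\<Sum>b\<in>nb i - {a}. E2 (YY l b i)) / card (nb i - {a})"
    have am: "allmom PM (zz (Suc l) i a)" "allmom PM ?u"
      using l ia by (auto intro!: allmom_zz allmom_mult allmom_Am allmom_um)
    have "dep (- (ball (Suc (Suc l)) i a - ball (Suc l) i a)) (zz (Suc l) i a)"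
      by (rule dep_mono[OF dep_zz[of "Suc l" i a]]) (use l ia in auto)
    then have "E (\<lambda>z. zz (Suc l) i a z * (zz (Suc (Suc l)) i a z - zz (Suc l) i a z)) = 0"
      using zz_orth[OF l, unfolded zz_orth_def, rule_format, OF ia am(1)] by simp
    then have cross: "E (\<lambda>z. zz (Suc l) i a z * ?u z) = 0" by (simp add: zz_Suc_Suc)
    have "(zz (Suc (Suc l)) i a z)\<^sup>2 = (zz (Suc l) i a z)\<^sup>2 + 2 * (zz (Suc l) i a z * ?u z) + (?u z)\<^sup>2" for z
      by (simp only: zz_Suc_Suc power2_sum)
    then have dec: "E (\<lambda>z. (zz (Suc (Suc l)) i a z)\<^sup>2) = E2 (zz (Suc l) i a) + E (\<lambda>z. (?u z)\<^sup>2)"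
      using allmomD[OF am(1), of 2] allmomD[OF am(2), of 2] allmom_integrable[OF allmom_mult[OF am]] cross by simp
    define q where "q = \<delta> / (\<nu> l)"
    have nu: "0 < (\<nu> l)" using nu_pos 3 by blast
    have q: "0 \<le> q" "q * (\<nu> l) = \<delta>" using nu delta_pos by (auto simp: q_def)
    have "\<bar>vbar - (\<nu> l)\<bar> \<le> (var_err (err (Suc l)) + var_err (err l)) * \<rho>"
      unfolding vbar_def by (rule avg_YY[OF _ nbset_message[OF ia] c]) (use l in simp)
    then have "q * \<bar>vbar - (\<nu> l)\<bar> \<le> q * ((var_err (err (Suc l)) + var_err (err l)) * \<rho>)"
      using q by (intro mult_left_mono)
    then have 1: "\<bar>q * vbar - \<delta>\<bar> \<le> q * ((var_err (err (Suc l)) + var_err (err l)) * \<rho>)"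
      using q by (simp add: abs_mult_pos' flip: right_diff_distrib) (simp add: right_diff_distrib)
    have 2: "\<bar>E (\<lambda>z. (?u z)\<^sup>2) - q * vbar\<bar> \<le> K\<^sup>2 * ((CY + 1) / 2) * \<rho>"
      unfolding q_def vbar_def by (rule E_increment_square[OF l ia])
    have 4: "\<bar>E2 (zz (Suc l) i a) - real (Suc l) * \<delta>\<bar> \<le> err (Suc l) * \<rho>"
      using c(2) ia unfolding zz_close_def by blast
    have e: "err (Suc (Suc l)) * \<rho> = err (Suc l) * \<rho> + q * ((var_err (err (Suc l)) + var_err (err l)) * \<rho>) + K\<^sup>2 * ((CY + 1) / 2) * \<rho>"
      by (simp add: q_def algebra_simps)
    have s: "real (Suc (Suc l)) * \<delta> = real (Suc l) * \<delta> + \<delta>" by (simp add: algebra_simps)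
    show "\<bar>E (\<lambda>z. (zz (Suc (Suc l)) i a z)\<^sup>2) - real (Suc (Suc l)) * \<delta>\<bar> \<le> err (Suc (Suc l)) * \<rho>"
      unfolding dec e s using 1 2 4 by linarith
  qed
qed

end

section \<open>Gaussian limit\<close>

lemma exp_minus_lipschitz:
  fixes a b :: real
  assumes "0 \<le> a" "0 \<le> b"
  shows "\<bar>exp (- a) - exp (- b)\<bar> \<le> \<bar>a - b\<bar>"
proof -
  have *: "exp (- a) - exp (- b) \<le> b - a \<and> exp (- b) \<le> exp (- a)" if "0 \<le> a" "a \<le> b" for a b :: real
  proof
    have "exp (- a) - exp (- b) = exp (- a) * (1 - exp (- (b - a)))"
      by (simp add: right_diff_distrib flip: exp_add)
    also have "\<dots> \<le> 1 * (1 - exp (- (b - a)))"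
      using that by (intro mult_right_mono) auto
    also have "\<dots> \<le> b - a"
    proof -
      have "1 - exp (- x) \<le> x" for x :: real using exp_ge_add_one_self[of "- x"] by linarith
      then show ?thesis unfolding mult_1 .
    qed
    finally show "exp (- a) - exp (- b) \<le> b - a" .
  qed (use that in simp)
  show ?thesis using *[of a b] *[of b a] assms by (cases "a \<le> b") auto
qed

text \<open>Variance 0 is included, where \<open>gauss\<close> is the point mass at 0: in the
  degenerate case all limit variances vanish.\<close>

lemma char_gauss:
  assumes "0 \<le> v"
  shows "(\<integral>x. iexp (\<theta> * x) \<partial>gauss v) = of_real (exp (- (\<theta>\<^sup>2 * v) / 2))"
proof (cases "v = 0")
  case True
  have "(\<integral>x. iexp (\<theta> * x) \<partial>return borel 0) = iexp (\<theta> * 0)"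
    by (rule integral_return) auto
  then show ?thesis using True by (simp add: gauss_def)
next
  case False
  then have v: "0 < v" using assms by simp
  interpret prob_space "gauss v" by (rule prob_space_gauss)
  have "distributed (gauss v) lborel (\<lambda>x. x) (normal_density 0 (sqrt v))"
    unfolding distributed_def by (auto simp: gauss_eq[OF v] distr_id2)
  then have "distributed (gauss v) lborel (\<lambda>x. (x - 0) / sqrt v) std_normal_density"
    using v by (subst (asm) normal_standard_normal_convert) auto
  then have d: "distr (gauss v) lborel (\<lambda>x. x / sqrt v) = std_normal_distribution"
    by (simp add: distributed_def)
  have "char std_normal_distribution (\<theta> * sqrt v) = (\<integral>x. iexp (\<theta> * sqrt v * (x / sqrt v)) \<partial>gauss v)"
    unfolding char_def d[symmetric] by (rule integral_distr) auto
  also have "\<dots> = (\<integral>x. iexp (\<theta> * x) \<partial>gauss v)" using v by (simp add: field_simps)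
  finally show ?thesis using v by (simp add: char_std_normal_distribution power_mult_distrib)
qed

lemma gauss_moment4_integrable:
  assumes "0 \<le> v"
  shows "integrable (gauss v) (\<lambda>x. x ^ 4)"
proof (cases "v = 0")
  case True
  interpret prob_space "return borel (0::real)" by (rule prob_space_return) simp
  have "integrable (return borel (0::real)) (\<lambda>x. x ^ 4)"
    by (rule integrable_const_bound[of _ 0]) (auto simp: AE_return)
  then show ?thesis using True by (simp add: gauss_def)
next
  case False
  then show ?thesis using assms by (intro gauss_moment) simp
qed

lemma iexp_gauss_integrable: "integrable (gauss v) (\<lambda>x. iexp (\<theta> * x))"
proof -
  interpret prob_space "gauss v" by (rule prob_space_gauss)
  have "(\<lambda>x. iexp (\<theta> * x)) \<in> borel_measurable (gauss v)"
    unfolding measurable_cong_sets[OF sets_gauss refl] by measurable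
  then show ?thesis by (intro integrable_const_bound[of _ 1]) auto
qed

context amp_params
begin

text \<open>The square comes from \<open>char_sum_approx\<close>, applied with a fourth-moment bound
  for a combination of l coordinates (hence l^3); the second sum is the effect of the error in the
  variances.\<close>

definition char_const :: "nat \<Rightarrow> (nat \<Rightarrow> real) \<Rightarrow> real" where
  "char_const l \<theta> = (1 + real l ^ 3 * (\<Sum>t<l. \<theta> t ^ 4 * CY))\<^sup>2
     + (\<Sum>t<l. (\<theta> t)\<^sup>2 * (var_err (err (Suc t)) + var_err (err t)))"

text \<open>One bound for both sides of the comparison: the first summand covers the
  \<open>u\<close> at finite d, the second the Gaussian limit.\<close>

definition mom_bound :: "nat \<Rightarrow> real" where
  "mom_bound l = 3 * CY\<^sup>2 + (\<Sum>t<l. \<integral>x. x ^ 4 \<partial>gauss ((\<nu> t)))"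

lemma char_const_nonneg: "0 \<le> char_const l \<theta>"
  unfolding char_const_def
  by (intro add_nonneg_nonneg sum_nonneg mult_nonneg_nonneg var_err_nonneg err_nonneg) auto

lemma limit_measure_component:
  assumes "t < l"
  shows "distr (limit_measure r f \<delta> l) (gauss ((\<nu> t))) (\<lambda>x. x t) = gauss ((\<nu> t))"
proof -
  interpret PP: product_prob_space "\<lambda>t. gauss ((\<nu> t))" "{..<l}"
    by (rule product_prob_spaceI) (rule prob_space_gauss)
  show ?thesis unfolding limit_measure_def using PP.PiM_component[of t] assms by simp
qed

lemma fourth_moments_limit: "fourth_moments_le l (mom_bound l) (limit_measure r f \<delta> l)"
  unfolding fourth_moments_le_def
proof (intro conjI allI impI)
  show "prob_space (limit_measure r f \<delta> l)"
    unfolding limit_measure_def by (rule prob_space_PiM) (rule prob_space_gauss)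
  show "sets (limit_measure r f \<delta> l) = sets (PiM {..<l} (\<lambda>_. borel))"
    unfolding limit_measure_def by (rule sets_PiM_cong) auto
  fix t assume t: "t < l"
  let ?g = "gauss ((\<nu> t))"
  have m: "(\<lambda>x. x t) \<in> measurable (limit_measure r f \<delta> l) ?g"
    unfolding limit_measure_def using t by (intro measurable_component_singleton) auto
  have g: "(\<lambda>x. x ^ 4) \<in> borel_measurable ?g"
    unfolding measurable_cong_sets[OF sets_gauss refl] by measurable
  show "integrable (limit_measure r f \<delta> l) (\<lambda>x. x t ^ 4)"
    using integrable_distr_eq[OF m g] gauss_moment4_integrable[OF nu_nonneg[of t]]
    unfolding limit_measure_component[OF t] by simp
  have "(\<integral>x. x t ^ 4 \<partial>limit_measure r f \<delta> l) = (\<integral>x. x ^ 4 \<partial>?g)"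
    using integral_distr[OF m g] unfolding limit_measure_component[OF t] by simp
  also have "\<dots> \<le> (\<Sum>t<l. \<integral>x. x ^ 4 \<partial>gauss ((\<nu> t)))"
    using t by (intro member_le_sum) (auto intro: integral_nonneg_AE)
  also have "\<dots> \<le> mom_bound l" by (simp add: mom_bound_def)
  finally show "(\<integral>x. x t ^ 4 \<partial>limit_measure r f \<delta> l) \<le> mom_bound l" .
qed

lemma char_limit:
  "char_fn l \<theta> (limit_measure r f \<delta> l)
     = of_real (exp (- (\<Sum>t<l. (\<theta> t)\<^sup>2 * (\<nu> t)) / 2))"
proof -
  interpret PP: product_prob_space "\<lambda>t. gauss ((\<nu> t))" "{..<l}"
    by (rule product_prob_spaceI) (rule prob_space_gauss)
  have "(\<integral>x. (\<Prod>t<l. iexp (\<theta> t * x t)) \<partial>limit_measure r f \<delta> l)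
      = (\<Prod>t<l. \<integral>x. iexp (\<theta> t * x) \<partial>gauss ((\<nu> t)))"
    unfolding limit_measure_def by (rule PP.product_integral_prod) (rule finite_lessThan, rule iexp_gauss_integrable)
  also have "\<dots> = (\<Prod>t<l. of_real (exp (- ((\<theta> t)\<^sup>2 * (\<nu> t)) / 2)))"
    by (intro prod.cong refl char_gauss nu_nonneg)
  also have "\<dots> = of_real (exp (\<Sum>t<l. - ((\<theta> t)\<^sup>2 * (\<nu> t)) / 2))"
    by (simp only: of_real_prod[symmetric] exp_sum[OF finite_lessThan])
  also have "(\<Sum>t<l. - ((\<theta> t)\<^sup>2 * (\<nu> t)) / 2) = - (\<Sum>t<l. (\<theta> t)\<^sup>2 * (\<nu> t)) / 2"
    by (simp add: sum_divide_distrib sum_negf)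
  finally have "(\<integral>x. (\<Prod>t<l. iexp (\<theta> t * x t)) \<partial>limit_measure r f \<delta> l)
      = of_real (exp (- (\<Sum>t<l. (\<theta> t)\<^sup>2 * (\<nu> t)) / 2))" .
  moreover have "(\<Prod>t<l. iexp (\<theta> t * x t)) = iexp (phase l \<theta> x)" for x
    by (simp add: phase_def sum_distrib_left exp_sum)
  ultimately show ?thesis by simp
qed

end

section \<open>Characteristic functions of the normalised sums\<close>

context amp
begin

text \<open>Index \<open>t\<close> stands for u^(t+1).\<close>

definition UU :: "nat \<Rightarrow> nat set \<Rightarrow> nat \<Rightarrow> (nat \<Rightarrow> real) \<Rightarrow> real" where
  "UU i B t z = (\<Sum>b\<in>B. YY t b i z) / sqrt (card B)"

text \<open>For s < t the earlier increment lives on balls of radius s + 1 \<le> t, hence avoids the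
  shells reached at step t.\<close>

lemma E_YY_YY:
  assumes "s < L" "t < L" "i \<in> V" "b \<in> nb i" "s \<noteq> t"
  shows "E (\<lambda>z. YY s b i z * YY t b i z) = 0"
proof -
  have *: "E (\<lambda>z. YY s b i z * YY t b i z) = 0" if "s < t" "t < L" for s t
  proof (rule YY_orth[OF that(2) assms(3,4)])
    show "allmom PM (YY s b i)" "dep (branch (Suc s) b i) (YY s b i)"
      using allmom_YY dep_YY that assms(4) by auto
    have "ball (Suc s) (vtx b \<kappa>) b \<inter> (ball (Suc t) (vtx b \<kappa>') b - ball t (vtx b \<kappa>') b) = {}"
      if k: "\<kappa> \<in> oth b i" "\<kappa>' \<in> oth b i" for \<kappa> \<kappa>'
    proof (cases "\<kappa> = \<kappa>'")
      case True
      then show ?thesis using ball_mono[of "Suc s" t "vtx b \<kappa>" b] \<open>s < t\<close> by auto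
    next
      case False
      then show ?thesis
        using ball_disjoint[OF assms(3,4) k(1) assms(4) k(2), of "Suc s" "Suc t"] \<open>s < t\<close> \<open>t < L\<close> by auto
    qed
    then show "branch (Suc s) b i \<inter> (\<Union>\<kappa>\<in>oth b i. ball (Suc t) (vtx b \<kappa>) b - ball t (vtx b \<kappa>) b) = {}"
      unfolding branch_def by blast
  qed
  show ?thesis
  proof (cases "s < t")
    case True
    then show ?thesis using * assms by blast
  next
    case False
    then have "E (\<lambda>z. YY t b i z * YY s b i z) = 0" using * assms by simp
    then show ?thesis by (simp add: mult.commute)
  qed
qed

text \<open>For fixed frequencies the l sums merge into one sum over factors of independent
  variables \<open>X b\<close>, to which the scalar estimate applies. The coordinates of one factor
  are dependent but uncorrelated, so the variance of \<open>X b\<close> has no mixed terms; this is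
  why the limit has independent coordinates.\<close>

lemma char_UU:
  assumes B: "nbset i B" and l: "l \<le> L"
  shows "cmod (E (\<lambda>z. iexp (phase l \<theta> (\<lambda>t. UU i B t z)))
    - of_real (exp (- (\<Sum>t<l. (\<theta> t)\<^sup>2 * (\<nu> t)) / 2))) \<le> char_const l \<theta> * \<rho>"
proof -
  note nB = nbset[OF B]
  define n where "n = real (card B)"
  have n: "0 < n" using nB by (simp add: n_def)
  define C where "C = 1 + real l ^ 3 * (\<Sum>t<l. \<theta> t ^ 4 * CY)"
  have C: "1 \<le> C" using CY_ge1 by (auto simp: C_def intro!: mult_nonneg_nonneg sum_nonneg)
  define X where "X b z = (\<Sum>t<l. \<theta> t * YY t b i z)" for b z
  have tL: "t < L" if "t \<in> {..<l}" for t using that l by simp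
  have bn: "b \<in> nb i" if "b \<in> B" for b using nB that by blast
  have Y: "allmom PM (YY t b i)" if "t \<in> {..<l}" "b \<in> B" for t b
    by (rule allmom_YY[OF tL[OF that(1)] bn[OF that(2)]])
  have X: "allmom PM (X b)" if "b \<in> B" for b
    unfolding X_def by (intro allmom_sum allmom_cmult Y that)
  have Xdep: "dep (branch l b i) (X b)" if b: "b \<in> B" for b
    unfolding X_def
  proof (intro dep_sum dep_comp2[where g = "(*)"] dep_const)
    fix t assume t: "t \<in> {..<l}"
    show "dep (branch l b i) (YY t b i)"
      by (rule dep_mono[OF dep_YY[OF tL[OF t] bn[OF b]] branch_mono]) (use t in simp)
  qed
  have EX: "E (X b) = 0" if b: "b \<in> B" for b
  proof -
    have "E (X b) = (\<Sum>t<l. E (\<lambda>z. \<theta> t * YY t b i z))"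
      unfolding X_def by (rule Bochner_Integration.integral_sum) (intro integrable_mult_right allmom_integrable Y b)
    also have "\<dots> = 0" by (rule sum.neutral) (use E_YY[OF tL nB(1) bn[OF b]] in auto)
    finally show ?thesis .
  qed
  have EX2: "E2 (X b) = (\<Sum>t<l. (\<theta> t)\<^sup>2 * E2 (YY t b i))" if b: "b \<in> B" for b
  proof -
    have inner: "E (\<lambda>z. X b z * YY t b i z) = \<theta> t * E2 (YY t b i)" if t: "t \<in> {..<l}" for t
    proof -
      have "E (\<lambda>z. YY t b i z * (\<Sum>s<l. \<theta> s * YY s b i z)) = (\<Sum>s<l. \<theta> s * E (\<lambda>z. YY t b i z * YY s b i z))"
        by (rule E_lincomb[OF Y[OF t b] Y[OF _ b]])
      also have "\<dots> = (\<Sum>s<l. if s = t then \<theta> t * E2 (YY t b i) else 0)"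
        by (rule sum.cong) (use E_YY_YY[OF tL[OF t] tL nB(1) bn[OF b]] in \<open>auto simp: power2_eq_square\<close>)
      also have "\<dots> = \<theta> t * E2 (YY t b i)" using t by simp
      finally show ?thesis by (simp add: X_def mult.commute)
    qed
    have "E2 (X b) = E (\<lambda>z. X b z * (\<Sum>t<l. \<theta> t * YY t b i z))"
      by (simp add: X_def power2_eq_square)
    also have "\<dots> = (\<Sum>t<l. \<theta> t * E (\<lambda>z. X b z * YY t b i z))"
      by (rule E_lincomb[OF X[OF b] Y[OF _ b]])
    also have "\<dots> = (\<Sum>t<l. (\<theta> t)\<^sup>2 * E2 (YY t b i))"
      by (rule sum.cong) (simp_all add: inner power2_eq_square)
    finally show ?thesis .
  qed
  have EX4: "E4 (X b) \<le> C" if b: "b \<in> B" for b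
  proof -
    have i4: "integrable PM (\<lambda>z. YY t b i z ^ 4)" if "t \<in> {..<l}" for t by (rule allmomD[OF Y[OF that b]])
    have "E4 (X b) \<le> E (\<lambda>z. real l ^ 3 * (\<Sum>t<l. \<theta> t ^ 4 * YY t b i z ^ 4))"
    proof (rule integral_mono)
      show "integrable PM (\<lambda>z. X b z ^ 4)" by (rule allmomD[OF X[OF b]])
      show "integrable PM (\<lambda>z. real l ^ 3 * (\<Sum>t<l. \<theta> t ^ 4 * YY t b i z ^ 4))"
        by (intro integrable_mult_right Bochner_Integration.integrable_sum i4)
      show "X b z ^ 4 \<le> real l ^ 3 * (\<Sum>t<l. \<theta> t ^ 4 * YY t b i z ^ 4)" for z
        using sum_power4_le[of "\<lambda>t. \<theta> t * YY t b i z" "{..<l}"] by (simp add: X_def power_mult_distrib)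
    qed
    also have "\<dots> = real l ^ 3 * (\<Sum>t<l. \<theta> t ^ 4 * E4 (YY t b i))"
      using i4 by (subst integral_mult_right_zero, subst Bochner_Integration.integral_sum) auto
    also have "\<dots> \<le> real l ^ 3 * (\<Sum>t<l. \<theta> t ^ 4 * CY)"
      using E_YY_power4[OF tL nB(1) bn[OF b]] by (intro mult_left_mono sum_mono) auto
    finally show ?thesis by (simp add: C_def)
  qed
  define q where "q = (\<Sum>b\<in>B. E2 (X b)) / n"
  define p where "p = (\<Sum>t<l. (\<theta> t)\<^sup>2 * (\<nu> t))"
  have "cmod (E (\<lambda>z. iexp ((\<Sum>b\<in>B. X b z) / sqrt n)) - of_real (exp (- q / 2))) \<le> C\<^sup>2 / sqrt n"
    unfolding q_def n_def
    using char_sum_approx[OF nB(4,3) Xdep branch_disjoint_family[OF nB(1,2) l] X EX C EX4] by simp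
  also have "\<dots> \<le> C\<^sup>2 * \<rho>"
    using mult_left_mono[OF nB(6), of "C\<^sup>2"] by (simp add: n_def)
  finally have 1: "cmod (E (\<lambda>z. iexp ((\<Sum>b\<in>B. X b z) / sqrt n)) - of_real (exp (- q / 2))) \<le> C\<^sup>2 * \<rho>" .
  have "(\<Sum>b\<in>B. X b z) / sqrt n = phase l \<theta> (\<lambda>t. UU i B t z)" for z
  proof -
    have "(\<Sum>b\<in>B. X b z) = (\<Sum>t<l. \<theta> t * (\<Sum>b\<in>B. YY t b i z))"
      unfolding X_def by (subst sum.swap) (simp add: sum_distrib_left)
    then show ?thesis by (simp add: phase_def UU_def n_def sum_divide_distrib[of _ "{..<l}"])
  qed
  note ph = this
  have q_alt: "q = (\<Sum>t<l. (\<theta> t)\<^sup>2 * ((\<Sum>b\<in>B. E2 (YY t b i)) / n))"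
  proof -
    have "(\<Sum>b\<in>B. E2 (X b)) = (\<Sum>b\<in>B. \<Sum>t<l. (\<theta> t)\<^sup>2 * E2 (YY t b i))"
      by (rule sum.cong) (simp_all add: EX2)
    also have "\<dots> = (\<Sum>t<l. (\<theta> t)\<^sup>2 * (\<Sum>b\<in>B. E2 (YY t b i)))"
      by (subst sum.swap) (simp add: sum_distrib_left)
    finally show ?thesis by (simp add: q_def sum_divide_distrib[of _ "{..<l}"])
  qed
  have "\<bar>q - p\<bar> \<le> (\<Sum>t<l. (\<theta> t)\<^sup>2 * (var_err (err (Suc t)) + var_err (err t))) * \<rho>"
  proof -
    have "q - p = (\<Sum>t<l. (\<theta> t)\<^sup>2 * ((\<Sum>b\<in>B. E2 (YY t b i)) / n - (\<nu> t)))"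
      unfolding q_alt p_def by (simp add: right_diff_distrib sum_subtractf)
    then have "\<bar>q - p\<bar> \<le> (\<Sum>t<l. (\<theta> t)\<^sup>2 * \<bar>(\<Sum>b\<in>B. E2 (YY t b i)) / n - (\<nu> t)\<bar>)"
      by (simp only:) (rule order_trans[OF sum_abs], simp add: abs_mult)
    also have "\<dots> \<le> (\<Sum>t<l. (\<theta> t)\<^sup>2 * ((var_err (err (Suc t)) + var_err (err t)) * \<rho>))"
    proof (rule sum_mono, rule mult_left_mono)
      fix t assume "t \<in> {..<l}"
      then have t: "t < L" by (rule tL)
      show "\<bar>(\<Sum>b\<in>B. E2 (YY t b i)) / n - (\<nu> t)\<bar> \<le> (var_err (err (Suc t)) + var_err (err t)) * \<rho>"
        unfolding n_def by (rule avg_YY[OF t B]) (use zz_close t in auto)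
    qed simp
    finally show ?thesis by (simp add: sum_distrib_right mult.assoc)
  qed
  note qp = this
  have q0: "0 \<le> q" unfolding q_def using n by (intro divide_nonneg_nonneg sum_nonneg) (auto intro: integral_nonneg_AE)
  have p0: "0 \<le> p" unfolding p_def by (intro sum_nonneg mult_nonneg_nonneg nu_nonneg) auto
  have "cmod (of_real (exp (- q / 2)) - of_real (exp (- p / 2))) = \<bar>exp (- (q / 2)) - exp (- (p / 2))\<bar>"
    by (simp flip: of_real_diff)
  also have "\<dots> \<le> \<bar>q / 2 - p / 2\<bar>" by (rule exp_minus_lipschitz) (use q0 p0 in auto)
  also have "\<dots> \<le> \<bar>q - p\<bar>" by linarith
  also note qp
  finally have 2: "cmod (of_real (exp (- q / 2)) - of_real (exp (- p / 2)))
    \<le> (\<Sum>t<l. (\<theta> t)\<^sup>2 * (var_err (err (Suc t)) + var_err (err t))) * \<rho>" .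
  have cc: "char_const l \<theta> * \<rho> = C\<^sup>2 * \<rho> + (\<Sum>t<l. (\<theta> t)\<^sup>2 * (var_err (err (Suc t)) + var_err (err t))) * \<rho>"
    unfolding char_const_def C_def by (simp only: distrib_right)
  have tri: "cmod (u - w) \<le> cmod (u - v) + cmod (v - w)" for u v w
    using norm_triangle_ineq[of "u - v" "v - w"] by simp
  show ?thesis
    unfolding cc p_def[symmetric] ph[symmetric] by (rule order_trans[OF tri add_mono[OF 1 2]])
qed

definition NU :: "nat \<Rightarrow> nat set \<Rightarrow> nat \<Rightarrow> (nat \<Rightarrow> real) measure" where
  "NU i B l = distr PM (PiM {..<l} (\<lambda>_. borel)) (\<lambda>z. \<lambda>t\<in>{..<l}. UU i B t z)"

lemma UU_measurable:
  assumes "nbset i B" "l \<le> L"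
  shows "(\<lambda>z. \<lambda>t\<in>{..<l}. UU i B t z) \<in> measurable PM (PiM {..<l} (\<lambda>_. borel))"
proof (rule measurable_restrict)
  fix t assume "t \<in> {..<l}"
  then have "allmom PM (UU i B t)"
    unfolding UU_def using assms(2) nbset(2)[OF assms(1)]
    by (intro allmom_divide allmom_sum allmom_YY) auto
  then show "UU i B t \<in> borel_measurable PM" by (rule allmom_measurable)
qed

lemma fourth_moments_NU:
  assumes B: "nbset i B" and l: "l \<le> L"
  shows "fourth_moments_le l (mom_bound l) (NU i B l)"
  unfolding fourth_moments_le_def
proof (intro conjI allI impI)
  note m = UU_measurable[OF assms]
  show "prob_space (NU i B l)" unfolding NU_def using m by (rule prob_space_distr)
  show "sets (NU i B l) = sets (PiM {..<l} (\<lambda>_. borel))" by (simp add: NU_def)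
  fix t assume t: "t < l"
  then have tL: "t < L" using l by simp
  have g: "(\<lambda>x. x t ^ 4) \<in> borel_measurable (PiM {..<l} (\<lambda>_. borel :: real measure))"
    using t by (intro borel_measurable_power measurable_component_singleton) auto
  have U: "allmom PM (UU i B t)"
    unfolding UU_def using tL nbset(2)[OF B]
    by (intro allmom_divide allmom_sum allmom_YY) auto
  show "integrable (NU i B l) (\<lambda>x. x t ^ 4)"
    using integrable_distr_eq[OF m g] allmomD[OF U, of 4] t unfolding NU_def by simp
  have "(\<integral>x. x t ^ 4 \<partial>NU i B l) = E4 (UU i B t)"
    using integral_distr[OF m g] t unfolding NU_def by simp
  also have "\<dots> \<le> 3 * CY\<^sup>2"
    unfolding UU_def
    by (rule E_avg_YY_power4[OF tL nbset(1,2,3)[OF B] CY_ge1 E_YY_power4[OF tL nbset(1)[OF B]]])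
  also have "\<dots> \<le> mom_bound l"
    unfolding mom_bound_def by (simp add: sum_nonneg integral_nonneg_AE)
  finally show "(\<integral>x. x t ^ 4 \<partial>NU i B l) \<le> mom_bound l" .
qed

lemma char_NU:
  assumes "nbset i B" "l \<le> L"
  shows "cmod (char_fn l \<theta> (NU i B l) - char_fn l \<theta> (limit_measure r f \<delta> l))
    \<le> char_const l \<theta> * \<rho>"
proof -
  have "phase l \<theta> \<in> borel_measurable (PiM {..<l} (\<lambda>_. borel))"
    unfolding phase_def by (intro borel_measurable_sum borel_measurable_times) auto
  then have "(\<lambda>x. iexp (phase l \<theta> x)) \<in> borel_measurable (PiM {..<l} (\<lambda>_. borel))" by measurable
  from integral_distr[OF UU_measurable[OF assms] this]
  have "char_fn l \<theta> (NU i B l) = E (\<lambda>z. iexp (phase l \<theta> (\<lambda>t. UU i B t z)))"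
    unfolding NU_def by (simp add: phase_def)
  then show ?thesis using char_UU[OF assms] unfolding char_limit by simp
qed

lemma E_psi_UU:
  assumes "nbset i B" "l \<le> L" "pseudo_lipschitz l \<psi>"
  shows "(\<integral>x. \<psi> x \<partial>NU i B l) = (\<integral>z. \<psi> (\<lambda>t\<in>{..<l}. UU i B t z) \<partial>init_measure V \<delta>)"
  using integral_distr[OF UU_measurable[OF assms(1,2)] pseudo_lipschitz_measurable[OF assms(3)]]
  unfolding NU_def PM_eq .

end

theorem mainTheorem3:
  fixes r :: nat and f :: "(nat \<Rightarrow> real) \<Rightarrow> real" and \<delta> K :: real and L :: nat
  assumes r2: "r \<ge> 2"
    and f01: "\<forall>x\<in>cube r. f x \<in> {0, 1}"
    and no_deg1: "\<forall>S. S \<subseteq> {..<r} \<and> card S = 1 \<longrightarrow> fhat r f S = 0"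
    and delta_pos: "\<delta> > 0"
    and K_pos: "K > 0"
    and L_def: "L = nat \<lfloor>1 / \<delta>\<rfloor>"
  shows "\<forall>l\<in>{1..L}. \<forall>\<psi>. pseudo_lipschitz l \<psi> \<longrightarrow>
    (\<forall>\<epsilon>>0. \<exists>D::nat. \<forall>d V Fc vtx Fm Fn i a.
       D \<le> d \<and>
       index_regular_hypergraph r d V Fc vtx \<and>
       (\<forall>k < 4 * L + 4. \<not> fg_has_cycle_of_length r V Fc vtx k) \<and>
       admissible_nonlin K L Fm \<and> admissible_nonlin K L Fn \<and>
       property_P2 r f \<delta> L d V Fc vtx Fm Fn \<and>
       i \<in> V \<and> a \<in> nbhd r Fc vtx i
       \<longrightarrow>
       \<bar>(\<integral>z0. \<psi> (\<lambda>t\<in>{..<l}. u_msg r f d Fc vtx Fm z0 (Suc t) i a) \<partial>init_measure V \<delta>)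
          - (\<integral>U. \<psi> U \<partial>limit_measure r f \<delta> l)\<bar> < \<epsilon> \<and>
       \<bar>(\<integral>z0. \<psi> (\<lambda>t\<in>{..<l}. u_node r f d Fc vtx Fm z0 (Suc t) i) \<partial>init_measure V \<delta>)
          - (\<integral>U. \<psi> U \<partial>limit_measure r f \<delta> l)\<bar> < \<epsilon>)"
proof (intro ballI allI impI, goal_cases)
  case (1 l \<psi> \<epsilon>)
  then have l: "l \<in> {1..L}" and psi: "pseudo_lipschitz l \<psi>" and eps: "\<epsilon> > 0" by auto
  interpret P: amp_params r f \<delta> K L
    by unfold_locales (use assms in auto)
  have mb: "0 \<le> P.mom_bound l"
    by (auto simp: P.mom_bound_def intro!: add_nonneg_nonneg sum_nonneg integral_nonneg_AE)
  from pseudo_lipschitz_comparison[OF psi mb eps] obtain \<Theta> \<eta> where \<Theta>: "finite \<Theta>" "\<eta> > 0"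
    and cmp: "\<forall>N N'. fourth_moments_le l (P.mom_bound l) N \<and> fourth_moments_le l (P.mom_bound l) N' \<and>
      (\<forall>\<theta>\<in>\<Theta>. cmod (char_fn l \<theta> N - char_fn l \<theta> N') \<le> \<eta>) \<longrightarrow>
      \<bar>(\<integral>x. \<psi> x \<partial>N) - (\<integral>x. \<psi> x \<partial>N')\<bar> < \<epsilon>"
    by (elim exE conjE)
  \<comment> \<open>One constant for all the finitely many frequencies.\<close>
  define c where "c = (\<Sum>\<theta>\<in>\<Theta>. P.char_const l \<theta>)"
  have c: "P.char_const l \<theta> \<le> c" if "\<theta> \<in> \<Theta>" for \<theta>
    unfolding c_def using that \<Theta>(1) P.char_const_nonneg by (intro member_le_sum) auto
  have c0: "0 \<le> c" unfolding c_def by (intro sum_nonneg P.char_const_nonneg)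
  \<comment> \<open>Chosen so that c / sqrt (d - 1) \<le> \<open>\<eta>\<close> for d \<ge> D; the
    summand 2 also secures d \<ge> 2. Nothing here refers to the hypergraph or the
    nonlinearities.\<close>
  define D where "D = nat \<lceil>(c / \<eta>)\<^sup>2\<rceil> + 2"
  show ?case
  proof (rule exI[of _ D], intro allI impI, elim conjE)
    fix d V Fc vtx Fm Fn i a
    assume D: "D \<le> d" and reg: "index_regular_hypergraph r d V Fc vtx"
      and girth: "\<forall>k < 4 * L + 4. \<not> fg_has_cycle_of_length r V Fc vtx k"
      and adm: "admissible_nonlin K L Fm" and P2: "property_P2 r f \<delta> L d V Fc vtx Fm Fn"
      and ia: "i \<in> V" "a \<in> nbhd r Fc vtx i"
    interpret amp r f \<delta> K L d V Fc vtx Fm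
    proof unfold_locales
      show "2 \<le> d" using D by (simp add: D_def)
      show "(\<integral>z. (A_msg r f d Fc vtx Fm z k i a)\<^sup>2 \<partial>init_measure V \<delta>) = \<delta> / nu r f \<delta> (Suc k)"
        if "k < L" "i \<in> V" "a \<in> nbhd r Fc vtx i" for k i a
        using P2 that unfolding property_P2_def by blast
    qed (use reg girth adm in auto)
    have "c / \<eta> \<le> sqrt (real d - 1)"
    proof (rule real_le_rsqrt)
      have "(c / \<eta>)\<^sup>2 \<le> real (nat \<lceil>(c / \<eta>)\<^sup>2\<rceil>)" by linarith
      also have "\<dots> \<le> real d - 1" using D by (simp add: D_def)
      finally show "(c / \<eta>)\<^sup>2 \<le> real d - 1" .
    qed
    moreover have "0 < sqrt (real d - 1)" using d2 by simp
    ultimately have crho: "c * \<rho> \<le> \<eta>" using \<Theta>(2) by (simp add: \<rho>_def field_simps)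
    have main: "\<bar>(\<integral>z0. \<psi> (\<lambda>t\<in>{..<l}. UU i B t z0) \<partial>init_measure V \<delta>) - (\<integral>U. \<psi> U \<partial>limit_measure r f \<delta> l)\<bar> < \<epsilon>"
      if B: "nbset i B" for B
    proof -
      have lL: "l \<le> L" using l by simp
      show ?thesis
        unfolding E_psi_UU[OF B lL psi, symmetric]
      proof (rule cmp[rule_format, OF conjI[OF fourth_moments_NU[OF B lL] conjI[OF P.fourth_moments_limit ballI]]])
        fix \<theta> assume \<theta>: "\<theta> \<in> \<Theta>"
        have "P.char_const l \<theta> * \<rho> \<le> c * \<rho>" using c[OF \<theta>] rho(1) by (intro mult_right_mono) auto
        then show "cmod (char_fn l \<theta> (NU i B l) - char_fn l \<theta> (limit_measure r f \<delta> l)) \<le> \<eta>"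
          using char_NU[OF B lL, of \<theta>] crho by linarith
      qed
    qed
    have msg: "u_msg r f d Fc vtx Fm z (Suc t) i a = UU i (nb i - {a}) t z" for t z
      using um_eq'[OF ia] by (simp add: um_def UU_def)
    have node: "u_node r f d Fc vtx Fm z (Suc t) i = UU i (nb i) t z" for t z
      by (simp add: u_node_eq UU_def card_nb[OF ia(1)])
    show "\<bar>(\<integral>z0. \<psi> (\<lambda>t\<in>{..<l}. u_msg r f d Fc vtx Fm z0 (Suc t) i a) \<partial>init_measure V \<delta>)
          - (\<integral>U. \<psi> U \<partial>limit_measure r f \<delta> l)\<bar> < \<epsilon> \<and>
       \<bar>(\<integral>z0. \<psi> (\<lambda>t\<in>{..<l}. u_node r f d Fc vtx Fm z0 (Suc t) i) \<partial>init_measure V \<delta>)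
          - (\<integral>U. \<psi> U \<partial>limit_measure r f \<delta> l)\<bar> < \<epsilon>"
      unfolding msg node using main[OF nbset_message[OF ia]] main[OF nbset_node[OF ia]] by blast
  qed
qed

end
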